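(* Let $\mathbf{S}=(\{A_\sigma,K_\sigma,B_\sigma\}_{\sigma=1}^{n_\mu},C,D,F,\mathbf{v})$ be a sGLSS of $(\mathbf{y},\mathbf{u},\boldsymbol{\mu})$. Then $\mathbf{S}_d=(\{A_\sigma,B_\sigma\}_{\sigma=1}^{n_\mu},C,D,\mathbf{u})$ is an asGLSS of $(\mathbf{y}^d,\boldsymbol{\mu})$ (with noise process $\mathbf{u}$), and $\mathbf{S}_s=(\{A_\sigma,K_\sigma\}_{\sigma=1}^{n_\mu},C,F,\mathbf{v})$ is an asGLSS of $(\mathbf{y}^s,\boldsymbol{\mu})$ (with noise process $\mathbf{v}$).
   Context: All random variables live on a fixed probability space; all processes are indexed by $t\in\mathbb{Z}$. Processes $\mathbf{u},\mathbf{y},\boldsymbol{\mu}=(\boldsymbol{\mu}_1,\dots,\boldsymbol{\mu}_{n_\mu})^T$ take values in $\mathbb{R}^{n_u},\mathbb{R}^{n_y},\mathbb{R}^{n_\mu}$. Words. $\Sigma=\{1,\dots,n_\mu\}$; $\Sigma^+$ is the set of nonempty finite words over $\Sigma$, $\epsilon$ is the empty word, $\Sigma^*=\Sigma^+\cup\{\epsilon\}$, $|w|$ is the length of $w$, and juxtaposition is concatenation. For square matrices $\{A_\sigma\}$ and $w=\sigma_1\cdots\sigma_k$, $A_w=A_{\sigma_k}\cdots A_{\sigma_1}$, $A_\epsilon=I$. For $w=\sigma_1\cdots\sigma_k\in\Sigma^+$, $\boldsymbol{\mu}_w(t)=\boldsymbol{\mu}_{\sigma_1}(t-k+1)\boldsymbol{\mu}_{\sigma_2}(t-k+2)\cdots\boldsymbol{\mu}_{\sigma_k}(t)$;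 $\boldsymbol{\mu}_\epsilon(t)=1$. Admissible switching. $\boldsymbol{\mu}$ is admissible if: (1) there is $\mathcal{E}\subseteq\Sigma\times\Sigma$ such that for each $\sigma\in\Sigma$ there is $\sigma'\in\Sigma$ with $(\sigma,\sigma')\in\mathcal{E}$, and, with $L$ the set of words $\sigma_1\cdots\sigma_k\in\Sigma^+$ with $(\sigma_i,\sigma_{i+1})\in\mathcal{E}$ for $i=1,\dots,k-1$, one has $\boldsymbol{\mu}_w=0$ for all $w\in\Sigma^+\setminus L$; (2) with $\mathcal{F}^{\boldsymbol{\mu},-}_t$ the $\sigma$-algebra generated by $\{\boldsymbol{\mu}(k)\}_{k<t}$, there are positive numbers $\{p_\sigma\}_{\sigma\in\Sigma}$ such that for all $w,v\in\Sigma^+$, $\sigma,\sigma'\in\Sigma$, $t\in\mathbb{Z}$: $E[\boldsymbol{\mu}_{w\sigma}(t)\boldsymbol{\mu}_{v\sigma'}(t)\mid\mathcal{F}^{\boldsymbol{\mu},-}_t]$ equals $p_\sigma\boldsymbol{\mu}_w(t-1)\boldsymbol{\mu}_v(t-1)$ if $\sigma=\sigma'$ and $w\sigma,v\sigma\in L$, and $0$ otherwise; $E[\boldsymbol{\mu}_{w\sigma}(t)\boldsymbol{\mu}_{\sigma'}(t)\mid\mathcal{F}^{\boldsymbol{\mu},-}_t]$ equals $p_\sigma\boldsymbol{\mu}_w(t-1)$ if $\sigma=\sigma'$ and $w\sigma\in L$, and $0$ otherwise; $E[\boldsymbol{\mu}_\sigma(t)\boldsymbol{\mu}_{\sigma'}(t)\mid\mathcal{F}^{\boldsymbol{\mu},-}_t]=0$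 if $\sigma\neq\sigma'$; (3) there are reals $\{\alpha_\sigma\}$ with $\sum_{\sigma}\alpha_\sigma\boldsymbol{\mu}_\sigma(t)=1$ for all $t$; (4) for all $w,v\in\Sigma^+$, $[\boldsymbol{\mu}_w,\boldsymbol{\mu}_v]^T$ is wide-sense stationary. Put $p_w=p_{\sigma_1}\cdots p_{\sigma_k}$ for $w=\sigma_1\cdots\sigma_k$. For a process $\mathbf{r}$ and $w\in\Sigma^+$: $\mathbf{z}^{\mathbf{r}}_w(t)=\mathbf{r}(t-|w|)\,\boldsymbol{\mu}_w(t-1)\frac{1}{\sqrt{p_w}}$. ZMWSSI. $\mathbf{r}$ is ZMWSSI (zero mean wide sense stationary w.r.t. $\boldsymbol{\mu}$) if (1) for every $t$ the $\sigma$-algebras generated by $\{\mathbf{r}(k)\}_{k\le t}$ and by $\{\boldsymbol{\mu}_\sigma(k)\}_{k\ge t,\sigma\in\Sigma}$ are conditionally independent given the one generated by $\{\boldsymbol{\mu}_\sigma(k)\}_{k<t,\sigma\in\Sigma}$; (2) the processes $\mathbf{r}$, $\mathbf{z}^{\mathbf{r}}_w$ ($w\in\Sigma^+$) are zero mean, square integrable and jointly wide-sense stationary. White noise w.r.t. $\boldsymbol{\mu}$: a ZMWSSI process $\mathbf{r}$ such that for all $w\in\Sigma^+$, $v\in\Sigma^*$, $\sigma\in\Sigma$: $E[\mathbf{z}^{\mathbf{r}}_w(t)(\mathbf{z}^{\mathbf{r}}_{\sigma v}(t))^T]=0$ if $w\ne\sigma v$, and $=E[\mathbf{z}^{\mathbf{r}}_\sigma(t)(\mathbf{z}^{\mathbf{r}}_\sigma(t))^T]$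 if $w=\sigma v\in L$; and $E[\mathbf{z}^{\mathbf{r}}_\sigma(t)(\mathbf{z}^{\mathbf{r}}_\sigma(t))^T]$ is nonsingular for all $\sigma\in\Sigma$. Standing assumptions: $\boldsymbol{\mu}$ is admissible; $\mathbf{u}$ is a white noise w.r.t. $\boldsymbol{\mu}$; $[\mathbf{y}^T,\mathbf{u}^T]^T$ is ZMWSSI. sGLSS. $\mathbf{S}=(\{A_\sigma,K_\sigma,B_\sigma\}_{\sigma=1}^{n_\mu},C,D,F,\mathbf{v})$, with $A_i\in\mathbb{R}^{n_x\times n_x}$, $B_i\in\mathbb{R}^{n_x\times n_u}$, $K_i\in\mathbb{R}^{n_x\times n_n}$, $C\in\mathbb{R}^{n_y\times n_x}$, $D\in\mathbb{R}^{n_y\times n_u}$, $F\in\mathbb{R}^{n_y\times n_n}$ and $\mathbf{v}$ an $\mathbb{R}^{n_n}$-valued (noise) process, is a stationary GLSS (sGLSS) of $(\mathbf{y},\mathbf{u},\boldsymbol{\mu})$ if there is an $\mathbb{R}^{n_x}$-valued (state) process $\mathbf{x}$ with $$\mathbf{x}(t+1)=\sum_{i=1}^{n_\mu}(A_i\mathbf{x}(t)+B_i\mathbf{u}(t)+K_i\mathbf{v}(t))\boldsymbol{\mu}_i(t),\qquad \mathbf{y}(t)=C\mathbf{x}(t)+D\mathbf{u}(t)+F\mathbf{v}(t)$$ for all $t\in\mathbb{Z}$, and: (1) $\boldsymbol{\omega}=[\mathbf{v}^T,\mathbf{u}^T]^T$ is a white noise w.r.t. $\boldsymbol{\mu}$,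 and $E[\mathbf{v}(t)\mathbf{u}(t)^T\boldsymbol{\mu}_\sigma^2(t)]=0$ for all $\sigma\in\Sigma$; (2) $[\mathbf{x}^T,\boldsymbol{\omega}^T]^T$ is ZMWSSI, and $E[\mathbf{z}^{\mathbf{x}}_\sigma(t)(\mathbf{z}^{\boldsymbol{\omega}}_\sigma(t))^T]=0$, $E[\mathbf{z}^{\mathbf{x}}_w(t)\boldsymbol{\omega}(t)^T]=0$ for all $\sigma\in\Sigma$, $w\in\Sigma^+$; (3) all eigenvalues of $\sum_{\sigma}p_\sigma A_\sigma\otimes A_\sigma$ lie in the open unit disc; (4) if $(\sigma_1,\sigma_2)\notin\mathcal{E}$ then $A_{\sigma_2}A_{\sigma_1}=0$ and $A_{\sigma_2}[K_{\sigma_1},B_{\sigma_1}]E[\mathbf{z}^{\boldsymbol{\omega}}_{\sigma_1}(t)(\mathbf{z}^{\boldsymbol{\omega}}_{\sigma_1}(t))^T]=0$. asGLSS (autonomous case). A tuple $(\{A_\sigma,K_\sigma\}_{\sigma=1}^{n_\mu},C,F,\mathbf{v})$ is an asGLSS of $(\mathbf{y},\boldsymbol{\mu})$ (for a given output process $\mathbf{y}$) if there is a process $\mathbf{x}$ with $\mathbf{x}(t+1)=\sum_i(A_i\mathbf{x}(t)+K_i\mathbf{v}(t))\boldsymbol{\mu}_i(t)$, $\mathbf{y}(t)=C\mathbf{x}(t)+F\mathbf{v}(t)$ for all $t$, and (1)–(4) above hold with the input removed, i.e. with $\boldsymbol{\omega}=\mathbf{v}$ and $[K_{\sigma_1},B_{\sigma_1}]$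 replaced by $K_{\sigma_1}$. Projection. $\mathcal{H}_1$ is the Hilbert space of real square integrable random variables with $\langle \mathbf{a},\mathbf{b}\rangle=E[\mathbf{a}\mathbf{b}]$. For a square integrable random vector $\mathbf{z}$ and closed subspace $M\subseteq\mathcal{H}_1$, $E_l[\mathbf{z}\mid M]$ is the componentwise orthogonal projection onto $M$; for a set $\mathfrak{S}$ of square integrable random vectors, $E_l[\mathbf{z}\mid\mathfrak{S}]$ is the projection onto the closed subspace generated by the coordinates of the elements of $\mathfrak{S}$. Components of the output: $\mathbf{y}^d(t)=E_l[\mathbf{y}(t)\mid\{\mathbf{z}^{\mathbf{u}}_w(t)\}_{w\in\Sigma^+}\cup\{\mathbf{u}(t)\}]$ and $\mathbf{y}^s(t)=\mathbf{y}(t)-\mathbf{y}^d(t)$. *)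

theory Defs
  imports "HOL-Probability.Probability"
begin

text \<open>
  A process with values in \<open>\<real>\<^sup>n\<close> is a function \<open>r :: int \<Rightarrow> 'a \<Rightarrow> real ^ 'n\<close>, where \<open>'a\<close> carries the
  probability space \<open>M\<close>. The alphabet is a finite type \<open>'s\<close>, the index type of the
  switching process \<open>\<mu> :: int \<Rightarrow> 'a \<Rightarrow> real ^ 's\<close>. Random variables are identified when they agree
  almost surely, so equations between them are stated with \<open>AE\<close>.
\<close>

section \<open>Random variables\<close>

definition sigma_gen :: "'a measure \<Rightarrow> ('i \<Rightarrow> 'a \<Rightarrow> 'b::topological_space) \<Rightarrow> 'i set \<Rightarrow> 'a measure" where
  "sigma_gen M X I =
     sigma (space M) (\<Union>i\<in>I. {X i -` B \<inter> space M | B. B \<in> sets borel})"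

definition cond_independent ::
  "'a measure \<Rightarrow> 'a measure \<Rightarrow> 'a measure \<Rightarrow> 'a measure \<Rightarrow> bool" where
  "cond_independent M F G H \<longleftrightarrow>
     (\<forall>A\<in>sets F. \<forall>B\<in>sets G. AE \<omega> in M.
        real_cond_exp M H (indicator (A \<inter> B)) \<omega>
          = real_cond_exp M H (indicator A) \<omega> * real_cond_exp M H (indicator B) \<omega>)"

definition square_int :: "'a measure \<Rightarrow> ('a \<Rightarrow> real) \<Rightarrow> bool" where
  "square_int M X \<longleftrightarrow> X \<in> borel_measurable M \<and> integrable M (\<lambda>\<omega>. (X \<omega>)\<^sup>2)"

text \<open>\<open>cross_moment M X Y\<close> is \<open>E[X Y\<^sup>T]\<close>.\<close>

definition cross_moment ::
  "'a measure \<Rightarrow> ('a \<Rightarrow> real ^ 'm) \<Rightarrow> ('a \<Rightarrow> real ^ 'n) \<Rightarrow> real ^ 'n ^ 'm" where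
  "cross_moment M X Y = (\<chi> i j. \<integral>\<omega>. X \<omega> $ i * Y \<omega> $ j \<partial>M)"

definition components :: "(int \<Rightarrow> 'a \<Rightarrow> real ^ 'n) \<Rightarrow> (int \<Rightarrow> 'a \<Rightarrow> real) set" where
  "components r = range (\<lambda>i t \<omega>. r t \<omega> $ i)"

text \<open>
  Joint wide-sense stationarity of a set of scalar processes; vector processes enter through
  their components. Given constant means, stationarity of second moments and of covariances
  coincide.
\<close>

definition jointly_wss :: "'a measure \<Rightarrow> (int \<Rightarrow> 'a \<Rightarrow> real) set \<Rightarrow> bool" where
  "jointly_wss M R \<longleftrightarrow>
     (\<forall>a\<in>R. \<forall>t. square_int M (a t)) \<and>
     (\<forall>a\<in>R. \<forall>s t. (\<integral>\<omega>. a s \<omega> \<partial>M) = (\<integral>\<omega>. a t \<omega> \<partial>M)) \<and>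
     (\<forall>a\<in>R. \<forall>b\<in>R. \<forall>s t k.
        (\<integral>\<omega>. a (s + k) \<omega> * b (t + k) \<omega> \<partial>M) = (\<integral>\<omega>. a s \<omega> * b t \<omega> \<partial>M))"

definition stack ::
  "(int \<Rightarrow> 'a \<Rightarrow> real ^ 'm) \<Rightarrow> (int \<Rightarrow> 'a \<Rightarrow> real ^ 'n) \<Rightarrow> int \<Rightarrow> 'a \<Rightarrow> real ^ ('m + 'n)" where
  "stack r q t \<omega> = (\<chi> k. case k of Inl i \<Rightarrow> r t \<omega> $ i | Inr j \<Rightarrow> q t \<omega> $ j)"


section \<open>Linear projection\<close>

definition closed_span :: "'a measure \<Rightarrow> ('a \<Rightarrow> real) set \<Rightarrow> ('a \<Rightarrow> real) set" where
  "closed_span M G =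
     {X. square_int M X \<and>
         (\<forall>e>0. \<exists>S c. finite S \<and> S \<subseteq> G \<and> (\<integral>\<omega>. (X \<omega> - (\<Sum>g\<in>S. c g * g \<omega>))\<^sup>2 \<partial>M) < e)}"

text \<open>
  The projection is determined only up to almost sure equality, and \<open>orth_proj\<close> picks
  an arbitrary version.
\<close>

definition orth_proj :: "'a measure \<Rightarrow> ('a \<Rightarrow> real) set \<Rightarrow> ('a \<Rightarrow> real) \<Rightarrow> 'a \<Rightarrow> real" where
  "orth_proj M V X = (SOME P. P \<in> V \<and> (\<forall>Z\<in>V. (\<integral>\<omega>. (X \<omega> - P \<omega>) * Z \<omega> \<partial>M) = 0))"

definition lin_proj ::
  "'a measure \<Rightarrow> ('a \<Rightarrow> real ^ 'n) \<Rightarrow> ('a \<Rightarrow> real ^ 'm) set \<Rightarrow> 'a \<Rightarrow> real ^ 'n" where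
  "lin_proj M X T \<omega> =
     (\<chi> i. orth_proj M (closed_span M {\<lambda>\<omega>. Y \<omega> $ j | Y j. Y \<in> T}) (\<lambda>\<omega>. X \<omega> $ i) \<omega>)"


section \<open>Switching processes\<close>

definition mu_word :: "(int \<Rightarrow> 'a \<Rightarrow> real ^ 's) \<Rightarrow> 's list \<Rightarrow> int \<Rightarrow> 'a \<Rightarrow> real" where
  "mu_word \<mu> w t \<omega> = (\<Prod>i<length w. \<mu> (t - int (length w) + 1 + int i) \<omega> $ (w ! i))"

definition p_word :: "('s \<Rightarrow> real) \<Rightarrow> 's list \<Rightarrow> real" where
  "p_word p w = prod_list (map p w)"

definition z_proc ::
  "(int \<Rightarrow> 'a \<Rightarrow> real ^ 's) \<Rightarrow> ('s \<Rightarrow> real) \<Rightarrow> (int \<Rightarrow> 'a \<Rightarrow> real ^ 'n)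
    \<Rightarrow> 's list \<Rightarrow> int \<Rightarrow> 'a \<Rightarrow> real ^ 'n" where
  "z_proc \<mu> p r w t \<omega> =
     (mu_word \<mu> w (t - 1) \<omega> * (1 / sqrt (p_word p w))) *\<^sub>R r (t - int (length w)) \<omega>"

definition adm_words :: "('s \<times> 's) set \<Rightarrow> 's list set" where
  "adm_words E = {w. w \<noteq> [] \<and> successively (\<lambda>a b. (a, b) \<in> E) w}"

text \<open>
  The edge set \<open>E\<close> and the weights \<open>p\<close> whose existence makes \<open>\<mu>\<close> admissible are parameters, since
  the later notions refer to them.
\<close>

definition admissible ::
  "'a measure \<Rightarrow> (int \<Rightarrow> 'a \<Rightarrow> real ^ 's::finite) \<Rightarrow> ('s \<times> 's) set \<Rightarrow> ('s \<Rightarrow> real) \<Rightarrow> bool" where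
  "admissible M \<mu> E p \<longleftrightarrow>
     (\<forall>a. \<exists>b. (a, b) \<in> E) \<and>
     (\<forall>w. w \<noteq> [] \<and> w \<notin> adm_words E \<longrightarrow> (\<forall>t. AE \<omega> in M. mu_word \<mu> w t \<omega> = 0)) \<and>
     (\<forall>a. p a > 0) \<and>
     (\<forall>w v a b t. w \<noteq> [] \<and> v \<noteq> [] \<longrightarrow>
        (AE \<omega> in M.
           real_cond_exp M (sigma_gen M \<mu> {..<t})
             (\<lambda>\<omega>. mu_word \<mu> (w @ [a]) t \<omega> * mu_word \<mu> (v @ [b]) t \<omega>) \<omega>
           = (if a = b \<and> w @ [a] \<in> adm_words E \<and> v @ [a] \<in> adm_words E
              then p a * mu_word \<mu> w (t - 1) \<omega> * mu_word \<mu> v (t - 1) \<omega> else 0))) \<and>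
     (\<forall>w a b t. w \<noteq> [] \<longrightarrow>
        (AE \<omega> in M.
           real_cond_exp M (sigma_gen M \<mu> {..<t})
             (\<lambda>\<omega>. mu_word \<mu> (w @ [a]) t \<omega> * mu_word \<mu> [b] t \<omega>) \<omega>
           = (if a = b \<and> w @ [a] \<in> adm_words E then p a * mu_word \<mu> w (t - 1) \<omega> else 0))) \<and>
     (\<forall>a b t. a \<noteq> b \<longrightarrow>
        (AE \<omega> in M.
           real_cond_exp M (sigma_gen M \<mu> {..<t})
             (\<lambda>\<omega>. mu_word \<mu> [a] t \<omega> * mu_word \<mu> [b] t \<omega>) \<omega> = 0)) \<and>
     (\<exists>\<alpha>. \<forall>t. AE \<omega> in M. (\<Sum>a\<in>UNIV. \<alpha> a * \<mu> t \<omega> $ a) = 1) \<and>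
     (\<forall>w v. w \<noteq> [] \<and> v \<noteq> [] \<longrightarrow> jointly_wss M {mu_word \<mu> w, mu_word \<mu> v})"

definition zmwssi ::
  "'a measure \<Rightarrow> (int \<Rightarrow> 'a \<Rightarrow> real ^ 's::finite) \<Rightarrow> ('s \<Rightarrow> real)
    \<Rightarrow> (int \<Rightarrow> 'a \<Rightarrow> real ^ 'n::finite) \<Rightarrow> bool" where
  "zmwssi M \<mu> p r \<longleftrightarrow>
     (\<forall>t. cond_independent M
        (sigma_gen M r {..t})
        (sigma_gen M (\<lambda>(k, a) \<omega>. \<mu> k \<omega> $ a) ({t..} \<times> UNIV))
        (sigma_gen M (\<lambda>(k, a) \<omega>. \<mu> k \<omega> $ a) ({..<t} \<times> UNIV))) \<and>
     (let R = components r \<union> (\<Union>w\<in>{w. w \<noteq> []}. components (z_proc \<mu> p r w))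
      in jointly_wss M R \<and> (\<forall>a\<in>R. \<forall>t. (\<integral>\<omega>. a t \<omega> \<partial>M) = 0))"

definition white_noise ::
  "'a measure \<Rightarrow> (int \<Rightarrow> 'a \<Rightarrow> real ^ 's::finite) \<Rightarrow> ('s \<times> 's) set \<Rightarrow> ('s \<Rightarrow> real)
    \<Rightarrow> (int \<Rightarrow> 'a \<Rightarrow> real ^ 'n::finite) \<Rightarrow> bool" where
  "white_noise M \<mu> E p r \<longleftrightarrow>
     zmwssi M \<mu> p r \<and>
     (\<forall>w v a t. w \<noteq> [] \<longrightarrow>
        (w \<noteq> a # v \<longrightarrow>
           cross_moment M (z_proc \<mu> p r w t) (z_proc \<mu> p r (a # v) t) = 0) \<and>
        (w = a # v \<and> w \<in> adm_words E \<longrightarrow>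
           cross_moment M (z_proc \<mu> p r w t) (z_proc \<mu> p r (a # v) t)
             = cross_moment M (z_proc \<mu> p r [a] t) (z_proc \<mu> p r [a] t))) \<and>
     (\<forall>a t. invertible (cross_moment M (z_proc \<mu> p r [a] t) (z_proc \<mu> p r [a] t)))"


section \<open>Matrices\<close>

definition kronecker :: "real ^ 'n ^ 'm \<Rightarrow> real ^ 'l ^ 'k \<Rightarrow> real ^ ('n \<times> 'l) ^ ('m \<times> 'k)" where
  "kronecker A B = (\<chi> i j. A $ fst i $ fst j * B $ snd i $ snd j)"

definition complex_eigenvalues :: "real ^ 'n ^ 'n \<Rightarrow> complex set" where
  "complex_eigenvalues A =
     {l. \<exists>v. v \<noteq> 0 \<and> (\<chi> i j. complex_of_real (A $ i $ j)) *v v = l *s v}"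

definition hcat :: "real ^ 'm ^ 'k \<Rightarrow> real ^ 'n ^ 'k \<Rightarrow> real ^ ('m + 'n) ^ 'k" where
  "hcat K B = (\<chi> i j. case j of Inl a \<Rightarrow> K $ i $ a | Inr b \<Rightarrow> B $ i $ b)"


section \<open>Stationary generalized linear switched systems\<close>

definition sGLSS ::
  "'a measure \<Rightarrow> (int \<Rightarrow> 'a \<Rightarrow> real ^ 's::finite) \<Rightarrow> ('s \<times> 's) set \<Rightarrow> ('s \<Rightarrow> real)
    \<Rightarrow> (int \<Rightarrow> 'a \<Rightarrow> real ^ 'ny) \<Rightarrow> (int \<Rightarrow> 'a \<Rightarrow> real ^ 'nu::finite)
    \<Rightarrow> ('s \<Rightarrow> real ^ 'nx ^ 'nx) \<Rightarrow> ('s \<Rightarrow> real ^ 'nn ^ 'nx) \<Rightarrow> ('s \<Rightarrow> real ^ 'nu ^ 'nx)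
    \<Rightarrow> real ^ 'nx ^ 'ny \<Rightarrow> real ^ 'nu ^ 'ny \<Rightarrow> real ^ 'nn ^ 'ny
    \<Rightarrow> (int \<Rightarrow> 'a \<Rightarrow> real ^ 'nn::finite) \<Rightarrow> bool" where
  "sGLSS M \<mu> E p y u A K B C D F v \<longleftrightarrow>
     (\<exists>x :: int \<Rightarrow> 'a \<Rightarrow> real ^ 'nx.
        (\<forall>t. AE \<omega> in M.
           x (t + 1) \<omega>
             = (\<Sum>i\<in>UNIV. \<mu> t \<omega> $ i *\<^sub>R (A i *v x t \<omega> + B i *v u t \<omega> + K i *v v t \<omega>))) \<and>
        (\<forall>t. AE \<omega> in M. y t \<omega> = C *v x t \<omega> + D *v u t \<omega> + F *v v t \<omega>) \<and>
        white_noise M \<mu> E p (stack v u) \<and>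
        (\<forall>a t. cross_moment M (v t) (\<lambda>\<omega>. (\<mu> t \<omega> $ a)\<^sup>2 *\<^sub>R u t \<omega>) = 0) \<and>
        zmwssi M \<mu> p (stack x (stack v u)) \<and>
        (\<forall>a t. cross_moment M (z_proc \<mu> p x [a] t) (z_proc \<mu> p (stack v u) [a] t) = 0) \<and>
        (\<forall>w t. w \<noteq> [] \<longrightarrow> cross_moment M (z_proc \<mu> p x w t) (stack v u t) = 0) \<and>
        (\<forall>l \<in> complex_eigenvalues (\<Sum>a\<in>UNIV. p a *\<^sub>R kronecker (A a) (A a)). cmod l < 1) \<and>
        (\<forall>a b. (a, b) \<notin> E \<longrightarrow>
           A b ** A a = 0 \<and>
           (\<forall>t. A b ** hcat (K a) (B a) **
              cross_moment M (z_proc \<mu> p (stack v u) [a] t) (z_proc \<mu> p (stack v u) [a] t) = 0)))"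

definition asGLSS ::
  "'a measure \<Rightarrow> (int \<Rightarrow> 'a \<Rightarrow> real ^ 's::finite) \<Rightarrow> ('s \<times> 's) set \<Rightarrow> ('s \<Rightarrow> real)
    \<Rightarrow> (int \<Rightarrow> 'a \<Rightarrow> real ^ 'ny)
    \<Rightarrow> ('s \<Rightarrow> real ^ 'nx ^ 'nx) \<Rightarrow> ('s \<Rightarrow> real ^ 'nn ^ 'nx)
    \<Rightarrow> real ^ 'nx ^ 'ny \<Rightarrow> real ^ 'nn ^ 'ny
    \<Rightarrow> (int \<Rightarrow> 'a \<Rightarrow> real ^ 'nn::finite) \<Rightarrow> bool" where
  "asGLSS M \<mu> E p y A K C F v \<longleftrightarrow>
     (\<exists>x :: int \<Rightarrow> 'a \<Rightarrow> real ^ 'nx.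
        (\<forall>t. AE \<omega> in M.
           x (t + 1) \<omega> = (\<Sum>i\<in>UNIV. \<mu> t \<omega> $ i *\<^sub>R (A i *v x t \<omega> + K i *v v t \<omega>))) \<and>
        (\<forall>t. AE \<omega> in M. y t \<omega> = C *v x t \<omega> + F *v v t \<omega>) \<and>
        white_noise M \<mu> E p v \<and>
        zmwssi M \<mu> p (stack x v) \<and>
        (\<forall>a t. cross_moment M (z_proc \<mu> p x [a] t) (z_proc \<mu> p v [a] t) = 0) \<and>
        (\<forall>w t. w \<noteq> [] \<longrightarrow> cross_moment M (z_proc \<mu> p x w t) (v t) = 0) \<and>
        (\<forall>l \<in> complex_eigenvalues (\<Sum>a\<in>UNIV. p a *\<^sub>R kronecker (A a) (A a)). cmod l < 1) \<and>
        (\<forall>a b. (a, b) \<notin> E \<longrightarrow>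
           A b ** A a = 0 \<and>
           (\<forall>t. A b ** K a ** cross_moment M (z_proc \<mu> p v [a] t) (z_proc \<mu> p v [a] t) = 0)))"

definition y_det ::
  "'a measure \<Rightarrow> (int \<Rightarrow> 'a \<Rightarrow> real ^ 's) \<Rightarrow> ('s \<Rightarrow> real)
    \<Rightarrow> (int \<Rightarrow> 'a \<Rightarrow> real ^ 'ny) \<Rightarrow> (int \<Rightarrow> 'a \<Rightarrow> real ^ 'nu) \<Rightarrow> int \<Rightarrow> 'a \<Rightarrow> real ^ 'ny" where
  "y_det M \<mu> p y u t = lin_proj M (y t) ({z_proc \<mu> p u w t | w. w \<noteq> []} \<union> {u t})"

definition y_sto ::
  "'a measure \<Rightarrow> (int \<Rightarrow> 'a \<Rightarrow> real ^ 's) \<Rightarrow> ('s \<Rightarrow> real)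
    \<Rightarrow> (int \<Rightarrow> 'a \<Rightarrow> real ^ 'ny) \<Rightarrow> (int \<Rightarrow> 'a \<Rightarrow> real ^ 'nu) \<Rightarrow> int \<Rightarrow> 'a \<Rightarrow> real ^ 'ny" where
  "y_sto M \<mu> p y u t \<omega> = y t \<omega> - y_det M \<mu> p y u t \<omega>"

end

theory Submission
  imports Defs
begin

text \<open>
  Project the state \<open>x(t)\<close> of the given realization orthogonally onto the closed span \<open>H(t)\<close> of the
  past input words \<open>z\<^sup>u\<^sub>w(t)\<close>, \<open>w\<close> nonempty, and call the projection \<open>x\<^sup>d(t)\<close> and the residual \<open>x\<^sup>s(t)\<close>.
  These two processes are the states of the two asserted realizations, and all their equations are
  read off from the uniqueness of orthogonal projections.

  The analytic heart is the operator that sends a process \<open>X\<close> to \<open>X(t - 1) \<mu>\<^sub>a(t - 1) / \<surd>p\<^sub>a\<close>. Conditional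
  independence allows \<open>\<mu>\<^sub>a(t)\<^sup>2\<close> to be replaced by its conditional expectation given the past of \<open>\<mu>\<close>
  inside \<open>E[X(t)\<^sup>2 \<mu>\<^sub>a(t)\<^sup>2]\<close>, and admissibility bounds that conditional expectation by \<open>p\<^sub>a\<close>
  (\<open>letter_cond_moment_le\<close>). Hence the operator is a contraction on adapted processes
  (\<open>md_single_contraction\<close>); different letters give orthogonal results (\<open>md_cross_letters\<close>), and equal
  letters preserve the inner product with a word, up to a factor 0 when the extended word is
  forbidden (\<open>md_same_letter\<close>). Conversely, since \<open>\<Sum> \<alpha>\<^sub>a \<mu>\<^sub>a = 1\<close>, orthogonality after modulation by
  every letter implies orthogonality (\<open>orthogonal_if_md_orthogonal\<close>). This turns the white noise
  hypotheses into statements at the present time: \<open>v(t)\<close> and \<open>u(t)\<close> are orthogonal to each other, to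
  \<open>x(t)\<close>, and to all their past words.

  The recursion for \<open>x\<^sup>d\<close> (\<open>Xd_update\<close>) is then obtained from that for \<open>x\<close>. The part
  \<open>\<Sum> \<mu>\<^sub>a(t) (A\<^sub>a x\<^sup>d(t) + B\<^sub>a u(t))\<close> lies in \<open>H(t + 1)\<close> because modulation maps \<open>H(t)\<close> and \<open>u(t)\<close> into \<open>H(t + 1)\<close>
  continuously. The remaining part \<open>\<Sum> \<mu>\<^sub>a(t) (A\<^sub>a x\<^sup>s(t) + K\<^sub>a v(t))\<close> is orthogonal to \<open>H(t + 1)\<close>. Likewise
  \<open>C x\<^sup>d(t) + D u(t)\<close> lies in the span of \<open>H(t)\<close> and \<open>u(t)\<close>, whereas \<open>C x\<^sup>s(t) + F v(t)\<close> is orthogonal to it, so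
  the former is \<open>y\<^sup>d(t)\<close> (\<open>y_det_eq\<close>).

  Stationarity of the new states needs the projections at different times to be one and the same
  time-invariant expression. Because the second moments do not depend on time, a sequence of
  finite linear combinations that approximates the projection at time 0 approximates it at every
  time (\<open>stationary_projection\<close>). Limits of such combinations inherit joint stationarity, zero
  means and measurability, whence the ZMWSSI property (\<open>zmwssi_from_components\<close>).
\<close>

section \<open>Conditional independence\<close>

definition join_algebra :: "'a measure \<Rightarrow> 'a measure \<Rightarrow> 'a measure \<Rightarrow> 'a measure" where
  "join_algebra M F H = sigma (space M) (sets F \<union> sets H)"

lemma subalgebra_join:
  assumes "subalgebra M F" "subalgebra M H"
  shows "subalgebra M (join_algebra M F H)"
    and "subalgebra (join_algebra M F H) F" and "subalgebra (join_algebra M F H) H"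
proof -
  have sub: "sets F \<union> sets H \<subseteq> Pow (space M)"
    using assms sets.space_closed[of M] by (auto simp: subalgebra_def)
  have sets: "sets (join_algebra M F H) = sigma_sets (space M) (sets F \<union> sets H)"
    unfolding join_algebra_def using sub by (rule sets_measure_of)
  have space: "space (join_algebra M F H) = space M"
    unfolding join_algebra_def using sub by (rule space_measure_of)
  have "sigma_sets (space M) (sets F \<union> sets H) \<subseteq> sets M"
    using assms by (intro sets.sigma_sets_subset) (auto simp: subalgebra_def)
  then show "subalgebra M (join_algebra M F H)"
    by (simp add: subalgebra_def sets space)
  show "subalgebra (join_algebra M F H) F" "subalgebra (join_algebra M F H) H"
    using assms by (auto simp: subalgebra_def sets space)
qed

text \<open>
  The intersections are closed under intersection, so they are the generator to which
  Dynkin's argument applies.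
\<close>

lemma sets_join_eq_intersections:
  assumes "subalgebra M F" "subalgebra M H"
  shows "sets (join_algebra M F H) = sigma_sets (space M) {A \<inter> B | A B. A \<in> sets F \<and> B \<in> sets H}"
    (is "_ = sigma_sets _ ?I")
proof -
  have sub: "sets F \<union> sets H \<subseteq> Pow (space M)"
    using assms sets.space_closed[of M] by (auto simp: subalgebra_def)
  have top: "space M \<in> sets F" "space M \<in> sets H"
    using assms by (metis subalgebra_def sets.top)+
  have "sets F \<union> sets H \<subseteq> ?I"
  proof
    fix A assume A: "A \<in> sets F \<union> sets H"
    then have "A = A \<inter> space M" "A = space M \<inter> A" using sub by auto
    then show "A \<in> ?I" using A top by auto
  qed
  moreover have "?I \<subseteq> sets (join_algebra M F H)"
    using subalgebra_join(2,3)[OF assms] by (auto simp: subalgebra_def)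
  then have "?I \<subseteq> sigma_sets (space M) (sets F \<union> sets H)"
    using sub by (simp add: join_algebra_def)
  ultimately have "sigma_sets (space M) ?I = sigma_sets (space M) (sets F \<union> sets H)"
    by (intro sigma_sets_eqI) auto
  then show ?thesis
    unfolding join_algebra_def using sub by (simp add: sets_measure_of)
qed

lemma set_integral_zero_from_generator:
  fixes h :: "'a \<Rightarrow> real"
  assumes h: "integrable M h" and I: "Int_stable \<I>" "\<I> \<subseteq> sets M" "space M \<in> \<I>"
    and zero: "\<And>A. A \<in> \<I> \<Longrightarrow> (\<integral>x\<in>A. h x \<partial>M) = 0"
    and A: "A \<in> sigma_sets (space M) \<I>"
  shows "(\<integral>x\<in>A. h x \<partial>M) = 0"
proof -
  have I': "\<I> \<subseteq> Pow (space M)" using I(2) sets.space_closed[of M] by blast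
  have meas: "sigma_sets (space M) \<I> \<subseteq> sets M" using I(2) by (rule sets.sigma_sets_subset)
  have int: "set_integrable M A h" if "A \<in> sets M" for A
    unfolding set_integrable_def using integrable_mult_indicator[OF that h] .
  show ?thesis
    using I(1) I' A
  proof (induction rule: sigma_sets_induct_disjoint)
    case (basic A) then show ?case by (rule zero)
  next
    case empty show ?case by (simp add: set_lebesgue_integral_def)
  next
    case (compl A)
    then have A: "A \<in> sets M" using meas by auto
    have "(\<integral>x\<in>A \<union> (space M - A). h x \<partial>M) = (\<integral>x\<in>A. h x \<partial>M) + (\<integral>x\<in>space M - A. h x \<partial>M)"
      using A int by (intro set_integral_Un) auto
    moreover have "A \<union> (space M - A) = space M" using sets.sets_into_space[OF A] by auto
    ultimately show ?case using compl.IH zero[OF I(3)] by simp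
  next
    case (union A)
    have A: "A i \<in> sets M" for i using union meas by auto
    then have "(\<integral>x\<in>(\<Union>i. A i). h x \<partial>M) = (\<Sum>i. (\<integral>x\<in>A i. h x \<partial>M))"
      using union(1) int by (intro lebesgue_integral_countable_add) (auto simp: disjoint_family_on_def)
    then show ?case using union.IH by simp
  qed
qed

context prob_space
begin

lemma sigma_finite_subalg: "subalgebra M F \<Longrightarrow> sigma_finite_subalgebra M F"
  using finite_measure_axioms finite_measure_subalgebra_axioms.intro finite_measure_subalgebra.intro
    finite_measure_subalgebra_is_sigma_finite by blast

lemma integrable_indicator_event: "A \<in> sets M \<Longrightarrow> integrable M (indicator A :: 'a \<Rightarrow> real)"
  by (intro integrable_real_indicator) (auto simp: less_top[symmetric])

lemma integrable_indicator_times: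
  fixes f :: "'a \<Rightarrow> real"
  shows "A \<in> sets M \<Longrightarrow> integrable M f \<Longrightarrow> integrable M (\<lambda>x. indicator A x * f x)"
  using integrable_mult_indicator[of A M f] by simp

text \<open>
  Conditional independence is expressed by real conditional expectations, but the square
  integrability of products is only available from their nonnegative counterpart; this
  links the two.
\<close>

lemma nn_cond_exp_eq_ennreal_real_cond_exp:
  fixes f :: "'a \<Rightarrow> real"
  assumes sub: "subalgebra M H" and f: "integrable M f" "\<And>x. 0 \<le> f x"
  shows "AE x in M. nn_cond_exp M H (\<lambda>x. ennreal (f x)) x = ennreal (real_cond_exp M H f x)"
proof -
  interpret H: sigma_finite_subalgebra M H by (rule sigma_finite_subalg[OF sub])
  have [measurable]: "f \<in> borel_measurable M" using f(1) by auto
  have pos: "AE x in M. 0 \<le> real_cond_exp M H f x"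
    using f by (intro H.real_cond_exp_pos) auto
  show ?thesis
  proof (rule AE_symmetric, rule H.nn_cond_exp_charact)
    fix A assume A: "A \<in> sets H"
    then have AM[measurable]: "A \<in> sets M" using sub by (auto simp: subalgebra_def)
    have "(\<integral>\<^sup>+x\<in>A. ennreal (f x) \<partial>M) = (\<integral>\<^sup>+x. ennreal (indicator A x * f x) \<partial>M)"
      by (intro nn_integral_cong) (auto simp: indicator_def)
    also have "\<dots> = ennreal (\<integral>x. indicator A x * f x \<partial>M)"
      using f AM by (intro nn_integral_eq_integral integrable_indicator_times) auto
    also have "(\<integral>x. indicator A x * f x \<partial>M) = (\<integral>x. indicator A x * real_cond_exp M H f x \<partial>M)"
      using H.real_cond_exp_intA[OF f(1) A] by (simp add: set_lebesgue_integral_def)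
    also have "ennreal \<dots> = (\<integral>\<^sup>+x. ennreal (indicator A x * real_cond_exp M H f x) \<partial>M)"
      using f AM pos H.real_cond_exp_int(1)[OF f(1)]
      by (intro nn_integral_eq_integral[symmetric] integrable_indicator_times) (auto simp: indicator_def)
    also have "\<dots> = (\<integral>\<^sup>+x\<in>A. ennreal (real_cond_exp M H f x) \<partial>M)"
      by (intro nn_integral_cong) (auto simp: indicator_def)
    finally show "(\<integral>\<^sup>+x\<in>A. ennreal (f x) \<partial>M) = (\<integral>\<^sup>+x\<in>A. ennreal (real_cond_exp M H f x) \<partial>M)" .
  qed auto
qed

text \<open>
  On an intersection \<open>A \<inter> C\<close> of sets from \<open>F\<close> and \<open>H\<close>, pull the indicator of \<open>C\<close> out of the
  conditional expectation and split \<open>E[1\<^sub>A 1\<^sub>B | H]\<close> into its two factors. Such intersections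
  generate the joined sigma-algebra.
\<close>

lemma cond_independent_tower:
  assumes sub: "subalgebra M F" "subalgebra M G" "subalgebra M H"
    and ci: "cond_independent M F G H"
    and A: "A \<in> sets (join_algebra M F H)" and B: "B \<in> sets G"
  shows "(\<integral>x\<in>A. indicator B x \<partial>M) = (\<integral>x\<in>A. real_cond_exp M H (indicator B) x \<partial>M)"
proof -
  interpret H: sigma_finite_subalgebra M H by (rule sigma_finite_subalg[OF sub(3)])
  let ?\<beta> = "real_cond_exp M H (indicator B)"
  have BM[measurable]: "B \<in> sets M" using B sub by (auto simp: subalgebra_def)
  have int\<beta>: "integrable M ?\<beta>" using integrable_indicator_event[OF BM] by (rule H.real_cond_exp_int)
  define h where "h = (\<lambda>x. indicator B x - ?\<beta> x)"
  have h: "integrable M h" unfolding h_def using int\<beta> integrable_indicator_event[OF BM] by simp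
  let ?I = "{A \<inter> C | A C. A \<in> sets F \<and> C \<in> sets H}"
  have I: "Int_stable ?I"
  proof (rule Int_stableI)
    fix a b assume "a \<in> ?I" "b \<in> ?I"
    then obtain A C A' C' where "a = A \<inter> C" "b = A' \<inter> C'" "A \<in> sets F" "A' \<in> sets F" "C \<in> sets H" "C' \<in> sets H"
      by auto
    then show "a \<inter> b \<in> ?I" by (intro CollectI exI[of _ "A \<inter> A'"] exI[of _ "C \<inter> C'"]) auto
  qed
  have IM: "?I \<subseteq> sets M" using sub by (auto simp: subalgebra_def)
  have top: "space M \<in> ?I"
    using sub by (intro CollectI exI[of _ "space M"]) (metis Int_absorb sets.top subalgebra_def)
  have "(\<integral>x\<in>a. h x \<partial>M) = 0" if a_in: "a \<in> ?I" for a
  proof -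
    obtain A C where a: "a = A \<inter> C" and A: "A \<in> sets F" and C: "C \<in> sets H" using a_in by auto
    have [measurable]: "A \<in> sets M" "C \<in> sets M" "C \<in> sets H" using A C sub by (auto simp: subalgebra_def)
    have "(\<integral>x\<in>a. indicator B x \<partial>M) = (\<integral>x\<in>C. indicator (A \<inter> B) x \<partial>M)"
      unfolding set_lebesgue_integral_def a by (intro Bochner_Integration.integral_cong) (auto simp: indicator_def)
    also have "\<dots> = (\<integral>x\<in>C. real_cond_exp M H (indicator (A \<inter> B)) x \<partial>M)"
      using C by (intro H.real_cond_exp_intA integrable_indicator_event) auto
    also have "\<dots> = (\<integral>x. (indicator C x * ?\<beta> x) * real_cond_exp M H (indicator A) x \<partial>M)"
      unfolding set_lebesgue_integral_def
    proof (intro integral_cong_AE)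
      have "AE x in M. real_cond_exp M H (indicator (A \<inter> B)) x = real_cond_exp M H (indicator A) x * ?\<beta> x"
        using ci A B by (auto simp: cond_independent_def)
      then show "AE x in M. indicator C x *\<^sub>R real_cond_exp M H (indicator (A \<inter> B)) x
          = (indicator C x * ?\<beta> x) * real_cond_exp M H (indicator A) x"
        by eventually_elim simp
    qed auto
    also have "\<dots> = (\<integral>x. (indicator C x * ?\<beta> x) * indicator A x \<partial>M)"
    proof (rule H.real_cond_exp_intg(2))
      have "integrable M (\<lambda>x. indicator (A \<inter> C) x * ?\<beta> x)"
        using int\<beta> by (intro integrable_indicator_times) auto
      then show "integrable M (\<lambda>x. indicator C x * ?\<beta> x * indicator A x)"
        by (simp add: indicator_inter_arith mult_ac)
    qed auto
    also have "\<dots> = (\<integral>x\<in>a. ?\<beta> x \<partial>M)"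
      unfolding set_lebesgue_integral_def a by (intro Bochner_Integration.integral_cong) (auto simp: indicator_def)
    finally have *: "(\<integral>x\<in>a. indicator B x \<partial>M) = (\<integral>x\<in>a. ?\<beta> x \<partial>M)" .
    have aM: "a \<in> sets M" using a_in IM by auto
    have "(\<integral>x\<in>a. h x \<partial>M) = (\<integral>x\<in>a. indicator B x \<partial>M) - (\<integral>x\<in>a. ?\<beta> x \<partial>M)"
      unfolding h_def using int\<beta> integrable_indicator_event[OF BM] aM
      by (intro set_integral_diff) (auto simp: set_integrable_def intro!: integrable_indicator_times)
    then show ?thesis using * by simp
  qed
  then have 0: "(\<integral>x\<in>A. h x \<partial>M) = 0"
    using set_integral_zero_from_generator[OF h I IM top] A
    unfolding sets_join_eq_intersections[OF sub(1,3)] by auto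
  have AM: "A \<in> sets M" using A subalgebra_join(1)[OF sub(1,3)] by (auto simp: subalgebra_def)
  have "(\<integral>x\<in>A. h x \<partial>M) = (\<integral>x\<in>A. indicator B x \<partial>M) - (\<integral>x\<in>A. ?\<beta> x \<partial>M)"
    unfolding h_def using int\<beta> integrable_indicator_event[OF BM] AM
    by (intro set_integral_diff) (auto simp: set_integrable_def intro!: integrable_indicator_times)
  with 0 show ?thesis by simp
qed

text \<open>
  Once \<open>H\<close> is known, the knowledge of \<open>F\<close> does not improve the prediction of anything that depends
  on \<open>G\<close> only. For indicators this is the previous lemma. To reach functions \<open>f\<close>, a set \<open>A\<close> of
  the joined sigma-algebra is kept fixed and \<open>E[\<cdot> | H]\<close> is moved from the indicator of a set of \<open>G\<close>
  to that of \<open>A\<close> by self-adjointness; then two measures on \<open>G\<close> agree and may be integrated against \<open>f\<close>.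
\<close>

lemma cond_independent_nn_cond_exp:
  assumes sub: "subalgebra M F" "subalgebra M G" "subalgebra M H"
    and ci: "cond_independent M F G H" and f: "f \<in> borel_measurable G"
  shows "AE x in M. nn_cond_exp M (join_algebra M F H) f x = nn_cond_exp M H f x"
proof -
  let ?J = "join_algebra M F H"
  note J = subalgebra_join[OF sub(1,3)]
  interpret H: sigma_finite_subalgebra M H by (rule sigma_finite_subalg[OF sub(3)])
  interpret G: sigma_finite_subalgebra M G by (rule sigma_finite_subalg[OF sub(2)])
  interpret J: sigma_finite_subalgebra M ?J by (rule sigma_finite_subalg[OF J(1)])
  have nn_ind: "AE x in M. nn_cond_exp M H (indicator C) x = ennreal (real_cond_exp M H (indicator C) x)"
    if "C \<in> sets M" for C
    using nn_cond_exp_eq_ennreal_real_cond_exp[OF sub(3) integrable_indicator_event[OF that]] by (simp add: ennreal_indicator)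
  have fM[measurable]: "f \<in> borel_measurable M" by (rule measurable_from_subalg[OF sub(2) f])
  show ?thesis
  proof (rule AE_symmetric, rule J.nn_cond_exp_charact)
    show "nn_cond_exp M H f \<in> borel_measurable ?J"
      using J(3) measurable_from_subalg borel_measurable_nn_cond_exp by blast
    show "f \<in> borel_measurable M" by fact
    fix A assume A: "A \<in> sets ?J"
    then have AM[measurable]: "A \<in> sets M" using J(1) by (auto simp: subalgebra_def)
    have pos: "AE x in M. 0 \<le> real_cond_exp M H (indicator C) x" if "C \<in> sets M" for C
      using that by (intro H.real_cond_exp_pos) auto
    \<comment> \<open>On sets of \<open>G\<close> the measures with densities \<open>1\<^sub>A\<close> and \<open>E[1\<^sub>A | H]\<close> agree.\<close>
    have eq: "(\<integral>\<^sup>+x\<in>B. indicator A x \<partial>M) = (\<integral>\<^sup>+x\<in>B. nn_cond_exp M H (indicator A) x \<partial>M)"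
      if B: "B \<in> sets G" for B
    proof -
      have BM[measurable]: "B \<in> sets M" using B sub by (auto simp: subalgebra_def)
      have i\<beta>: "integrable M (real_cond_exp M H (indicator B))"
        using integrable_indicator_event[OF BM] by (rule H.real_cond_exp_int)
      have "(\<integral>\<^sup>+x\<in>B. indicator A x \<partial>M) = (\<integral>\<^sup>+x. ennreal (indicator A x * indicator B x) \<partial>M)"
        by (intro nn_integral_cong) (auto simp: indicator_def)
      also have "\<dots> = ennreal (\<integral>x. indicator A x * indicator B x \<partial>M)"
        by (intro nn_integral_eq_integral integrable_indicator_times integrable_indicator_event AM BM) auto
      also have "(\<integral>x. indicator A x * indicator B x \<partial>M) = (\<integral>x. indicator A x * real_cond_exp M H (indicator B) x \<partial>M)"
        using cond_independent_tower[OF sub ci A B] by (simp add: set_lebesgue_integral_def)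
      also have "ennreal \<dots> = (\<integral>\<^sup>+x. ennreal (indicator A x * real_cond_exp M H (indicator B) x) \<partial>M)"
        using pos[OF BM] by (intro nn_integral_eq_integral[symmetric] integrable_indicator_times i\<beta> AM) auto
      also have "\<dots> = (\<integral>\<^sup>+x. nn_cond_exp M H (indicator B) x * indicator A x \<partial>M)"
        using nn_ind[OF BM] by (intro nn_integral_cong_AE) (auto simp: indicator_def)
      also have "\<dots> = (\<integral>\<^sup>+x. nn_cond_exp M H (indicator B) x * nn_cond_exp M H (indicator A) x \<partial>M)"
        by (intro H.nn_cond_exp_intg[symmetric]) auto
      also have "\<dots> = (\<integral>\<^sup>+x. nn_cond_exp M H (indicator A) x * nn_cond_exp M H (indicator B) x \<partial>M)"
        by (simp add: mult.commute)
      also have "\<dots> = (\<integral>\<^sup>+x. nn_cond_exp M H (indicator A) x * indicator B x \<partial>M)"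
        by (intro H.nn_cond_exp_intg) auto
      finally show ?thesis .
    qed
    have G_eq: "AE x in M. nn_cond_exp M G (nn_cond_exp M H (indicator A)) x = nn_cond_exp M G (indicator A) x"
    proof (rule G.nn_cond_exp_charact)
      fix B assume B: "B \<in> sets G"
      show "(\<integral>\<^sup>+x\<in>B. indicator A x \<partial>M)
          = (\<integral>\<^sup>+x\<in>B. nn_cond_exp M G (nn_cond_exp M H (indicator A)) x \<partial>M)"
        using G.nn_cond_exp_intg[of "indicator B" "nn_cond_exp M H (indicator A)"] B eq[OF B]
        by (simp add: mult.commute)
    qed auto
    have "(\<integral>\<^sup>+x\<in>A. f x \<partial>M) = (\<integral>\<^sup>+x. f x * nn_cond_exp M G (indicator A) x \<partial>M)"
      using f by (intro G.nn_cond_exp_intg[symmetric]) auto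
    also have "\<dots> = (\<integral>\<^sup>+x. f x * nn_cond_exp M G (nn_cond_exp M H (indicator A)) x \<partial>M)"
      using G_eq by (intro nn_integral_cong_AE) auto
    also have "\<dots> = (\<integral>\<^sup>+x. f x * nn_cond_exp M H (indicator A) x \<partial>M)"
      using f by (intro G.nn_cond_exp_intg) auto
    also have "\<dots> = (\<integral>\<^sup>+x. nn_cond_exp M H (indicator A) x * f x \<partial>M)"
      by (simp add: mult.commute)
    also have "\<dots> = (\<integral>\<^sup>+x. nn_cond_exp M H (indicator A) x * nn_cond_exp M H f x \<partial>M)"
      by (intro H.nn_cond_exp_intg[symmetric]) auto
    also have "\<dots> = (\<integral>\<^sup>+x. nn_cond_exp M H f x * nn_cond_exp M H (indicator A) x \<partial>M)"
      by (simp add: mult.commute)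
    also have "\<dots> = (\<integral>\<^sup>+x. nn_cond_exp M H f x * indicator A x \<partial>M)"
      by (intro H.nn_cond_exp_intg) auto
    finally show "(\<integral>\<^sup>+x\<in>A. f x \<partial>M) = (\<integral>\<^sup>+x\<in>A. nn_cond_exp M H f x \<partial>M)" .
  qed
qed

lemma cond_independent_real_cond_exp:
  assumes sub: "subalgebra M F" "subalgebra M G" "subalgebra M H"
    and ci: "cond_independent M F G H" and f: "f \<in> borel_measurable G"
  shows "AE x in M. real_cond_exp M (join_algebra M F H) f x = real_cond_exp M H f x"
  using cond_independent_nn_cond_exp[OF sub ci, of "\<lambda>x. ennreal (f x)"]
    cond_independent_nn_cond_exp[OF sub ci, of "\<lambda>x. ennreal (- f x)"] f
  by (auto simp: real_cond_exp_def)

text \<open>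
  The projected states depend on the past of \<open>\<mu>\<close> as well as on the input, so they are measurable for
  a join of two sigma-algebras; this extends conditional independence to them.
\<close>

lemma cond_independent_join:
  assumes sub: "subalgebra M F" "subalgebra M G" "subalgebra M H"
    and ci: "cond_independent M F G H"
  shows "cond_independent M (join_algebra M F H) G H"
  unfolding cond_independent_def
proof (intro ballI)
  let ?J = "join_algebra M F H"
  note J = subalgebra_join[OF sub(1,3)]
  interpret H: sigma_finite_subalgebra M H by (rule sigma_finite_subalg[OF sub(3)])
  interpret J: sigma_finite_subalgebra M ?J by (rule sigma_finite_subalg[OF J(1)])
  fix A B assume A: "A \<in> sets ?J" and B: "B \<in> sets G"
  have [measurable]: "A \<in> sets M" "B \<in> sets M" "A \<in> sets ?J" "B \<in> sets G"
    using A B J sub by (auto simp: subalgebra_def)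
  let ?\<beta> = "real_cond_exp M H (indicator B)"
  have int\<beta>: "integrable M ?\<beta>" by (intro H.real_cond_exp_int integrable_indicator_event) auto
  have "AE x in M. real_cond_exp M ?J (indicator (A \<inter> B)) x = indicator A x * real_cond_exp M ?J (indicator B) x"
    using J.real_cond_exp_mult[of "indicator A" "indicator B"] integrable_indicator_times[OF _ integrable_indicator_event, of A B]
    by (simp add: indicator_inter_arith[abs_def])
  moreover have "AE x in M. real_cond_exp M ?J (indicator B) x = ?\<beta> x"
    by (rule cond_independent_real_cond_exp[OF sub ci]) auto
  ultimately have 1: "AE x in M. real_cond_exp M ?J (indicator (A \<inter> B)) x = ?\<beta> x * indicator A x"
    by eventually_elim simp
  have "AE x in M. real_cond_exp M H (real_cond_exp M ?J (indicator (A \<inter> B))) x = real_cond_exp M H (indicator (A \<inter> B)) x"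
    using J by (intro H.real_cond_exp_nested_subalg integrable_indicator_event) auto
  moreover have "AE x in M. real_cond_exp M H (real_cond_exp M ?J (indicator (A \<inter> B))) x = real_cond_exp M H (\<lambda>x. ?\<beta> x * indicator A x) x"
    using 1 by (rule H.real_cond_exp_cong) auto
  moreover have "AE x in M. real_cond_exp M H (\<lambda>x. ?\<beta> x * indicator A x) x = ?\<beta> x * real_cond_exp M H (indicator A) x"
    using integrable_indicator_times[OF _ int\<beta>, of A] by (intro H.real_cond_exp_mult) (auto simp: mult.commute)
  ultimately show "AE x in M. real_cond_exp M H (indicator (A \<inter> B)) x = real_cond_exp M H (indicator A) x * ?\<beta> x"
    by eventually_elim (simp add: mult.commute)
qed

end

lemma cond_independent_mono:
  "cond_independent M F G H \<Longrightarrow> sets F' \<subseteq> sets F \<Longrightarrow> cond_independent M F' G H"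
  by (auto simp: cond_independent_def)

section \<open>Square integrable random variables\<close>

lemma square_intD:
  assumes "square_int M X"
  shows "X \<in> borel_measurable M" "integrable M (\<lambda>\<omega>. (X \<omega>)\<^sup>2)"
  using assms by (auto simp: square_int_def)

lemma square_int_mult_integrable:
  assumes "square_int M X" "square_int M Y"
  shows "integrable M (\<lambda>\<omega>. X \<omega> * Y \<omega>)"
proof (rule Bochner_Integration.integrable_bound)
  show "integrable M (\<lambda>\<omega>. (X \<omega>)\<^sup>2 + (Y \<omega>)\<^sup>2)"
    using assms by (auto dest: square_intD)
  show "(\<lambda>\<omega>. X \<omega> * Y \<omega>) \<in> borel_measurable M"
    using assms[THEN square_intD(1)] by measurable
  have "\<bar>a * b\<bar> \<le> a\<^sup>2 + b\<^sup>2" for a b :: real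
  proof -
    have "2 * (\<bar>a\<bar> * \<bar>b\<bar>) \<le> a\<^sup>2 + b\<^sup>2" using sum_squares_bound[of "\<bar>a\<bar>" "\<bar>b\<bar>"] by simp
    moreover have "0 \<le> \<bar>a\<bar> * \<bar>b\<bar>" by simp
    ultimately show ?thesis unfolding abs_mult by linarith
  qed
  then show "AE \<omega> in M. norm (X \<omega> * Y \<omega>) \<le> norm ((X \<omega>)\<^sup>2 + (Y \<omega>)\<^sup>2)"
    by auto
qed

lemma square_int_cmult: "square_int M X \<Longrightarrow> square_int M (\<lambda>\<omega>. c * X \<omega>)"
  by (auto simp: square_int_def power_mult_distrib)

lemma square_int_add:
  assumes "square_int M X" "square_int M Y"
  shows "square_int M (\<lambda>\<omega>. X \<omega> + Y \<omega>)"
proof -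
  have "integrable M (\<lambda>\<omega>. (X \<omega>)\<^sup>2 + (Y \<omega>)\<^sup>2 + 2 * (X \<omega> * Y \<omega>))"
    by (intro Bochner_Integration.integrable_add integrable_mult_right square_intD(2) assms square_int_mult_integrable)
  moreover have "(\<lambda>\<omega>. (X \<omega>)\<^sup>2 + (Y \<omega>)\<^sup>2 + 2 * (X \<omega> * Y \<omega>)) = (\<lambda>\<omega>. (X \<omega> + Y \<omega>)\<^sup>2)"
    by (simp add: power2_sum mult.assoc)
  ultimately show ?thesis
    using assms[THEN square_intD(1)] by (auto simp: square_int_def)
qed

lemma square_int_diff:
  assumes "square_int M X" "square_int M Y"
  shows "square_int M (\<lambda>\<omega>. X \<omega> - Y \<omega>)"
  using square_int_add[OF assms(1) square_int_cmult[OF assms(2), of "-1"]] by simp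

lemma square_int_zero: "square_int M (\<lambda>\<omega>. 0)"
  by (simp add: square_int_def)

lemma square_int_sum:
  assumes "\<And>i. i \<in> I \<Longrightarrow> square_int M (X i)"
  shows "square_int M (\<lambda>\<omega>. \<Sum>i\<in>I. X i \<omega>)"
  using assms by (induction I rule: infinite_finite_induct) (auto intro: square_int_add square_int_zero)

lemma square_int_one: "prob_space M \<Longrightarrow> square_int M (\<lambda>\<omega>. 1)"
  by (simp add: square_int_def prob_space.emeasure_space_1 prob_space.finite_measure finite_measure.integrable_const)

lemma Cauchy_Schwarz_integral:
  assumes X: "square_int M X" and Y: "square_int M Y"
  shows "(\<integral>\<omega>. X \<omega> * Y \<omega> \<partial>M)\<^sup>2 \<le> (\<integral>\<omega>. (X \<omega>)\<^sup>2 \<partial>M) * (\<integral>\<omega>. (Y \<omega>)\<^sup>2 \<partial>M)"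
proof -
  let ?a = "\<integral>\<omega>. (X \<omega>)\<^sup>2 \<partial>M" and ?b = "\<integral>\<omega>. (Y \<omega>)\<^sup>2 \<partial>M" and ?c = "\<integral>\<omega>. X \<omega> * Y \<omega> \<partial>M"
  have quad: "0 \<le> s\<^sup>2 * ?a + 2 * s * ?c + ?b" for s
  proof -
    have "0 \<le> (\<integral>\<omega>. (s * X \<omega> + Y \<omega>)\<^sup>2 \<partial>M)" by simp
    also have "(\<lambda>\<omega>. (s * X \<omega> + Y \<omega>)\<^sup>2) = (\<lambda>\<omega>. s\<^sup>2 * (X \<omega>)\<^sup>2 + 2 * s * (X \<omega> * Y \<omega>) + (Y \<omega>)\<^sup>2)"
      by (simp add: power2_sum power_mult_distrib mult_ac fun_eq_iff)
    also have "(\<integral>\<omega>. s\<^sup>2 * (X \<omega>)\<^sup>2 + 2 * s * (X \<omega> * Y \<omega>) + (Y \<omega>)\<^sup>2 \<partial>M) = s\<^sup>2 * ?a + 2 * s * ?c + ?b"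
      using X Y square_int_mult_integrable[OF X Y] by (simp add: square_int_def)
    finally show ?thesis .
  qed
  show ?thesis
  proof (cases "?a = 0")
    case True
    have "?c = 0"
    proof (rule ccontr)
      assume "?c \<noteq> 0"
      then have "2 * (- (?b + 1) / (2 * ?c)) * ?c = - (?b + 1)" by simp
      then show False using quad[of "- (?b + 1) / (2 * ?c)"] unfolding True by linarith
    qed
    then show ?thesis by simp
  next
    case False
    moreover have "0 \<le> ?a" by simp
    ultimately have a: "0 < ?a" by linarith
    have "0 \<le> ?a * ((- ?c / ?a)\<^sup>2 * ?a + 2 * (- ?c / ?a) * ?c + ?b)"
      using quad[of "- ?c / ?a"] a by (intro mult_nonneg_nonneg) auto
    also have "\<dots> = ?a * ?b - ?c\<^sup>2"
    proof -
      have "a * ((- c / a)\<^sup>2 * a + 2 * (- c / a) * c + b) = a * b - c\<^sup>2" if "a > 0" for a b c :: real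
        using that by (simp add: field_simps power2_eq_square)
      then show ?thesis using a .
    qed
    finally show ?thesis by simp
  qed
qed

lemma tendsto_zero_below:
  fixes f g :: "nat \<Rightarrow> real"
  assumes "\<And>n. 0 \<le> f n" "\<And>n. f n \<le> g n" "g \<longlonglongrightarrow> 0"
  shows "f \<longlonglongrightarrow> 0"
  using assms by (intro tendsto_sandwich[OF _ _ tendsto_const assms(3)]) auto

lemma integral_mult_tendsto:
  assumes X: "square_int M X" "\<And>n. square_int M (Y n)" and Z: "square_int M Z"
    and lim: "(\<lambda>n. \<integral>\<omega>. (X \<omega> - Y n \<omega>)\<^sup>2 \<partial>M) \<longlonglongrightarrow> 0"
  shows "(\<lambda>n. \<integral>\<omega>. Y n \<omega> * Z \<omega> \<partial>M) \<longlonglongrightarrow> (\<integral>\<omega>. X \<omega> * Z \<omega> \<partial>M)"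
proof -
  let ?d = "\<lambda>n. \<integral>\<omega>. (X \<omega> - Y n \<omega>) * Z \<omega> \<partial>M"
  have d: "?d n = (\<integral>\<omega>. X \<omega> * Z \<omega> \<partial>M) - (\<integral>\<omega>. Y n \<omega> * Z \<omega> \<partial>M)" for n
    using X Z by (simp add: left_diff_distrib square_int_mult_integrable)
  have "(\<lambda>n. (?d n)\<^sup>2) \<longlonglongrightarrow> 0"
  proof (rule tendsto_zero_below)
    show "(?d n)\<^sup>2 \<le> (\<integral>\<omega>. (X \<omega> - Y n \<omega>)\<^sup>2 \<partial>M) * (\<integral>\<omega>. (Z \<omega>)\<^sup>2 \<partial>M)" for n
      by (intro Cauchy_Schwarz_integral square_int_diff X Z)
    show "(\<lambda>n. (\<integral>\<omega>. (X \<omega> - Y n \<omega>)\<^sup>2 \<partial>M) * (\<integral>\<omega>. (Z \<omega>)\<^sup>2 \<partial>M)) \<longlonglongrightarrow> 0"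
      using tendsto_mult_left_zero[OF lim] .
  qed simp
  then have "(\<lambda>n. sqrt ((?d n)\<^sup>2)) \<longlonglongrightarrow> sqrt 0" by (rule tendsto_real_sqrt)
  then have "?d \<longlonglongrightarrow> 0" by (simp add: tendsto_rabs_zero_iff)
  then have "(\<lambda>n. (\<integral>\<omega>. X \<omega> * Z \<omega> \<partial>M) - ?d n) \<longlonglongrightarrow> (\<integral>\<omega>. X \<omega> * Z \<omega> \<partial>M) - 0"
    by (intro tendsto_intros)
  then show ?thesis by (simp add: d)
qed

lemma square_integral_add_le:
  assumes "square_int M X" "square_int M Y"
  shows "(\<integral>\<omega>. (X \<omega> + Y \<omega>)\<^sup>2 \<partial>M) \<le> 2 * (\<integral>\<omega>. (X \<omega>)\<^sup>2 \<partial>M) + 2 * (\<integral>\<omega>. (Y \<omega>)\<^sup>2 \<partial>M)"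
proof -
  have "(\<integral>\<omega>. (X \<omega> + Y \<omega>)\<^sup>2 \<partial>M) \<le> (\<integral>\<omega>. 2 * (X \<omega>)\<^sup>2 + 2 * (Y \<omega>)\<^sup>2 \<partial>M)"
  proof (rule integral_mono)
    show "integrable M (\<lambda>\<omega>. (X \<omega> + Y \<omega>)\<^sup>2)" using square_int_add[OF assms] by (rule square_intD)
    show "integrable M (\<lambda>\<omega>. 2 * (X \<omega>)\<^sup>2 + 2 * (Y \<omega>)\<^sup>2)"
      by (intro Bochner_Integration.integrable_add integrable_mult_right square_intD(2) assms)
    fix \<omega> show "(X \<omega> + Y \<omega>)\<^sup>2 \<le> 2 * (X \<omega>)\<^sup>2 + 2 * (Y \<omega>)\<^sup>2"
      using zero_le_power2[of "X \<omega> - Y \<omega>"] by (simp add: power2_sum power2_diff)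
  qed
  also have "\<dots> = 2 * (\<integral>\<omega>. (X \<omega>)\<^sup>2 \<partial>M) + 2 * (\<integral>\<omega>. (Y \<omega>)\<^sup>2 \<partial>M)"
    using assms by (simp add: square_int_def)
  finally show ?thesis .
qed

lemma square_integral_zero_AE:
  assumes "square_int M X" "(\<integral>\<omega>. X \<omega> * X \<omega> \<partial>M) = 0"
  shows "AE \<omega> in M. X \<omega> = 0"
  using integral_nonneg_eq_0_iff_AE[OF square_intD(2)[OF assms(1)]] assms(2)
  by (simp add: power2_eq_square)

text \<open>
  Completeness of \<open>L\<^sup>2\<close> for rapidly converging sequences: the increments are summable almost
  surely, and Fatou's lemma gives the rate. The limit is the pointwise \<open>lim\<close>, so it is
  measurable for every sigma-algebra for which all members of the sequence are.
\<close>

lemma (in prob_space) L2_limit: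
  fixes f :: "nat \<Rightarrow> 'a \<Rightarrow> real"
  assumes f: "\<And>n. square_int M (f n)"
    and cauchy: "\<And>n m. n \<le> m \<Longrightarrow> (\<integral>\<omega>. (f m \<omega> - f n \<omega>)\<^sup>2 \<partial>M) \<le> (1/4)^n"
  shows "square_int M (\<lambda>\<omega>. lim (\<lambda>n. f n \<omega>))" (is "square_int M ?P")
    and "(\<integral>\<omega>. (lim (\<lambda>n. f n \<omega>) - f n \<omega>)\<^sup>2 \<partial>M) \<le> (1/4)^n"
proof -
  have [measurable]: "f n \<in> borel_measurable M" for n using f by (rule square_intD)
  have P[measurable]: "?P \<in> borel_measurable M" by (rule borel_measurable_lim_metric) simp
  let ?d = "\<lambda>n \<omega>. \<bar>f (Suc n) \<omega> - f n \<omega>\<bar>"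
  have sqd: "square_int M (?d n)" for n
    using square_int_diff[OF f f, of "Suc n" n] by (auto simp: square_int_def)
  have int_d: "integrable M (?d n)" for n
    using square_int_mult_integrable[OF sqd square_int_one] prob_space_axioms by simp
  have d: "(\<integral>\<omega>. ?d n \<omega> \<partial>M) \<le> (1/2)^n" for n
  proof -
    have "(\<integral>\<omega>. ?d n \<omega> * 1 \<partial>M)\<^sup>2 \<le> (\<integral>\<omega>. (?d n \<omega>)\<^sup>2 \<partial>M) * (\<integral>\<omega>. 1\<^sup>2 \<partial>M)"
      by (intro Cauchy_Schwarz_integral sqd square_int_one prob_space_axioms)
    also have "\<dots> \<le> (1/4)^n" using cauchy[of n "Suc n"] by (simp add: prob_space)
    also have "(1/4::real)^n = ((1/2)\<^sup>2)^n" by (simp add: power2_eq_square)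
    also have "\<dots> = ((1/2)^n)\<^sup>2" by (simp only: power_mult[symmetric] mult.commute)
    finally have "(\<integral>\<omega>. ?d n \<omega> \<partial>M)\<^sup>2 \<le> ((1/2)^n)\<^sup>2" by (simp only: mult_1_right)
    then show ?thesis by (rule power2_le_imp_le) simp
  qed
  have "(\<integral>\<^sup>+\<omega>. (\<Sum>n. ennreal (?d n \<omega>)) \<partial>M) = (\<Sum>n. \<integral>\<^sup>+\<omega>. ennreal (?d n \<omega>) \<partial>M)"
    by (intro nn_integral_suminf) auto
  also have "\<dots> = (\<Sum>n. ennreal (\<integral>\<omega>. ?d n \<omega> \<partial>M))"
    by (intro suminf_cong nn_integral_eq_integral int_d) auto
  also have "\<dots> \<le> (\<Sum>n. ennreal ((1/2)^n))"
    by (intro suminf_le ennreal_leI d) auto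
  also have "\<dots> = ennreal 2"
  proof (rule suminf_ennreal_eq)
    show "(\<lambda>n. (1/2)^n) sums (2::real)" using geometric_sums[of "1/2::real"] by simp
  qed simp
  also have "\<dots> < \<infinity>" by simp
  finally have "(\<integral>\<^sup>+\<omega>. (\<Sum>n. ennreal (?d n \<omega>)) \<partial>M) \<noteq> \<infinity>"
    by (rule less_imp_neq)
  then have "AE \<omega> in M. (\<Sum>n. ennreal (?d n \<omega>)) \<noteq> \<infinity>"
    by (intro nn_integral_noteq_infinite) auto
  then have conv: "AE \<omega> in M. (\<lambda>n. f n \<omega>) \<longlonglongrightarrow> ?P \<omega>"
  proof eventually_elim
    case (elim \<omega>)
    then have "summable (\<lambda>n. ?d n \<omega>)"
      by (intro summable_suminf_not_top) auto
    then have "summable (\<lambda>n. f (Suc n) \<omega> - f n \<omega>)" by (rule summable_rabs_cancel)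
    then have "convergent (\<lambda>n. \<Sum>k<n. f (Suc k) \<omega> - f k \<omega>)" by (simp add: summable_iff_convergent)
    then have "convergent (\<lambda>n. f n \<omega> - f 0 \<omega>)"
      by (simp only: sum_lessThan_telescope[of "\<lambda>n. f n \<omega>"])
    then have "convergent (\<lambda>n. (f n \<omega> - f 0 \<omega>) + f 0 \<omega>)"
      by (intro convergent_add convergent_const)
    then show ?case by (simp add: convergent_LIMSEQ_iff)
  qed
  have bound: "(\<integral>\<^sup>+\<omega>. ennreal ((?P \<omega> - f n \<omega>)\<^sup>2) \<partial>M) \<le> ennreal ((1/4)^n)" for n
  proof -
    have "(\<integral>\<^sup>+\<omega>. ennreal ((?P \<omega> - f n \<omega>)\<^sup>2) \<partial>M) = (\<integral>\<^sup>+\<omega>. liminf (\<lambda>m. ennreal ((f m \<omega> - f n \<omega>)\<^sup>2)) \<partial>M)"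
      using conv
    proof (intro nn_integral_cong_AE, eventually_elim)
      case (elim \<omega>)
      then have "(\<lambda>m. ennreal ((f m \<omega> - f n \<omega>)\<^sup>2)) \<longlonglongrightarrow> ennreal ((?P \<omega> - f n \<omega>)\<^sup>2)"
        by (intro tendsto_ennrealI tendsto_intros)
      then show ?case by (rule lim_imp_Liminf[OF trivial_limit_sequentially, symmetric])
    qed
    also have "\<dots> \<le> liminf (\<lambda>m. \<integral>\<^sup>+\<omega>. ennreal ((f m \<omega> - f n \<omega>)\<^sup>2) \<partial>M)"
      by (intro nn_integral_liminf) auto
    also have "\<dots> \<le> liminf (\<lambda>m. ennreal ((1/4)^n))"
    proof (rule Liminf_mono, rule eventually_sequentiallyI)
      fix m assume "n \<le> m"
      have "(\<integral>\<^sup>+\<omega>. ennreal ((f m \<omega> - f n \<omega>)\<^sup>2) \<partial>M) = ennreal (\<integral>\<omega>. (f m \<omega> - f n \<omega>)\<^sup>2 \<partial>M)"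
        by (intro nn_integral_eq_integral square_intD(2) square_int_diff f) auto
      then show "(\<integral>\<^sup>+\<omega>. ennreal ((f m \<omega> - f n \<omega>)\<^sup>2) \<partial>M) \<le> ennreal ((1/4)^n)"
        using cauchy[OF \<open>n \<le> m\<close>] by (simp add: ennreal_leI)
    qed
    also have "\<dots> = ennreal ((1/4)^n)" by (simp add: Liminf_const)
    finally show ?thesis .
  qed
  have sq: "square_int M (\<lambda>\<omega>. ?P \<omega> - f n \<omega>)" for n
    unfolding square_int_def
  proof (rule conjI)
    show "(\<lambda>\<omega>. ?P \<omega> - f n \<omega>) \<in> borel_measurable M" by simp
    show "integrable M (\<lambda>\<omega>. (?P \<omega> - f n \<omega>)\<^sup>2)"
    proof (rule integrableI_bounded)
      show "(\<lambda>\<omega>. (?P \<omega> - f n \<omega>)\<^sup>2) \<in> borel_measurable M" by simp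
    have "(\<integral>\<^sup>+\<omega>. ennreal (norm ((?P \<omega> - f n \<omega>)\<^sup>2)) \<partial>M) = (\<integral>\<^sup>+\<omega>. ennreal ((?P \<omega> - f n \<omega>)\<^sup>2) \<partial>M)"
      by simp
    also note bound[of n]
    also have "ennreal ((1/4)^n) < \<infinity>" by simp
    finally show "(\<integral>\<^sup>+\<omega>. ennreal (norm ((?P \<omega> - f n \<omega>)\<^sup>2)) \<partial>M) < \<infinity>" .
    qed
  qed
  show "square_int M ?P"
    using square_int_add[OF sq[of 0] f[of 0]] by simp
  have "ennreal (\<integral>\<omega>. (?P \<omega> - f n \<omega>)\<^sup>2 \<partial>M) = (\<integral>\<^sup>+\<omega>. ennreal ((?P \<omega> - f n \<omega>)\<^sup>2) \<partial>M)"
    using square_intD(2)[OF sq[of n]] by (intro nn_integral_eq_integral[symmetric]) auto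
  with bound[of n] have "ennreal (\<integral>\<omega>. (?P \<omega> - f n \<omega>)\<^sup>2 \<partial>M) \<le> ennreal ((1/4)^n)"
    by (simp only:)
  then show "(\<integral>\<omega>. (?P \<omega> - f n \<omega>)\<^sup>2 \<partial>M) \<le> (1/4)^n"
    by (subst (asm) ennreal_le_iff) simp_all
qed

section \<open>Stationary combinations of processes and their limits\<close>

text \<open>
  A process is treated as a single vector: the coefficients of a combination are the same at
  every time.
\<close>

inductive_set combinations :: "(int \<Rightarrow> 'a \<Rightarrow> real) set \<Rightarrow> (int \<Rightarrow> 'a \<Rightarrow> real) set" for R where
  zero: "(\<lambda>t \<omega>. 0) \<in> combinations R"
| step: "Y \<in> combinations R \<Longrightarrow> g \<in> R \<Longrightarrow> (\<lambda>t \<omega>. Y t \<omega> + c * g t \<omega>) \<in> combinations R"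

text \<open>
  One combination has to approximate at all times simultaneously. Its members are therefore limits
  with time-invariant coefficients, and second moments of the members are as stationary as those
  of \<open>R\<close>.
\<close>

definition process_span :: "'a measure \<Rightarrow> (int \<Rightarrow> 'a \<Rightarrow> real) set \<Rightarrow> (int \<Rightarrow> 'a \<Rightarrow> real) set" where
  "process_span M R =
     {X. (\<forall>t. square_int M (X t)) \<and>
         (\<forall>e>0. \<exists>Y\<in>combinations R. \<forall>t. (\<integral>\<omega>. (X t \<omega> - Y t \<omega>)\<^sup>2 \<partial>M) < e)}"

definition square_int_processes :: "'a measure \<Rightarrow> (int \<Rightarrow> 'a \<Rightarrow> real) set" where
  "square_int_processes M = {X. \<forall>t. square_int M (X t)}"

lemma combinations_base: "g \<in> R \<Longrightarrow> g \<in> combinations R"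
  using combinations.step[OF combinations.zero, of g R 1] by simp

lemma combinations_add_cmult:
  assumes "X \<in> combinations R" "Y \<in> combinations R"
  shows "(\<lambda>t \<omega>. X t \<omega> + c * Y t \<omega>) \<in> combinations R"
  using assms(2)
proof induction
  case zero then show ?case using assms(1) by simp
next
  case (step Y g d)
  show ?case using combinations.step[OF step.IH step.hyps(2), of "c * d"] by (simp add: algebra_simps)
qed

lemma combinations_mono:
  assumes "R \<subseteq> R'" "X \<in> combinations R"
  shows "X \<in> combinations R'"
  using assms(2,1) by induction (auto intro: combinations.intros)

lemma square_int_combinations:
  assumes "R \<subseteq> square_int_processes M" "X \<in> combinations R"
  shows "square_int M (X t)"
  using assms(2,1)
  by induction (auto intro!: square_int_add square_int_cmult square_int_zero simp: square_int_processes_def)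

lemma combinations_measurable:
  assumes "X \<in> combinations R" "\<And>g. g \<in> R \<Longrightarrow> g t \<in> borel_measurable N"
  shows "X t \<in> borel_measurable N"
  using assms by (induction) auto

lemma combinations_stationary:
  assumes wss: "jointly_wss M R" and "X \<in> combinations R" "Y \<in> combinations R"
  shows "(\<integral>\<omega>. X (s + k) \<omega> * Y (t + k) \<omega> \<partial>M) = (\<integral>\<omega>. X s \<omega> * Y t \<omega> \<partial>M)"
proof -
  have R: "R \<subseteq> square_int_processes M" using wss by (auto simp: jointly_wss_def square_int_processes_def)
  note sq = square_int_combinations[OF R]
  have gs: "square_int M (g t)" if "g \<in> R" for g t using that R by (auto simp: square_int_processes_def)
  have base: "(\<integral>\<omega>. g (s + k) \<omega> * Y (t + k) \<omega> \<partial>M) = (\<integral>\<omega>. g s \<omega> * Y t \<omega> \<partial>M)" if g: "g \<in> R" for g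
    using assms(3)
  proof induction
    case zero show ?case by simp
  next
    case (step Y h c)
    have "(\<integral>\<omega>. g (s + k) \<omega> * h (t + k) \<omega> \<partial>M) = (\<integral>\<omega>. g s \<omega> * h t \<omega> \<partial>M)"
      using wss g step.hyps(2) by (simp add: jointly_wss_def)
    then show ?case
      using step.IH gs[OF g] gs[OF step.hyps(2)] sq[OF step.hyps(1)]
      by (simp add: distrib_left mult.left_commute[of _ c] square_int_mult_integrable)
  qed
  show ?thesis
    using assms(2)
  proof induction
    case zero show ?case by simp
  next
    case (step X g c)
    then show ?case
      using base[OF step.hyps(2)] gs[OF step.hyps(2)] sq[OF step.hyps(1)] sq[OF assms(3)]
      by (simp add: distrib_right mult.assoc square_int_mult_integrable)
  qed
qed

lemma process_span_sequence:
  assumes "X \<in> process_span M R"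
  obtains Y where "\<And>n. Y n \<in> combinations R"
    and "\<And>t. (\<lambda>n. \<integral>\<omega>. (X t \<omega> - Y n t \<omega>)\<^sup>2 \<partial>M) \<longlonglongrightarrow> 0"
proof -
  have "\<forall>n. \<exists>Y\<in>combinations R. \<forall>t. (\<integral>\<omega>. (X t \<omega> - Y t \<omega>)\<^sup>2 \<partial>M) < 1 / real (Suc n)"
    using assms by (auto simp: process_span_def)
  then obtain Y where Y: "\<And>n. Y n \<in> combinations R"
      "\<And>n t. (\<integral>\<omega>. (X t \<omega> - Y n t \<omega>)\<^sup>2 \<partial>M) < 1 / real (Suc n)"
    by metis
  have "(\<lambda>n. \<integral>\<omega>. (X t \<omega> - Y n t \<omega>)\<^sup>2 \<partial>M) \<longlonglongrightarrow> 0" for t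
    using LIMSEQ_inverse_real_of_nat Y(2)[of t]
    by (intro tendsto_zero_below[OF _ _ LIMSEQ_inverse_real_of_nat])
      (auto simp: inverse_eq_divide less_imp_le)
  with Y(1) show ?thesis using that by blast
qed

lemma process_spanD: "X \<in> process_span M R \<Longrightarrow> square_int M (X t)"
  by (simp add: process_span_def)

lemma process_span_mono: "R \<subseteq> R' \<Longrightarrow> process_span M R \<subseteq> process_span M R'"
  using combinations_mono unfolding process_span_def by blast

lemma process_span_base:
  assumes "R \<subseteq> square_int_processes M" "g \<in> R"
  shows "g \<in> process_span M R"
proof -
  have "\<exists>Y\<in>combinations R. \<forall>t. (\<integral>\<omega>. (g t \<omega> - Y t \<omega>)\<^sup>2 \<partial>M) < e" if "e > 0" for e
    using that combinations_base[OF assms(2)] by (intro bexI[of _ g]) auto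
  then show ?thesis
    using assms by (auto simp: process_span_def square_int_processes_def)
qed

lemma process_span_zero: "(\<lambda>t \<omega>. 0) \<in> process_span M R"
  unfolding process_span_def
  using combinations.zero by (auto intro!: square_int_zero bexI[of _ "\<lambda>t \<omega>. 0"])

lemma process_span_add_cmult:
  assumes R: "R \<subseteq> square_int_processes M" and X: "X \<in> process_span M R" and Y: "Y \<in> process_span M R"
  shows "(\<lambda>t \<omega>. X t \<omega> + c * Y t \<omega>) \<in> process_span M R"
proof -
  have "\<exists>Z\<in>combinations R. \<forall>t. (\<integral>\<omega>. (X t \<omega> + c * Y t \<omega> - Z t \<omega>)\<^sup>2 \<partial>M) < e" if e: "e > 0" for e
  proof -
    let ?e = "e / (4 * (1 + c\<^sup>2))"
    have c: "0 < 1 + c\<^sup>2" by (simp add: add_pos_nonneg)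
    then have e': "?e > 0" using e by simp
    obtain X' where X': "X' \<in> combinations R" "\<And>t. (\<integral>\<omega>. (X t \<omega> - X' t \<omega>)\<^sup>2 \<partial>M) < ?e"
      using X e' unfolding process_span_def by blast
    obtain Y' where Y': "Y' \<in> combinations R" "\<And>t. (\<integral>\<omega>. (Y t \<omega> - Y' t \<omega>)\<^sup>2 \<partial>M) < ?e"
      using Y e' unfolding process_span_def by blast
    have "(\<integral>\<omega>. (X t \<omega> + c * Y t \<omega> - (X' t \<omega> + c * Y' t \<omega>))\<^sup>2 \<partial>M) < e" for t
    proof -
      have "(\<integral>\<omega>. (X t \<omega> + c * Y t \<omega> - (X' t \<omega> + c * Y' t \<omega>))\<^sup>2 \<partial>M)
          = (\<integral>\<omega>. ((X t \<omega> - X' t \<omega>) + c * (Y t \<omega> - Y' t \<omega>))\<^sup>2 \<partial>M)"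
        by (simp add: algebra_simps)
      also have "\<dots> \<le> 2 * (\<integral>\<omega>. (X t \<omega> - X' t \<omega>)\<^sup>2 \<partial>M) + 2 * (\<integral>\<omega>. (c * (Y t \<omega> - Y' t \<omega>))\<^sup>2 \<partial>M)"
        by (intro square_integral_add_le square_int_diff square_int_cmult process_spanD[OF X] process_spanD[OF Y]
            square_int_combinations[OF R] X'(1) Y'(1))
      also have "(\<integral>\<omega>. (c * (Y t \<omega> - Y' t \<omega>))\<^sup>2 \<partial>M) = c\<^sup>2 * (\<integral>\<omega>. (Y t \<omega> - Y' t \<omega>)\<^sup>2 \<partial>M)"
        by (simp add: power_mult_distrib)
      also have "2 * (\<integral>\<omega>. (X t \<omega> - X' t \<omega>)\<^sup>2 \<partial>M) + 2 * (c\<^sup>2 * (\<integral>\<omega>. (Y t \<omega> - Y' t \<omega>)\<^sup>2 \<partial>M)) \<le> 2 * ?e + 2 * (c\<^sup>2 * ?e)"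
        using X'(2)[of t] Y'(2)[of t] by (intro add_mono mult_left_mono) auto
      also have "\<dots> = 2 * ((1 + c\<^sup>2) * ?e)" by (simp only: distrib_right distrib_left mult_1_left)
      also have "\<dots> = e / 2" using c by (simp add: field_simps)
      also have "\<dots> < e" using e by simp
      finally show ?thesis .
    qed
    then show ?thesis
      by (intro bexI[OF _ combinations_add_cmult[OF X'(1) Y'(1), of c]] allI)
  qed
  moreover have "square_int M (\<lambda>\<omega>. X t \<omega> + c * Y t \<omega>)" for t
    by (intro square_int_add square_int_cmult process_spanD[OF X] process_spanD[OF Y])
  ultimately show ?thesis by (auto simp: process_span_def)
qed

lemma process_span_lin:
  assumes "R \<subseteq> square_int_processes M"
  shows process_span_add: "X \<in> process_span M R \<Longrightarrow> Y \<in> process_span M R \<Longrightarrow> (\<lambda>t \<omega>. X t \<omega> + Y t \<omega>) \<in> process_span M R"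
    and process_span_diff: "X \<in> process_span M R \<Longrightarrow> Y \<in> process_span M R \<Longrightarrow> (\<lambda>t \<omega>. X t \<omega> - Y t \<omega>) \<in> process_span M R"
    and process_span_cmult: "Y \<in> process_span M R \<Longrightarrow> (\<lambda>t \<omega>. c * Y t \<omega>) \<in> process_span M R"
  using process_span_add_cmult[OF assms, of X Y 1] process_span_add_cmult[OF assms, of X Y "-1"]
    process_span_add_cmult[OF assms process_span_zero, of Y c] by auto

lemma process_span_sum:
  assumes "R \<subseteq> square_int_processes M" "\<And>i. i \<in> I \<Longrightarrow> X i \<in> process_span M R"
  shows "(\<lambda>t \<omega>. \<Sum>i\<in>I. X i t \<omega>) \<in> process_span M R"
  using assms(2)
  by (induction I rule: infinite_finite_induct) (auto intro: process_span_add[OF assms(1)] process_span_zero)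

lemma process_span_integral_tendsto:
  assumes R: "R \<subseteq> square_int_processes M" and Y: "\<And>n. Y n \<in> combinations R"
    and X: "X \<in> process_span M R"
    and lim: "\<And>t. (\<lambda>n. \<integral>\<omega>. (X t \<omega> - Y n t \<omega>)\<^sup>2 \<partial>M) \<longlonglongrightarrow> 0" and Z: "square_int M Z"
  shows "(\<lambda>n. \<integral>\<omega>. Y n t \<omega> * Z \<omega> \<partial>M) \<longlonglongrightarrow> (\<integral>\<omega>. X t \<omega> * Z \<omega> \<partial>M)"
  by (intro integral_mult_tendsto Z process_spanD[OF X] square_int_combinations[OF R] Y lim)

lemma process_span_orthogonal:
  assumes R: "R \<subseteq> square_int_processes M" and X: "X \<in> process_span M R" and Z: "square_int M Z"
    and orth: "\<And>g. g \<in> R \<Longrightarrow> (\<integral>\<omega>. g t \<omega> * Z \<omega> \<partial>M) = 0"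
  shows "(\<integral>\<omega>. X t \<omega> * Z \<omega> \<partial>M) = 0"
proof -
  obtain Y where Y: "\<And>n. Y n \<in> combinations R" "\<And>t. (\<lambda>n. \<integral>\<omega>. (X t \<omega> - Y n t \<omega>)\<^sup>2 \<partial>M) \<longlonglongrightarrow> 0"
    using process_span_sequence[OF X] by blast
  have "(\<integral>\<omega>. V t \<omega> * Z \<omega> \<partial>M) = 0" if "V \<in> combinations R" for V
    using that
  proof induction
    case (step V g c)
    have "square_int M (g t)" using step.hyps(2) R by (auto simp: square_int_processes_def)
    then show ?case
      using step.IH orth[OF step.hyps(2)] square_int_combinations[OF R step.hyps(1)] Z
      by (simp add: distrib_right mult.assoc square_int_mult_integrable)
  qed simp
  then show ?thesis
    using process_span_integral_tendsto[OF R Y(1) X Y(2) Z, of t] Y(1) by (simp add: LIMSEQ_const_iff)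
qed

text \<open>
  Inner products are continuous in each factor separately, so the limit is taken in one factor
  at a time.
\<close>

lemma process_span_stationary:
  assumes wss: "jointly_wss M R" and X: "X \<in> process_span M R" and Y: "Y \<in> process_span M R"
  shows "(\<integral>\<omega>. X (s + k) \<omega> * Y (t + k) \<omega> \<partial>M) = (\<integral>\<omega>. X s \<omega> * Y t \<omega> \<partial>M)"
proof -
  have R: "R \<subseteq> square_int_processes M" using wss by (auto simp: jointly_wss_def square_int_processes_def)
  obtain X' where X': "\<And>n. X' n \<in> combinations R" "\<And>t. (\<lambda>n. \<integral>\<omega>. (X t \<omega> - X' n t \<omega>)\<^sup>2 \<partial>M) \<longlonglongrightarrow> 0"
    using process_span_sequence[OF X] by blast
  obtain Y' where Y': "\<And>n. Y' n \<in> combinations R" "\<And>t. (\<lambda>n. \<integral>\<omega>. (Y t \<omega> - Y' n t \<omega>)\<^sup>2 \<partial>M) \<longlonglongrightarrow> 0"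
    using process_span_sequence[OF Y] by blast
  have 1: "(\<integral>\<omega>. X (s + k) \<omega> * V (t + k) \<omega> \<partial>M) = (\<integral>\<omega>. X s \<omega> * V t \<omega> \<partial>M)" if V: "V \<in> combinations R" for V
    using process_span_integral_tendsto[OF R X'(1) X X'(2) square_int_combinations[OF R V], of "s + k" "t + k"]
      process_span_integral_tendsto[OF R X'(1) X X'(2) square_int_combinations[OF R V], of s t]
    by (simp add: combinations_stationary[OF wss X'(1) V] LIMSEQ_unique)
  show ?thesis
    using process_span_integral_tendsto[OF R Y'(1) Y Y'(2) process_spanD[OF X], of "t + k" "s + k"]
      process_span_integral_tendsto[OF R Y'(1) Y Y'(2) process_spanD[OF X], of t s]
    by (simp add: 1[OF Y'(1)] mult.commute[of "Y' _ _ _"] mult.commute[of "Y _ _"] LIMSEQ_unique)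
qed

lemma process_span_jointly_wss:
  assumes wss: "jointly_wss M R" and mean: "\<And>g t. g \<in> R \<Longrightarrow> (\<integral>\<omega>. g t \<omega> \<partial>M) = 0"
    and M: "prob_space M" and Q: "Q \<subseteq> process_span M R"
  shows "jointly_wss M Q" and "\<And>g t. g \<in> Q \<Longrightarrow> (\<integral>\<omega>. g t \<omega> \<partial>M) = 0"
proof -
  have R: "R \<subseteq> square_int_processes M" using wss by (auto simp: jointly_wss_def square_int_processes_def)
  show mean': "(\<integral>\<omega>. g t \<omega> \<partial>M) = 0" if "g \<in> Q" for g t
    using process_span_orthogonal[OF R _ square_int_one[OF M], of g t] mean that Q by auto
  show "jointly_wss M Q"
    unfolding jointly_wss_def using Q mean' process_spanD process_span_stationary[OF wss] by (auto dest!: subsetD[OF Q])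
qed

text \<open>
  First-order condition at the minimum of a quadratic. The denominator \<open>\<gamma> + 1\<close> in the test point
  avoids a case distinction on \<open>\<gamma> = 0\<close>.
\<close>

lemma linear_term_zero:
  fixes \<gamma> \<kappa> :: real
  assumes nonneg: "\<And>s. 0 \<le> - 2 * s * \<kappa> + s\<^sup>2 * \<gamma>" and \<gamma>: "0 \<le> \<gamma>"
  shows "\<kappa> = 0"
proof -
  define q where "q = \<kappa> / (\<gamma> + 1)"
  have \<kappa>: "\<kappa> = q * (\<gamma> + 1)" using \<gamma> by (simp add: q_def)
  have "0 \<le> (\<gamma> + 1)\<^sup>2 * (- 2 * q * \<kappa> + q\<^sup>2 * \<gamma>)"
    by (intro mult_nonneg_nonneg nonneg) auto
  also have "\<dots> = - (\<gamma> + 2) * \<kappa>\<^sup>2"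
    unfolding \<kappa> by (simp add: power2_eq_square algebra_simps)
  finally have "(\<gamma> + 2) * \<kappa>\<^sup>2 \<le> 0" unfolding mult_minus_left by linarith
  then show ?thesis using \<gamma> by (simp add: mult_le_0_iff)
qed

lemma parallelogram_midpoint:
  fixes x a b :: real
  shows "(a - b)\<^sup>2 = 2 * (x - a)\<^sup>2 + 2 * (x - b)\<^sup>2 - 4 * (x - (1/2 * a + 1/2 * b))\<^sup>2"
  by (simp add: power2_eq_square field_simps)

text \<open>
  The orthogonal projections of \<open>X(t)\<close> onto the closed spans of \<open>{g(t) | g \<in> R}\<close> form a single member
  of the span of \<open>R\<close>. Minimise the distance at time 0: by the parallelogram law a minimising
  sequence of combinations is Cauchy there, and by stationarity it is Cauchy at the same rate at
  every other time. The residual is orthogonal to \<open>R\<close> at time 0 by minimality, hence at all times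
  by stationarity. The last clause says that the projection is adapted to whatever \<open>R\<close> is adapted to.
\<close>

theorem (in prob_space) stationary_projection:
  assumes wss: "jointly_wss M (insert X R)"
  obtains P where "P \<in> process_span M R"
    and "\<And>g t. g \<in> R \<Longrightarrow> (\<integral>\<omega>. (X t \<omega> - P t \<omega>) * g t \<omega> \<partial>M) = 0"
    and "\<And>N t. (\<And>g. g \<in> R \<Longrightarrow> g t \<in> borel_measurable N) \<Longrightarrow> P t \<in> borel_measurable N"
proof -
  let ?R = "insert X R"
  have R': "?R \<subseteq> square_int_processes M" using wss by (auto simp: jointly_wss_def square_int_processes_def)
  then have R: "R \<subseteq> square_int_processes M" by auto
  have X: "square_int M (X t)" for t using R' by (auto simp: square_int_processes_def)
  note sq = square_int_combinations[OF R]
  define err where "err = (\<lambda>Y :: int \<Rightarrow> 'a \<Rightarrow> real. \<integral>\<omega>. (X 0 \<omega> - Y 0 \<omega>)\<^sup>2 \<partial>M)"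
  have comb_shift: "(\<integral>\<omega>. (Y t \<omega>)\<^sup>2 \<partial>M) = (\<integral>\<omega>. (Y 0 \<omega>)\<^sup>2 \<partial>M)" if "Y \<in> combinations ?R" for Y t
    using combinations_stationary[OF wss that that, of 0 t 0] by (simp add: power2_eq_square)
  define D where "D = (INF Y\<in>combinations R. err Y)"
  have bdd: "bdd_below (err ` combinations R)" by (intro bdd_belowI[of _ 0]) (auto simp: err_def)
  have D_le: "D \<le> err Y" if "Y \<in> combinations R" for Y
    unfolding D_def using bdd that by (rule cINF_lower)
  have "\<exists>Y\<in>combinations R. err Y < D + (1/4)^n / 4" for n
    using cINF_less_iff[OF _ bdd, of "D + (1/4)^n / 4"] combinations.zero[of R] by (auto simp: D_def)
  then obtain Y where Y: "\<And>n. Y n \<in> combinations R" and Yd: "\<And>n. err (Y n) < D + (1/4)^n / 4"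
    by metis
  have diff: "(\<lambda>t \<omega>. Y m t \<omega> - Y n t \<omega>) \<in> combinations R" for m n
    using combinations_add_cmult[OF Y[of m] Y[of n], of "-1"] by simp
  have cauchy: "(\<integral>\<omega>. (Y m t \<omega> - Y n t \<omega>)\<^sup>2 \<partial>M) \<le> (1/4)^n" if "n \<le> m" for m n t
  proof -
    \<comment> \<open>Parallelogram law at time 0; the midpoint of two almost minimisers is no better than \<open>D\<close>.\<close>
    let ?mid = "\<lambda>t \<omega>. 1/2 * Y m t \<omega> + 1/2 * Y n t \<omega>"
    have mid: "?mid \<in> combinations R"
      using combinations_add_cmult[OF combinations_add_cmult[OF combinations.zero Y[of m], of "1/2"] Y[of n], of "1/2"]
      by simp
    have i: "integrable M (\<lambda>\<omega>. (X 0 \<omega> - Y k 0 \<omega>)\<^sup>2)" for k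
      by (intro square_intD(2) square_int_diff X sq Y)
    have i': "integrable M (\<lambda>\<omega>. (X 0 \<omega> - ?mid 0 \<omega>)\<^sup>2)"
      by (intro square_intD(2) square_int_diff X sq[OF mid])
    have "(\<integral>\<omega>. (Y m t \<omega> - Y n t \<omega>)\<^sup>2 \<partial>M) = (\<integral>\<omega>. (Y m 0 \<omega> - Y n 0 \<omega>)\<^sup>2 \<partial>M)"
      using comb_shift[OF combinations_mono[OF _ diff]] by blast
    also have "(\<lambda>\<omega>. (Y m 0 \<omega> - Y n 0 \<omega>)\<^sup>2)
        = (\<lambda>\<omega>. 2 * (X 0 \<omega> - Y m 0 \<omega>)\<^sup>2 + 2 * (X 0 \<omega> - Y n 0 \<omega>)\<^sup>2 - 4 * (X 0 \<omega> - ?mid 0 \<omega>)\<^sup>2)"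
      by (rule ext) (rule parallelogram_midpoint)
    also have "(\<integral>\<omega>. 2 * (X 0 \<omega> - Y m 0 \<omega>)\<^sup>2 + 2 * (X 0 \<omega> - Y n 0 \<omega>)\<^sup>2 - 4 * (X 0 \<omega> - ?mid 0 \<omega>)\<^sup>2 \<partial>M)
        = 2 * err (Y m) + 2 * err (Y n) - 4 * err ?mid"
      unfolding err_def using i i' by simp
    also have "\<dots> \<le> (1/4)^m / 2 + (1/4)^n / 2"
      using Yd[of m] Yd[of n] D_le[OF mid] by linarith
    also have "(1/4::real)^m \<le> (1/4)^n"
      by (rule power_decreasing[OF that]) simp_all
    then have "(1/4::real)^m / 2 + (1/4)^n / 2 \<le> (1/4)^n" by linarith
    finally show ?thesis .
  qed
  define P where "P = (\<lambda>t \<omega>. lim (\<lambda>n. Y n t \<omega>))"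
  have P: "square_int M (P t)" and P_le: "(\<integral>\<omega>. (P t \<omega> - Y n t \<omega>)\<^sup>2 \<partial>M) \<le> (1/4)^n" for t n
    unfolding P_def using L2_limit[of "\<lambda>n. Y n t", OF sq[OF Y] cauchy] by auto
  have lim14: "(\<lambda>n. (1/4::real)^n) \<longlonglongrightarrow> 0" by (intro LIMSEQ_power_zero) auto
  have span: "P \<in> process_span M R"
  proof -
    have "\<exists>Y\<in>combinations R. \<forall>t. (\<integral>\<omega>. (P t \<omega> - Y t \<omega>)\<^sup>2 \<partial>M) < e" if "e > 0" for e
    proof -
      obtain n where "(1/4::real)^n < e" using \<open>e > 0\<close> real_arch_pow_inv[of e "1/4"] by auto
      then show ?thesis using Y[of n] P_le[of _ n] by (intro bexI[of _ "Y n"]) (auto intro: le_less_trans)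
    qed
    then show ?thesis using P by (auto simp: process_span_def)
  qed
  moreover have "(\<integral>\<omega>. (X t \<omega> - P t \<omega>) * g t \<omega> \<partial>M) = 0" if g: "g \<in> R" for g t
  proof -
    have gsq: "square_int M (g t)" for t using g R by (auto simp: square_int_processes_def)
    let ?\<gamma> = "\<integral>\<omega>. (g 0 \<omega>)\<^sup>2 \<partial>M" and ?\<kappa> = "\<integral>\<omega>. (X 0 \<omega> - P 0 \<omega>) * g 0 \<omega> \<partial>M"
    have "0 \<le> - 2 * s * ?\<kappa> + s\<^sup>2 * ?\<gamma>" for s
    proof (rule LIMSEQ_le_const)
      have "(\<lambda>n. \<integral>\<omega>. Y n 0 \<omega> * g 0 \<omega> \<partial>M) \<longlonglongrightarrow> (\<integral>\<omega>. P 0 \<omega> * g 0 \<omega> \<partial>M)"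
      proof (intro process_span_integral_tendsto[OF R Y span] gsq)
        fix t show "(\<lambda>n. \<integral>\<omega>. (P t \<omega> - Y n t \<omega>)\<^sup>2 \<partial>M) \<longlonglongrightarrow> 0"
          by (intro tendsto_zero_below[OF _ _ lim14] P_le) auto
      qed
      then have "(\<lambda>n. (\<integral>\<omega>. X 0 \<omega> * g 0 \<omega> \<partial>M) - (\<integral>\<omega>. Y n 0 \<omega> * g 0 \<omega> \<partial>M)) \<longlonglongrightarrow> ?\<kappa>"
        using X P gsq by (auto simp: left_diff_distrib square_int_mult_integrable intro!: tendsto_intros)
      moreover have "(\<lambda>n. (1/4)^n / 4) \<longlonglongrightarrow> (0::real) / 4" by (rule tendsto_divide[OF lim14 tendsto_const]) simp
      ultimately have "(\<lambda>n. (1/4)^n / 4 - 2 * s * ((\<integral>\<omega>. X 0 \<omega> * g 0 \<omega> \<partial>M) - (\<integral>\<omega>. Y n 0 \<omega> * g 0 \<omega> \<partial>M)) + s\<^sup>2 * ?\<gamma>)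
          \<longlonglongrightarrow> 0 / 4 - 2 * s * ?\<kappa> + s\<^sup>2 * ?\<gamma>"
        by (intro tendsto_add tendsto_diff tendsto_mult_left tendsto_const)
      then show "(\<lambda>n. (1/4)^n / 4 - 2 * s * ((\<integral>\<omega>. X 0 \<omega> * g 0 \<omega> \<partial>M) - (\<integral>\<omega>. Y n 0 \<omega> * g 0 \<omega> \<partial>M)) + s\<^sup>2 * ?\<gamma>)
          \<longlonglongrightarrow> - 2 * s * ?\<kappa> + s\<^sup>2 * ?\<gamma>" by simp
      have "0 \<le> (1/4)^n / 4 - 2 * s * ((\<integral>\<omega>. X 0 \<omega> * g 0 \<omega> \<partial>M) - (\<integral>\<omega>. Y n 0 \<omega> * g 0 \<omega> \<partial>M)) + s\<^sup>2 * ?\<gamma>" for n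
      proof -
        have "(\<lambda>t \<omega>. Y n t \<omega> + s * g t \<omega>) \<in> combinations R" using Y g by (rule combinations.step)
        then have "D \<le> (\<integral>\<omega>. (X 0 \<omega> - (Y n 0 \<omega> + s * g 0 \<omega>))\<^sup>2 \<partial>M)"
          using D_le by (auto simp: err_def)
        also have "(\<lambda>\<omega>. (X 0 \<omega> - (Y n 0 \<omega> + s * g 0 \<omega>))\<^sup>2)
            = (\<lambda>\<omega>. (X 0 \<omega> - Y n 0 \<omega>)\<^sup>2 - 2 * s * (X 0 \<omega> * g 0 \<omega> - Y n 0 \<omega> * g 0 \<omega>) + s\<^sup>2 * (g 0 \<omega>)\<^sup>2)"
          by (simp add: fun_eq_iff power2_eq_square left_diff_distrib right_diff_distrib distrib_left distrib_right)
        also have "(\<integral>\<omega>. (X 0 \<omega> - Y n 0 \<omega>)\<^sup>2 - 2 * s * (X 0 \<omega> * g 0 \<omega> - Y n 0 \<omega> * g 0 \<omega>) + s\<^sup>2 * (g 0 \<omega>)\<^sup>2 \<partial>M)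
            = err (Y n) - 2 * s * ((\<integral>\<omega>. X 0 \<omega> * g 0 \<omega> \<partial>M) - (\<integral>\<omega>. Y n 0 \<omega> * g 0 \<omega> \<partial>M)) + s\<^sup>2 * ?\<gamma>"
          using square_intD(2)[OF square_int_diff[OF X sq[OF Y]]] square_intD(2)[OF gsq]
            square_int_mult_integrable[OF X gsq] square_int_mult_integrable[OF sq[OF Y] gsq]
          by (simp add: err_def)
        finally show ?thesis using Yd[of n] by linarith
      qed
      then show "\<exists>N. \<forall>n\<ge>N. 0 \<le> (1/4)^n / 4 - 2 * s * ((\<integral>\<omega>. X 0 \<omega> * g 0 \<omega> \<partial>M) - (\<integral>\<omega>. Y n 0 \<omega> * g 0 \<omega> \<partial>M)) + s\<^sup>2 * ?\<gamma>"
        by blast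
    qed
    then have k0: "?\<kappa> = 0" by (rule linear_term_zero) simp
    have "(\<lambda>t \<omega>. X t \<omega> - P t \<omega>) \<in> process_span M ?R" "g \<in> process_span M ?R"
      using process_span_base[OF R'] g span process_span_mono[of R ?R M]
      by (auto intro!: process_span_diff[OF R'])
    from process_span_stationary[OF wss this, of 0 t 0] k0 show ?thesis by simp
  qed
  moreover have "P t \<in> borel_measurable N" if "\<And>g. g \<in> R \<Longrightarrow> g t \<in> borel_measurable N" for N t
  proof -
    have [measurable]: "Y n t \<in> borel_measurable N" for n using combinations_measurable[OF Y that] .
    show ?thesis unfolding P_def by measurable
  qed
  ultimately show ?thesis using that by blast
qed

text \<open>
  The difference lies in the span and is orthogonal to it.
\<close>

lemma process_span_AE_unique:
  assumes R: "R \<subseteq> square_int_processes M" and P: "P \<in> process_span M R" "Q \<in> process_span M R"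
    and eq: "\<And>g. g \<in> R \<Longrightarrow> (\<integral>\<omega>. P t \<omega> * g t \<omega> \<partial>M) = (\<integral>\<omega>. Q t \<omega> * g t \<omega> \<partial>M)"
  shows "AE \<omega> in M. P t \<omega> = Q t \<omega>"
proof -
  let ?d = "\<lambda>t \<omega>. P t \<omega> - Q t \<omega>"
  have d: "?d \<in> process_span M R" using P by (rule process_span_diff[OF R])
  have "(\<integral>\<omega>. ?d t \<omega> * ?d t \<omega> \<partial>M) = 0"
  proof (rule process_span_orthogonal[OF R d process_spanD[OF d]])
    fix g assume g: "g \<in> R"
    then have gs: "square_int M (g t)" using R by (auto simp: square_int_processes_def)
    have "(\<integral>\<omega>. g t \<omega> * ?d t \<omega> \<partial>M) = (\<integral>\<omega>. P t \<omega> * g t \<omega> - Q t \<omega> * g t \<omega> \<partial>M)"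
      by (intro Bochner_Integration.integral_cong refl) (simp add: left_diff_distrib right_diff_distrib)
    also have "\<dots> = (\<integral>\<omega>. P t \<omega> * g t \<omega> \<partial>M) - (\<integral>\<omega>. Q t \<omega> * g t \<omega> \<partial>M)"
      by (intro Bochner_Integration.integral_diff square_int_mult_integrable gs process_spanD[OF P(1)] process_spanD[OF P(2)])
    also have "\<dots> = 0" using eq[OF g] by simp
    finally show "(\<integral>\<omega>. g t \<omega> * ?d t \<omega> \<partial>M) = 0" .
  qed
  then have "AE \<omega> in M. ?d t \<omega> = 0" by (rule square_integral_zero_AE[OF process_spanD[OF d]])
  then show ?thesis by eventually_elim simp
qed

lemma combinations_slice:
  assumes "Y \<in> combinations R"
  shows "\<exists>S c. finite S \<and> S \<subseteq> {g t | g. g \<in> R} \<and> (\<forall>\<omega>. Y t \<omega> = (\<Sum>h\<in>S. c h * h \<omega>))"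
  using assms
proof induction
  case zero
  have "finite {}" "{} \<subseteq> {g t | g. g \<in> R}" "\<forall>\<omega>. 0 = (\<Sum>h\<in>{}. (0::real) * h \<omega>)" by simp_all
  then show ?case by (intro exI conjI)
next
  case (step Y g d)
  from step.IH obtain S c where S: "finite S" "S \<subseteq> {g t | g. g \<in> R}" "\<forall>\<omega>. Y t \<omega> = (\<Sum>h\<in>S. c h * h \<omega>)"
    by (elim exE conjE)
  let ?c = "\<lambda>h. (if h \<in> S then c h else 0) + (if h = g t then d else 0)"
  have "Y t \<omega> + d * g t \<omega> = (\<Sum>h\<in>insert (g t) S. ?c h * h \<omega>)" for \<omega>
  proof -
    have "(\<Sum>h\<in>insert (g t) S. ?c h * h \<omega>)
        = (\<Sum>h\<in>insert (g t) S. (if h \<in> S then c h * h \<omega> else 0) + (if h = g t then d * h \<omega> else 0))"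
      by (intro sum.cong refl) (simp add: distrib_right)
    also have "\<dots> = (\<Sum>h\<in>insert (g t) S. (if h \<in> S then c h * h \<omega> else 0)) + (\<Sum>h\<in>insert (g t) S. (if h = g t then d * h \<omega> else 0))"
      by (rule sum.distrib)
    also have "(\<Sum>h\<in>insert (g t) S. (if h \<in> S then c h * h \<omega> else 0)) = (\<Sum>h\<in>S. c h * h \<omega>)"
      using S(1) by (intro sum.mono_neutral_cong_right) auto
    also have "(\<Sum>h\<in>insert (g t) S. (if h = g t then d * h \<omega> else 0)) = d * g t \<omega>"
      using S(1) by (subst sum.delta) simp_all
    finally show ?thesis using S(3) by simp
  qed
  then have "\<forall>\<omega>. Y t \<omega> + d * g t \<omega> = (\<Sum>h\<in>insert (g t) S. ?c h * h \<omega>)" by (rule allI)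
  moreover have "finite (insert (g t) S)" using S(1) by simp
  moreover have "insert (g t) S \<subseteq> {g t | g. g \<in> R}"
    using S(2) step.hyps(2) by auto
  ultimately show ?case by (intro exI conjI)
qed

text \<open>
  Connects time-invariant combinations of processes with the closed subspaces of random
  variables that define \<open>y\<^sup>d\<close>.
\<close>

lemma process_span_slice:
  assumes "X \<in> process_span M R"
  shows "X t \<in> closed_span M {g t | g. g \<in> R}"
  unfolding closed_span_def
proof (intro CollectI conjI allI impI)
  show "square_int M (X t)" using assms by (rule process_spanD)
  fix e :: real assume "e > 0"
  then obtain Y where Y: "Y \<in> combinations R" "(\<integral>\<omega>. (X t \<omega> - Y t \<omega>)\<^sup>2 \<partial>M) < e"
    using assms unfolding process_span_def by blast
  show "\<exists>S c. finite S \<and> S \<subseteq> {g t | g. g \<in> R} \<and> (\<integral>\<omega>. (X t \<omega> - (\<Sum>g\<in>S. c g * g \<omega>))\<^sup>2 \<partial>M) < e"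
  proof -
    obtain S c where S: "finite S" "S \<subseteq> {g t | g. g \<in> R}" "\<forall>\<omega>. Y t \<omega> = (\<Sum>h\<in>S. c h * h \<omega>)"
      using combinations_slice[OF Y(1), of t] by (elim exE conjE)
    have "(\<integral>\<omega>. (X t \<omega> - (\<Sum>g\<in>S. c g * g \<omega>))\<^sup>2 \<partial>M) < e" using Y(2) S(3) by simp
    with S(1,2) show ?thesis by (intro exI conjI)
  qed
qed

lemma closed_span_orthogonal:
  assumes G: "\<And>g. g \<in> G \<Longrightarrow> square_int M g" and X: "X \<in> closed_span M G" and Z: "square_int M Z"
    and orth: "\<And>g. g \<in> G \<Longrightarrow> (\<integral>\<omega>. Z \<omega> * g \<omega> \<partial>M) = 0"
  shows "(\<integral>\<omega>. Z \<omega> * X \<omega> \<partial>M) = 0"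
proof -
  have Xs: "square_int M X" using X by (simp add: closed_span_def)
  have ex: "\<forall>n. \<exists>S c. finite S \<and> S \<subseteq> G \<and> (\<integral>\<omega>. (X \<omega> - (\<Sum>g\<in>S. c g * g \<omega>))\<^sup>2 \<partial>M) < 1 / real (Suc n)"
    using X by (simp add: closed_span_def)
  obtain S where "\<forall>n. \<exists>c. finite (S n) \<and> S n \<subseteq> G \<and> (\<integral>\<omega>. (X \<omega> - (\<Sum>g\<in>S n. c g * g \<omega>))\<^sup>2 \<partial>M) < 1 / real (Suc n)"
    using choice[OF ex] by (elim exE)
  from choice[OF this] obtain c where "\<forall>n. finite (S n) \<and> S n \<subseteq> G \<and> (\<integral>\<omega>. (X \<omega> - (\<Sum>g\<in>S n. c n g * g \<omega>))\<^sup>2 \<partial>M) < 1 / real (Suc n)"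
    by (elim exE)
  then have S: "\<And>n. finite (S n)" "\<And>n. S n \<subseteq> G"
      "\<And>n. (\<integral>\<omega>. (X \<omega> - (\<Sum>g\<in>S n. c n g * g \<omega>))\<^sup>2 \<partial>M) < 1 / real (Suc n)"
    by simp_all
  let ?Y = "\<lambda>n \<omega>. \<Sum>g\<in>S n. c n g * g \<omega>"
  have "(\<lambda>n. \<integral>\<omega>. ?Y n \<omega> * Z \<omega> \<partial>M) \<longlonglongrightarrow> (\<integral>\<omega>. X \<omega> * Z \<omega> \<partial>M)"
  proof (rule integral_mult_tendsto[OF Xs _ Z])
    show "square_int M (?Y n)" for n
      using S(2) G by (intro square_int_sum square_int_cmult) auto
    show "(\<lambda>n. \<integral>\<omega>. (X \<omega> - ?Y n \<omega>)\<^sup>2 \<partial>M) \<longlonglongrightarrow> 0"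
      using S(3) by (intro tendsto_zero_below[OF _ _ LIMSEQ_inverse_real_of_nat])
        (auto simp: inverse_eq_divide less_imp_le)
  qed
  moreover have "(\<integral>\<omega>. ?Y n \<omega> * Z \<omega> \<partial>M) = 0" for n
  proof -
    have "(\<integral>\<omega>. ?Y n \<omega> * Z \<omega> \<partial>M) = (\<integral>\<omega>. (\<Sum>g\<in>S n. c n g * (Z \<omega> * g \<omega>)) \<partial>M)"
      by (intro Bochner_Integration.integral_cong refl) (simp add: sum_distrib_right sum_distrib_left mult_ac)
    also have "\<dots> = (\<Sum>g\<in>S n. (\<integral>\<omega>. c n g * (Z \<omega> * g \<omega>) \<partial>M))"
      using S(2) G Z by (intro Bochner_Integration.integral_sum) (auto intro!: square_int_mult_integrable)
    also have "\<dots> = 0" using S(2) orth by (intro sum.neutral) auto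
    finally show ?thesis .
  qed
  ultimately show ?thesis by (simp add: LIMSEQ_const_iff mult.commute)
qed

text \<open>
  The chosen version of the projection is unspecified, but any candidate with the defining
  property coincides with it almost surely. The candidate also shows that the choice is not vacuous.
\<close>

lemma orth_proj_AE_eq:
  assumes X: "square_int M X" and V: "\<And>Z. Z \<in> V \<Longrightarrow> square_int M Z"
    and P: "P \<in> V" "\<And>Z. Z \<in> V \<Longrightarrow> (\<integral>\<omega>. (X \<omega> - P \<omega>) * Z \<omega> \<partial>M) = 0"
  shows "AE \<omega> in M. orth_proj M V X \<omega> = P \<omega>"
proof -
  let ?Q = "orth_proj M V X"
  have Q: "?Q \<in> V \<and> (\<forall>Z\<in>V. (\<integral>\<omega>. (X \<omega> - ?Q \<omega>) * Z \<omega> \<partial>M) = 0)"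
    unfolding orth_proj_def
    by (rule someI_ex[where P="\<lambda>P. P \<in> V \<and> (\<forall>Z\<in>V. (\<integral>\<omega>. (X \<omega> - P \<omega>) * Z \<omega> \<partial>M) = 0)"]) (use P in blast)
  then have Qs: "square_int M ?Q" and Ps: "square_int M P" using V P by auto
  have eq: "(\<integral>\<omega>. ?Q \<omega> * Z \<omega> \<partial>M) = (\<integral>\<omega>. P \<omega> * Z \<omega> \<partial>M)" if Z: "Z \<in> V" for Z
  proof -
    have "(\<integral>\<omega>. (X \<omega> - ?Q \<omega>) * Z \<omega> \<partial>M) = 0" "(\<integral>\<omega>. (X \<omega> - P \<omega>) * Z \<omega> \<partial>M) = 0"
      using Q P(2) Z by blast+
    then show ?thesis
      by (simp add: left_diff_distrib square_int_mult_integrable V[OF Z] X Qs Ps)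
  qed
  have PV: "P \<in> V" and QV: "?Q \<in> V" using P(1) Q by blast+
  have "(\<integral>\<omega>. (?Q \<omega> - P \<omega>) * (?Q \<omega> - P \<omega>) \<partial>M)
      = (\<integral>\<omega>. (?Q \<omega> * ?Q \<omega> - P \<omega> * ?Q \<omega>) - (?Q \<omega> * P \<omega> - P \<omega> * P \<omega>) \<partial>M)"
    by (intro Bochner_Integration.integral_cong refl) (simp add: left_diff_distrib right_diff_distrib)
  also have "\<dots> = ((\<integral>\<omega>. ?Q \<omega> * ?Q \<omega> \<partial>M) - (\<integral>\<omega>. P \<omega> * ?Q \<omega> \<partial>M))
      - ((\<integral>\<omega>. ?Q \<omega> * P \<omega> \<partial>M) - (\<integral>\<omega>. P \<omega> * P \<omega> \<partial>M))"
    by (simp add: square_int_mult_integrable Qs Ps mult.commute)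
  also have "\<dots> = 0" unfolding eq[OF PV] eq[OF QV] by simp
  finally have "(\<integral>\<omega>. (?Q \<omega> - P \<omega>) * (?Q \<omega> - P \<omega>) \<partial>M) = 0" .
  then have "AE \<omega> in M. ?Q \<omega> - P \<omega> = 0"
    by (rule square_integral_zero_AE[OF square_int_diff[OF Qs Ps]])
  then show ?thesis by eventually_elim simp
qed

section \<open>Generated sigma-algebras\<close>

lemma space_sigma_gen: "space (sigma_gen M X I) = space M"
  unfolding sigma_gen_def by (rule space_measure_of) auto

lemma sets_sigma_gen:
  "sets (sigma_gen M X I) = sigma_sets (space M) (\<Union>i\<in>I. {X i -` B \<inter> space M | B. B \<in> sets borel})"
  unfolding sigma_gen_def by (rule sets_measure_of) auto

lemma measurable_sigma_gen:
  fixes X :: "'i \<Rightarrow> 'a \<Rightarrow> 'b::topological_space"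
  assumes "i \<in> I" shows "X i \<in> borel_measurable (sigma_gen M X I)"
proof (rule measurableI)
  fix B assume "B \<in> sets (borel :: 'b measure)"
  then show "X i -` B \<inter> space (sigma_gen M X I) \<in> sets (sigma_gen M X I)"
    using assms unfolding sets_sigma_gen space_sigma_gen by (intro sigma_sets.Basic) blast
qed simp

lemma sets_sigma_gen_subset:
  assumes "space N = space M" "\<And>i. i \<in> I \<Longrightarrow> X i \<in> borel_measurable N"
  shows "sets (sigma_gen M X I) \<subseteq> sets N"
proof -
  have "(\<Union>i\<in>I. {X i -` B \<inter> space M | B. B \<in> sets borel}) \<subseteq> sets N"
    using measurable_sets[OF assms(2)] assms(1) by auto
  then show ?thesis
    unfolding sets_sigma_gen assms(1)[symmetric] by (rule sets.sigma_sets_subset)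
qed

lemma subalgebra_sigma_gen:
  assumes "\<And>i. i \<in> I \<Longrightarrow> X i \<in> borel_measurable M"
  shows "subalgebra M (sigma_gen M X I)"
  using sets_sigma_gen_subset[OF refl assms] by (simp add: subalgebra_def space_sigma_gen)

lemma borel_measurable_vec_components:
  fixes f :: "'a \<Rightarrow> real ^ 'n"
  shows "f \<in> borel_measurable N \<longleftrightarrow> (\<forall>i. (\<lambda>x. f x $ i) \<in> borel_measurable N)"
proof -
  have "f \<in> borel_measurable N \<longleftrightarrow> (\<forall>b\<in>Basis. (\<lambda>x. f x \<bullet> b) \<in> borel_measurable N)"
    by (rule borel_measurable_euclidean_space)
  also have "\<dots> \<longleftrightarrow> (\<forall>i. (\<lambda>x. f x \<bullet> axis i 1) \<in> borel_measurable N)"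
    by (auto simp: Basis_vec_def)
  finally show ?thesis by (simp add: inner_axis)
qed

lemma nn_cond_exp_sets_cong:
  assumes "sets F = sets F'"
  shows "nn_cond_exp M F = nn_cond_exp M F'"
  unfolding nn_cond_exp_def restr_to_subalg_def subalgebra_def assms sets_eq_imp_space_eq[OF assms] ..

text \<open>
  Admissibility conditions on the past of \<open>\<mu>\<close> as a vector process, ZMWSSI on the past of its
  components. The two sigma-algebras have the same sets and hence the same conditional expectations.
\<close>

lemma real_cond_exp_sets_cong: "sets F = sets F' \<Longrightarrow> real_cond_exp M F = real_cond_exp M F'"
  unfolding real_cond_exp_def using nn_cond_exp_sets_cong[of F F' M] by simp

section \<open>Modulation by the switching process\<close>

abbreviation (input) component :: "(int \<Rightarrow> 'a \<Rightarrow> real ^ 'n) \<Rightarrow> 'n \<Rightarrow> int \<Rightarrow> 'a \<Rightarrow> real" where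
  "component r i \<equiv> \<lambda>t \<omega>. r t \<omega> $ i"

text \<open>
  The scalar form of \<open>z_proc\<close>. Stated for arbitrary scalar processes it is an operator, and
  \<open>modulate_snoc\<close> factors it into single letters.
\<close>

definition modulate ::
  "(int \<Rightarrow> 'a \<Rightarrow> real ^ 's) \<Rightarrow> ('s \<Rightarrow> real) \<Rightarrow> 's list \<Rightarrow> (int \<Rightarrow> 'a \<Rightarrow> real) \<Rightarrow> int \<Rightarrow> 'a \<Rightarrow> real" where
  "modulate \<mu> p w X t \<omega> = mu_word \<mu> w (t - 1) \<omega> * (1 / sqrt (p_word p w)) * X (t - int (length w)) \<omega>"

text \<open>
  The empty word contributes the components of \<open>r\<close> themselves, so these are exactly the processes
  whose joint stationarity ZMWSSI demands (\<open>modulated_eq_components\<close>).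
\<close>

definition modulated ::
  "(int \<Rightarrow> 'a \<Rightarrow> real ^ 's) \<Rightarrow> ('s \<Rightarrow> real) \<Rightarrow> (int \<Rightarrow> 'a \<Rightarrow> real ^ 'n) \<Rightarrow> (int \<Rightarrow> 'a \<Rightarrow> real) set" where
  "modulated \<mu> p r = {modulate \<mu> p w (component r i) | w i. True}"

lemma z_proc_component: "z_proc \<mu> p r w t \<omega> $ i = modulate \<mu> p w (component r i) t \<omega>"
  by (simp add: z_proc_def modulate_def)

lemma mu_word_snoc: "mu_word \<mu> (w @ [a]) t \<omega> = mu_word \<mu> w (t - 1) \<omega> * \<mu> t \<omega> $ a"
proof -
  have "(\<Prod>i<length w. \<mu> (t - int (length (w @ [a])) + 1 + int i) \<omega> $ ((w @ [a]) ! i))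
      = (\<Prod>i<length w. \<mu> (t - 1 - int (length w) + 1 + int i) \<omega> $ (w ! i))"
    by (intro prod.cong refl) (simp add: nth_append algebra_simps)
  then show ?thesis
    unfolding mu_word_def by simp
qed

lemma mu_word_Nil: "mu_word \<mu> [] t \<omega> = 1"
  by (simp add: mu_word_def)

lemma mu_word_single: "mu_word \<mu> [a] t \<omega> = \<mu> t \<omega> $ a"
  by (simp add: mu_word_def)

lemma modulate_Nil [simp]: "modulate \<mu> p [] X = X"
  by (simp add: fun_eq_iff modulate_def mu_word_Nil p_word_def)

lemma modulate_single:
  "modulate \<mu> p [a] X t \<omega> = 1 / sqrt (p a) * (X (t - 1) \<omega> * \<mu> (t - 1) \<omega> $ a)"
  by (simp add: modulate_def mu_word_single p_word_def)

lemma modulate_snoc: "modulate \<mu> p (w @ [a]) X = modulate \<mu> p [a] (modulate \<mu> p w X)"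
proof (intro ext)
  fix t \<omega>
  have e: "X (t - (1 + int (length w))) = X (t - 1 - int (length w))"
    by (rule arg_cong[where f = X]) simp
  show "modulate \<mu> p (w @ [a]) X t \<omega> = modulate \<mu> p [a] (modulate \<mu> p w X) t \<omega>"
    by (simp add: modulate_single modulate_def[of _ _ "w @ [a]"] modulate_def[of _ _ w] mu_word_snoc
        p_word_def real_sqrt_mult e mult_ac)
qed

lemma modulate_append: "modulate \<mu> p (v @ w) X = modulate \<mu> p w (modulate \<mu> p v X)"
proof (induction w rule: rev_induct)
  case (snoc a w)
  then show ?case by (simp add: modulate_snoc flip: append_assoc)
qed simp

lemma modulate_add_cmult:
  "modulate \<mu> p w (\<lambda>t \<omega>. X t \<omega> + c * Y t \<omega>) = (\<lambda>t \<omega>. modulate \<mu> p w X t \<omega> + c * modulate \<mu> p w Y t \<omega>)"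
  by (simp add: fun_eq_iff modulate_def algebra_simps)

lemma modulate_zero: "modulate \<mu> p w (\<lambda>t \<omega>. 0) = (\<lambda>t \<omega>. 0)"
  by (simp add: fun_eq_iff modulate_def)

lemma modulate_combinations:
  assumes "Y \<in> combinations R"
  shows "modulate \<mu> p w Y \<in> combinations (modulate \<mu> p w ` R)"
  using assms
  by induction (auto simp: modulate_zero modulate_add_cmult intro: combinations.intros)

lemma modulated_eq_components:
  fixes \<mu> :: "int \<Rightarrow> 'a \<Rightarrow> real ^ 's"
  shows "components r \<union> (\<Union>w\<in>{w. w \<noteq> []}. components (z_proc \<mu> p r w)) = modulated \<mu> p r"
proof -
  have "components (z_proc \<mu> p r w) = {modulate \<mu> p w (component r i) | i. True}" for w
    by (auto simp: components_def z_proc_component)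
  moreover have "components r = {modulate \<mu> p [] (component r i) | i. True}"
    by (auto simp: components_def)
  ultimately have "components r \<union> (\<Union>w\<in>{w. w \<noteq> []}. components (z_proc \<mu> p r w))
      = (\<Union>w\<in>insert [] {w. w \<noteq> []}. {modulate \<mu> p w (component r i) | i. True})"
    by simp
  also have "insert [] {w. w \<noteq> []} = (UNIV :: 's list set)" by auto
  finally show ?thesis unfolding modulated_def by auto
qed

lemma zmwssi_iff:
  "zmwssi M \<mu> p r \<longleftrightarrow>
     (\<forall>t. cond_independent M (sigma_gen M r {..t})
        (sigma_gen M (\<lambda>(k, a) \<omega>. \<mu> k \<omega> $ a) ({t..} \<times> UNIV))
        (sigma_gen M (\<lambda>(k, a) \<omega>. \<mu> k \<omega> $ a) ({..<t} \<times> UNIV))) \<and>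
     jointly_wss M (modulated \<mu> p r) \<and> (\<forall>X\<in>modulated \<mu> p r. \<forall>t. (\<integral>\<omega>. X t \<omega> \<partial>M) = 0)"
  unfolding zmwssi_def Let_def modulated_eq_components ..

lemma modulated_modulate:
  assumes "X \<in> modulated \<mu> p r"
  shows "modulate \<mu> p w X \<in> modulated \<mu> p r"
proof -
  obtain v i where "X = modulate \<mu> p v (component r i)" using assms by (auto simp: modulated_def)
  then have "modulate \<mu> p w X = modulate \<mu> p (v @ w) (component r i)" by (simp add: modulate_append)
  then show ?thesis unfolding modulated_def by blast
qed

lemma modulated_component: "component r i \<in> modulated \<mu> p r"
proof -
  have "component r i = modulate \<mu> p [] (component r i)" by simp
  then show ?thesis unfolding modulated_def by blast
qed

section \<open>Moments of an admissible switching process\<close>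

locale switched = prob_space M
  for M :: "'a measure" +
  fixes \<mu> :: "int \<Rightarrow> 'a \<Rightarrow> real ^ 's::finite" and E :: "('s \<times> 's) set" and p :: "'s \<Rightarrow> real"
  assumes admissible: "admissible M \<mu> E p"
begin

abbreviation past :: "int \<Rightarrow> 'a measure" where
  "past t \<equiv> sigma_gen M (\<lambda>(k, a) \<omega>. \<mu> k \<omega> $ a) ({..<t} \<times> UNIV)"

abbreviation future :: "int \<Rightarrow> 'a measure" where
  "future t \<equiv> sigma_gen M (\<lambda>(k, a) \<omega>. \<mu> k \<omega> $ a) ({t..} \<times> UNIV)"

abbreviation md :: "'s list \<Rightarrow> (int \<Rightarrow> 'a \<Rightarrow> real) \<Rightarrow> int \<Rightarrow> 'a \<Rightarrow> real" where
  "md \<equiv> modulate \<mu> p"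

lemma p_pos: "0 < p a"
  using admissible by (simp add: admissible_def)

lemma square_int_mu_word:
  assumes "w \<noteq> []" shows "square_int M (mu_word \<mu> w t)"
proof -
  have "\<forall>w v. w \<noteq> [] \<and> v \<noteq> [] \<longrightarrow> jointly_wss M {mu_word \<mu> w, mu_word \<mu> v}"
    using admissible unfolding admissible_def by (elim conjE)
  with assms have "jointly_wss M {mu_word \<mu> w, mu_word \<mu> w}" by blast
  then show ?thesis by (simp add: jointly_wss_def)
qed

lemma square_int_mu: "square_int M (\<lambda>\<omega>. \<mu> t \<omega> $ a)"
  using square_int_mu_word[of "[a]" t] by (simp add: mu_word_single[abs_def])

lemma measurable_mu [measurable]: "(\<lambda>\<omega>. \<mu> t \<omega> $ a) \<in> borel_measurable M"
  using square_int_mu by (rule square_intD)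

lemma subalgebra_past: "subalgebra M (past t)" and subalgebra_future: "subalgebra M (future t)"
  by (auto intro!: subalgebra_sigma_gen)

lemma measurable_mu_past: "k < t \<Longrightarrow> (\<lambda>\<omega>. \<mu> k \<omega> $ a) \<in> borel_measurable (past t)"
  using measurable_sigma_gen[of "(k, a)" "{..<t} \<times> UNIV" "\<lambda>(k, a) \<omega>. \<mu> k \<omega> $ a" M] by simp

lemma measurable_mu_future: "t \<le> k \<Longrightarrow> (\<lambda>\<omega>. \<mu> k \<omega> $ a) \<in> borel_measurable (future t)"
  using measurable_sigma_gen[of "(k, a)" "{t..} \<times> UNIV" "\<lambda>(k, a) \<omega>. \<mu> k \<omega> $ a" M] by simp

lemma sets_past_eq: "sets (sigma_gen M \<mu> {..<t}) = sets (past t)"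
proof
  show "sets (sigma_gen M \<mu> {..<t}) \<subseteq> sets (past t)"
    by (intro sets_sigma_gen_subset) (auto simp: space_sigma_gen borel_measurable_vec_components measurable_mu_past)
  have "\<mu> k \<in> borel_measurable (sigma_gen M \<mu> {..<t})" if "k < t" for k
    using that by (intro measurable_sigma_gen) simp
  then show "sets (past t) \<subseteq> sets (sigma_gen M \<mu> {..<t})"
    by (intro sets_sigma_gen_subset) (auto simp: space_sigma_gen borel_measurable_vec_components)
qed

lemmas cond_exp_past = real_cond_exp_sets_cong[OF sets_past_eq]

lemma cond_exp_cross_letters:
  assumes "a \<noteq> b"
  shows "AE \<omega> in M. real_cond_exp M (past t) (\<lambda>\<omega>. \<mu> t \<omega> $ a * \<mu> t \<omega> $ b) \<omega> = 0"
proof -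
  have "\<forall>a b t. a \<noteq> b \<longrightarrow> (AE \<omega> in M. real_cond_exp M (sigma_gen M \<mu> {..<t}) (\<lambda>\<omega>. mu_word \<mu> [a] t \<omega> * mu_word \<mu> [b] t \<omega>) \<omega> = 0)"
    using admissible unfolding admissible_def by (elim conjE)
  with assms show ?thesis by (simp add: mu_word_single cond_exp_past)
qed

lemma letters_sum_one:
  obtains \<alpha> where "\<And>t. AE \<omega> in M. (\<Sum>a\<in>UNIV. \<alpha> a * \<mu> t \<omega> $ a) = 1"
proof -
  have "\<exists>\<alpha>. \<forall>t. AE \<omega> in M. (\<Sum>a\<in>UNIV. \<alpha> a * \<mu> t \<omega> $ a) = 1"
    using admissible unfolding admissible_def by (elim conjE)
  then show ?thesis using that by blast
qed

abbreviation letter_cond_moment :: "'s \<Rightarrow> int \<Rightarrow> 'a \<Rightarrow> real" where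
  "letter_cond_moment a t \<equiv> real_cond_exp M (past t) (\<lambda>\<omega>. (\<mu> t \<omega> $ a)\<^sup>2)"

text \<open>
  This is the admissibility condition for the word \<open>ba\<close> paired with itself, cancelled by one
  factor \<open>\<mu>\<^sub>b(t - 1)\<close>. The conditional second moment of a letter need not be constant; it becomes \<open>p\<^sub>a\<close> or 0
  only after multiplication by the preceding letter.
\<close>

lemma letter_cond_moment_step:
  "AE \<omega> in M. \<mu> (t - 1) \<omega> $ b * letter_cond_moment a t \<omega> = (if (b, a) \<in> E then p a * \<mu> (t - 1) \<omega> $ b else 0)"
proof -
  interpret H: sigma_finite_subalgebra M "past t" by (rule sigma_finite_subalg[OF subalgebra_past])
  have adm: "[b, a] \<in> adm_words E \<longleftrightarrow> (b, a) \<in> E" by (simp add: adm_words_def)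
  have word: "mu_word \<mu> [b, a] t \<omega> = \<mu> (t - 1) \<omega> $ b * \<mu> t \<omega> $ a" for \<omega>
    using mu_word_snoc[of \<mu> "[b]" a t \<omega>] by (simp add: mu_word_single)
  have "\<forall>w v a b t. w \<noteq> [] \<and> v \<noteq> [] \<longrightarrow>
        (AE \<omega> in M. real_cond_exp M (sigma_gen M \<mu> {..<t})
             (\<lambda>\<omega>. mu_word \<mu> (w @ [a]) t \<omega> * mu_word \<mu> (v @ [b]) t \<omega>) \<omega>
           = (if a = b \<and> w @ [a] \<in> adm_words E \<and> v @ [a] \<in> adm_words E
              then p a * mu_word \<mu> w (t - 1) \<omega> * mu_word \<mu> v (t - 1) \<omega> else 0))"
    using admissible unfolding admissible_def by (elim conjE)
  from this[rule_format, of "[b]" "[b]" t a a]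
  have "AE \<omega> in M. real_cond_exp M (past t) (\<lambda>\<omega>. (\<mu> (t - 1) \<omega> $ b * \<mu> t \<omega> $ a) * (\<mu> (t - 1) \<omega> $ b * \<mu> t \<omega> $ a)) \<omega>
      = (if (b, a) \<in> E then p a * \<mu> (t - 1) \<omega> $ b * \<mu> (t - 1) \<omega> $ b else 0)"
    by (cases "(b, a) \<in> E") (simp_all add: word adm mu_word_single cond_exp_past)
  moreover have "AE \<omega> in M. real_cond_exp M (past t) (\<lambda>\<omega>. (\<mu> (t - 1) \<omega> $ b)\<^sup>2 * (\<mu> t \<omega> $ a)\<^sup>2) \<omega>
      = (\<mu> (t - 1) \<omega> $ b)\<^sup>2 * letter_cond_moment a t \<omega>"
  proof (rule H.real_cond_exp_mult)
    show "(\<lambda>\<omega>. (\<mu> (t - 1) \<omega> $ b)\<^sup>2) \<in> borel_measurable (past t)"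
      by (intro borel_measurable_power measurable_mu_past) simp
    show "integrable M (\<lambda>\<omega>. (\<mu> (t - 1) \<omega> $ b)\<^sup>2 * (\<mu> t \<omega> $ a)\<^sup>2)"
      using square_intD(2)[OF square_int_mu_word[of "[b, a]" t]] by (simp add: word power_mult_distrib)
  qed simp
  ultimately show ?thesis
  proof eventually_elim
    case (elim \<omega>)
    have fn: "(\<lambda>\<omega>. (\<mu> (t - 1) \<omega> $ b * \<mu> t \<omega> $ a) * (\<mu> (t - 1) \<omega> $ b * \<mu> t \<omega> $ a))
        = (\<lambda>\<omega>. (\<mu> (t - 1) \<omega> $ b)\<^sup>2 * (\<mu> t \<omega> $ a)\<^sup>2)"
      by (simp add: fun_eq_iff power2_eq_square)
    have "(\<mu> (t - 1) \<omega> $ b)\<^sup>2 * letter_cond_moment a t \<omega>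
        = (if (b, a) \<in> E then p a * \<mu> (t - 1) \<omega> $ b * \<mu> (t - 1) \<omega> $ b else 0)"
      using elim unfolding fn by (simp only:)
    then have "\<mu> (t - 1) \<omega> $ b * (\<mu> (t - 1) \<omega> $ b * letter_cond_moment a t \<omega>)
        = \<mu> (t - 1) \<omega> $ b * (if (b, a) \<in> E then p a * \<mu> (t - 1) \<omega> $ b else 0)"
      by (cases "(b, a) \<in> E") (simp_all only: if_True if_False power2_eq_square mult_ac mult_zero_right)
    then show ?case by (cases "\<mu> (t - 1) \<omega> $ b = 0") auto
  qed
qed

text \<open>
  As \<open>\<Sum> \<alpha>\<^sub>b \<mu>\<^sub>b(t - 1) = 1\<close>, some letter is nonzero at almost every point, and the previous lemma for
  that letter forces the value \<open>p\<^sub>a\<close> or 0.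
\<close>

lemma letter_cond_moment_le: "AE \<omega> in M. letter_cond_moment a t \<omega> \<le> p a"
proof -
  obtain \<alpha> where \<alpha>: "\<And>t. AE \<omega> in M. (\<Sum>a\<in>UNIV. \<alpha> a * \<mu> t \<omega> $ a) = 1" using letters_sum_one by blast
  have "AE \<omega> in M. \<forall>b. \<mu> (t - 1) \<omega> $ b * letter_cond_moment a t \<omega> = (if (b, a) \<in> E then p a * \<mu> (t - 1) \<omega> $ b else 0)"
    using letter_cond_moment_step[of t _ a] by (simp add: AE_all_countable)
  with \<alpha>[of "t - 1"] show ?thesis
  proof eventually_elim
    case (elim \<omega>)
    have "\<exists>b. \<mu> (t - 1) \<omega> $ b \<noteq> 0"
    proof (rule ccontr)
      assume "\<not> ?thesis"
      then have "(\<Sum>a\<in>UNIV. \<alpha> a * \<mu> (t - 1) \<omega> $ a) = 0" by simp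
      with elim(1) show False by simp
    qed
    then obtain b where b: "\<mu> (t - 1) \<omega> $ b \<noteq> 0" by blast
    have eq: "\<mu> (t - 1) \<omega> $ b * letter_cond_moment a t \<omega> = (if (b, a) \<in> E then p a * \<mu> (t - 1) \<omega> $ b else 0)"
      using elim(2) by blast
    show ?case
    proof (cases "(b, a) \<in> E")
      case True with eq b show ?thesis by simp
    next
      case False with eq b p_pos[of a] show ?thesis by simp
    qed
  qed
qed

end

section \<open>Modulation of adapted processes\<close>

locale switched_process = switched M \<mu> E p
  for M :: "'a measure" and \<mu> :: "int \<Rightarrow> 'a \<Rightarrow> real ^ 's::finite" and E p +
  fixes r :: "int \<Rightarrow> 'a \<Rightarrow> real ^ 'n::finite"
  assumes r: "zmwssi M \<mu> p r"
begin

abbreviation R :: "(int \<Rightarrow> 'a \<Rightarrow> real) set" where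
  "R \<equiv> modulated \<mu> p r"

text \<open>
  Everything known at time \<open>t\<close> before \<open>\<mu>(t)\<close> is drawn. Modulated processes involve earlier letters, so
  the past of \<open>r\<close> alone would be too small.
\<close>

abbreviation history :: "int \<Rightarrow> 'a measure" where
  "history t \<equiv> join_algebra M (sigma_gen M r {..t}) (past t)"

definition adapted :: "(int \<Rightarrow> 'a \<Rightarrow> real) set" where
  "adapted = {X. \<forall>t. square_int M (X t) \<and> X t \<in> borel_measurable (history t)}"

lemma jointly_wss_R: "jointly_wss M R"
  and mean_R: "X \<in> R \<Longrightarrow> (\<integral>\<omega>. X t \<omega> \<partial>M) = 0"
  using r by (auto simp: zmwssi_iff)

lemma square_int_R: "R \<subseteq> square_int_processes M"
  using jointly_wss_R by (auto simp: jointly_wss_def square_int_processes_def)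

lemma measurable_r: "r t \<in> borel_measurable M"
  using square_int_R modulated_component[of r _ \<mu> p]
  by (auto simp: borel_measurable_vec_components square_int_processes_def dest!: subsetD intro: square_intD(1))

lemma subalgebra_r: "subalgebra M (sigma_gen M r {..t})"
  by (rule subalgebra_sigma_gen) (rule measurable_r)

lemmas subalgebra_history = subalgebra_join[OF subalgebra_r subalgebra_past]

lemma cond_independent_r: "cond_independent M (sigma_gen M r {..t}) (future t) (past t)"
  using r by (simp add: zmwssi_iff)

lemma past_history: "f \<in> borel_measurable (past t) \<Longrightarrow> f \<in> borel_measurable (history t)"
  using measurable_from_subalg[OF subalgebra_history(3)] .

lemma component_history: "k \<le> t \<Longrightarrow> (\<lambda>\<omega>. r k \<omega> $ i) \<in> borel_measurable (history t)"
  using measurable_from_subalg[OF subalgebra_history(2), of "\<lambda>\<omega>. r k \<omega> $ i" t borel]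
    measurable_sigma_gen[of k "{..t}" r M]
  by (simp add: borel_measurable_vec_components)

lemma history_mono:
  assumes "s \<le> t" "f \<in> borel_measurable (history s)"
  shows "f \<in> borel_measurable (history t)"
proof -
  have sp: "space (history t) = space M" for t
    using subalgebra_history(1) by (simp add: subalgebra_def)
  have "sets (sigma_gen M r {..s}) \<subseteq> sets (history t)"
    using assms(1) component_history[of _ t]
    by (intro sets_sigma_gen_subset sp) (auto simp: borel_measurable_vec_components)
  moreover have "sets (past s) \<subseteq> sets (history t)"
    using assms(1) by (intro sets_sigma_gen_subset sp) (auto intro!: past_history measurable_mu_past)
  ultimately have "sets (history s) \<subseteq> sets (history t)"
    unfolding join_algebra_def[of M "sigma_gen M r {..s}"]
    using subalgebra_r[of s] subalgebra_past[of s] sets.space_closed[of M]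
      sets.sigma_sets_subset[of "sets (sigma_gen M r {..s}) \<union> sets (past s)" "history t"]
    by (subst sets_measure_of) (auto simp: subalgebra_def sp)
  then have "subalgebra (history t) (history s)" by (simp add: subalgebra_def sp)
  then show ?thesis using assms(2) by (rule measurable_from_subalg)
qed

lemma adaptedD:
  assumes "X \<in> adapted"
  shows "square_int M (X t)" "X t \<in> borel_measurable (history t)" "X t \<in> borel_measurable M"
  using assms square_intD(1)[of M "X t"] by (auto simp: adapted_def)

lemma adapted_square_int: "S \<subseteq> adapted \<Longrightarrow> S \<subseteq> square_int_processes M"
  by (auto simp: adapted_def square_int_processes_def)

lemma cond_exp_history_nn:
  assumes "f \<in> borel_measurable (future t)"
  shows "AE \<omega> in M. nn_cond_exp M (history t) f \<omega> = nn_cond_exp M (past t) f \<omega>"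
  using assms by (rule cond_independent_nn_cond_exp[OF subalgebra_r subalgebra_future subalgebra_past cond_independent_r])

text \<open>
  Given the history, present and future letters are predicted by the past of \<open>\<mu>\<close> alone.
\<close>

lemma integral_times_future:
  assumes X: "X \<in> borel_measurable (history t)" and f: "f \<in> borel_measurable (future t)"
    and int: "integrable M (\<lambda>\<omega>. X \<omega> * f \<omega>)"
  shows "(\<integral>\<omega>. X \<omega> * f \<omega> \<partial>M) = (\<integral>\<omega>. X \<omega> * real_cond_exp M (past t) f \<omega> \<partial>M)"
proof -
  interpret J: sigma_finite_subalgebra M "history t" by (rule sigma_finite_subalg[OF subalgebra_history(1)])
  have [measurable]: "f \<in> borel_measurable M" by (rule measurable_from_subalg[OF subalgebra_future f])
  have [measurable]: "X \<in> borel_measurable M" by (rule measurable_from_subalg[OF subalgebra_history(1) X])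
  have "(\<integral>\<omega>. X \<omega> * f \<omega> \<partial>M) = (\<integral>\<omega>. X \<omega> * real_cond_exp M (history t) f \<omega> \<partial>M)"
    using int X by (intro J.real_cond_exp_intg(2)[symmetric]) auto
  also have "AE \<omega> in M. real_cond_exp M (history t) f \<omega> = real_cond_exp M (past t) f \<omega>"
    by (rule cond_independent_real_cond_exp[OF subalgebra_r subalgebra_future subalgebra_past cond_independent_r f])
  then have "(\<integral>\<omega>. X \<omega> * real_cond_exp M (history t) f \<omega> \<partial>M) = (\<integral>\<omega>. X \<omega> * real_cond_exp M (past t) f \<omega> \<partial>M)"
    by (intro integral_cong_AE) auto
  finally show ?thesis .
qed

text \<open>
  \<open>E[X\<^sup>2 \<mu>\<^sub>a\<^sup>2] = E[X\<^sup>2 E[\<mu>\<^sub>a\<^sup>2 | past]] \<le> p\<^sub>a E[X\<^sup>2]\<close>. The computation takes place among nonnegative integrals,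
  as the finiteness of the left-hand side is part of the claim.
\<close>

lemma letter_times_adapted:
  assumes X: "X \<in> adapted"
  shows "square_int M (\<lambda>\<omega>. X t \<omega> * \<mu> t \<omega> $ a)"
    and "(\<integral>\<omega>. (X t \<omega> * \<mu> t \<omega> $ a)\<^sup>2 \<partial>M) \<le> p a * (\<integral>\<omega>. (X t \<omega>)\<^sup>2 \<partial>M)"
proof -
  interpret J: sigma_finite_subalgebra M "history t" by (rule sigma_finite_subalg[OF subalgebra_history(1)])
  note [measurable] = adaptedD(3)[OF X]
  let ?f = "\<lambda>\<omega>. ennreal ((\<mu> t \<omega> $ a)\<^sup>2)"
  have fut: "?f \<in> borel_measurable (future t)"
    using measurable_mu_future[of t t a] by measurable
  have his: "(\<lambda>\<omega>. ennreal ((X t \<omega>)\<^sup>2)) \<in> borel_measurable (history t)"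
    using adaptedD(2)[OF X, of t] by measurable
  have "AE \<omega> in M. nn_cond_exp M (past t) ?f \<omega> = ennreal (letter_cond_moment a t \<omega>)"
    by (intro nn_cond_exp_eq_ennreal_real_cond_exp subalgebra_past square_intD(2) square_int_mu) simp
  then have le: "AE \<omega> in M. nn_cond_exp M (history t) ?f \<omega> \<le> ennreal (p a)"
    using letter_cond_moment_le[of t a] cond_exp_history_nn[OF fut]
    by eventually_elim (simp add: ennreal_leI)
  have "(\<integral>\<^sup>+\<omega>. ennreal ((X t \<omega> * \<mu> t \<omega> $ a)\<^sup>2) \<partial>M) = (\<integral>\<^sup>+\<omega>. ennreal ((X t \<omega>)\<^sup>2) * ?f \<omega> \<partial>M)"
    by (simp add: power_mult_distrib ennreal_mult)
  also have "\<dots> = (\<integral>\<^sup>+\<omega>. ennreal ((X t \<omega>)\<^sup>2) * nn_cond_exp M (history t) ?f \<omega> \<partial>M)"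
    using his by (intro J.nn_cond_exp_intg[symmetric]) auto
  also have "\<dots> \<le> (\<integral>\<^sup>+\<omega>. ennreal (p a) * ennreal ((X t \<omega>)\<^sup>2) \<partial>M)"
  proof (intro nn_integral_mono_AE)
    show "AE \<omega> in M. ennreal ((X t \<omega>)\<^sup>2) * nn_cond_exp M (history t) ?f \<omega> \<le> ennreal (p a) * ennreal ((X t \<omega>)\<^sup>2)"
      using le
    proof eventually_elim
      case (elim \<omega>)
      then have "ennreal ((X t \<omega>)\<^sup>2) * nn_cond_exp M (history t) ?f \<omega> \<le> ennreal ((X t \<omega>)\<^sup>2) * ennreal (p a)"
        by (rule mult_left_mono) simp
      then show ?case by (simp only: mult.commute)
    qed
  qed
  also have "\<dots> = ennreal (p a) * (\<integral>\<^sup>+\<omega>. ennreal ((X t \<omega>)\<^sup>2) \<partial>M)"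
    by (rule nn_integral_cmult) simp
  also have "(\<integral>\<^sup>+\<omega>. ennreal ((X t \<omega>)\<^sup>2) \<partial>M) = ennreal (\<integral>\<omega>. (X t \<omega>)\<^sup>2 \<partial>M)"
    by (intro nn_integral_eq_integral square_intD(2) adaptedD(1)[OF X]) simp
  also have "ennreal (p a) * \<dots> = ennreal (p a * (\<integral>\<omega>. (X t \<omega>)\<^sup>2 \<partial>M))"
    using p_pos[of a] by (simp add: ennreal_mult)
  finally have bound: "(\<integral>\<^sup>+\<omega>. ennreal ((X t \<omega> * \<mu> t \<omega> $ a)\<^sup>2) \<partial>M) \<le> ennreal (p a * (\<integral>\<omega>. (X t \<omega>)\<^sup>2 \<partial>M))" .
  show sq: "square_int M (\<lambda>\<omega>. X t \<omega> * \<mu> t \<omega> $ a)"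
    unfolding square_int_def
  proof (rule conjI)
    show "(\<lambda>\<omega>. X t \<omega> * \<mu> t \<omega> $ a) \<in> borel_measurable M" by measurable
    show "integrable M (\<lambda>\<omega>. (X t \<omega> * \<mu> t \<omega> $ a)\<^sup>2)"
    proof (rule integrableI_bounded)
      show "(\<lambda>\<omega>. (X t \<omega> * \<mu> t \<omega> $ a)\<^sup>2) \<in> borel_measurable M" by measurable
      have "(\<integral>\<^sup>+\<omega>. ennreal (norm ((X t \<omega> * \<mu> t \<omega> $ a)\<^sup>2)) \<partial>M) = (\<integral>\<^sup>+\<omega>. ennreal ((X t \<omega> * \<mu> t \<omega> $ a)\<^sup>2) \<partial>M)"
        by simp
      also note bound
      also have "ennreal (p a * (\<integral>\<omega>. (X t \<omega>)\<^sup>2 \<partial>M)) < \<infinity>" by simp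
      finally show "(\<integral>\<^sup>+\<omega>. ennreal (norm ((X t \<omega> * \<mu> t \<omega> $ a)\<^sup>2)) \<partial>M) < \<infinity>" .
    qed
  qed
  have "ennreal (\<integral>\<omega>. (X t \<omega> * \<mu> t \<omega> $ a)\<^sup>2 \<partial>M) = (\<integral>\<^sup>+\<omega>. ennreal ((X t \<omega> * \<mu> t \<omega> $ a)\<^sup>2) \<partial>M)"
    by (intro nn_integral_eq_integral[symmetric] square_intD(2)[OF sq]) simp
  with bound have "ennreal (\<integral>\<omega>. (X t \<omega> * \<mu> t \<omega> $ a)\<^sup>2 \<partial>M) \<le> ennreal (p a * (\<integral>\<omega>. (X t \<omega>)\<^sup>2 \<partial>M))"
    by (simp only:)
  moreover have "0 \<le> p a * (\<integral>\<omega>. (X t \<omega>)\<^sup>2 \<partial>M)" using p_pos[of a] by simp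
  ultimately show "(\<integral>\<omega>. (X t \<omega> * \<mu> t \<omega> $ a)\<^sup>2 \<partial>M) \<le> p a * (\<integral>\<omega>. (X t \<omega>)\<^sup>2 \<partial>M)"
    by (subst (asm) ennreal_le_iff)
qed

lemma adapted_md_single:
  assumes X: "X \<in> adapted" shows "md [a] X \<in> adapted"
  unfolding adapted_def
proof (intro CollectI allI conjI)
  fix t
  show "square_int M (md [a] X t)"
    using square_int_cmult[OF letter_times_adapted(1)[OF X, of "t - 1" a], of "1 / sqrt (p a)"]
    by (simp add: modulate_single[abs_def])
  have "X (t - 1) \<in> borel_measurable (history t)"
    using history_mono[OF _ adaptedD(2)[OF X], of "t - 1" t] by simp
  moreover have "(\<lambda>\<omega>. \<mu> (t - 1) \<omega> $ a) \<in> borel_measurable (history t)"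
    by (intro past_history measurable_mu_past) simp
  ultimately show "md [a] X t \<in> borel_measurable (history t)"
    unfolding modulate_single[abs_def] by measurable
qed

lemma adapted_md:
  assumes X: "X \<in> adapted" shows "md w X \<in> adapted"
  by (induction w rule: rev_induct) (auto simp: X modulate_snoc intro: adapted_md_single)

lemma adapted_component: "component r i \<in> adapted"
proof -
  have "component r i \<in> square_int_processes M"
    using square_int_R modulated_component by (rule subsetD)
  then show ?thesis by (auto simp: adapted_def square_int_processes_def component_history)
qed

lemma R_adapted: "R \<subseteq> adapted"
  by (auto simp: modulated_def intro: adapted_md adapted_component)

lemma adapted_add_cmult:
  assumes "X \<in> adapted" "Y \<in> adapted"
  shows "(\<lambda>t \<omega>. X t \<omega> + c * Y t \<omega>) \<in> adapted"
  unfolding adapted_def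
proof (intro CollectI allI conjI)
  fix t
  show "square_int M (\<lambda>\<omega>. X t \<omega> + c * Y t \<omega>)"
    by (intro square_int_add square_int_cmult adaptedD assms)
  show "(\<lambda>\<omega>. X t \<omega> + c * Y t \<omega>) \<in> borel_measurable (history t)"
    by (intro borel_measurable_add borel_measurable_times borel_measurable_const adaptedD assms)
qed

lemma adapted_diff:
  "X \<in> adapted \<Longrightarrow> Y \<in> adapted \<Longrightarrow> (\<lambda>t \<omega>. X t \<omega> - Y t \<omega>) \<in> adapted"
  using adapted_add_cmult[of X Y "-1"] by simp

lemma adapted_combinations:
  assumes "Y \<in> combinations S" "S \<subseteq> adapted"
  shows "Y \<in> adapted"
  using assms
proof induction
  case zero show ?case by (simp add: adapted_def square_int_zero)
next
  case (step Y g c)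
  then show ?case by (intro adapted_add_cmult) auto
qed

lemma md_single_contraction:
  assumes X: "X \<in> adapted"
  shows "(\<integral>\<omega>. (md [a] X t \<omega>)\<^sup>2 \<partial>M) \<le> (\<integral>\<omega>. (X (t - 1) \<omega>)\<^sup>2 \<partial>M)"
proof -
  have "(\<integral>\<omega>. (md [a] X t \<omega>)\<^sup>2 \<partial>M) = 1 / p a * (\<integral>\<omega>. (X (t - 1) \<omega> * \<mu> (t - 1) \<omega> $ a)\<^sup>2 \<partial>M)"
    using p_pos[of a] by (simp add: modulate_single power_mult_distrib power_divide)
  also have "\<dots> \<le> 1 / p a * (p a * (\<integral>\<omega>. (X (t - 1) \<omega>)\<^sup>2 \<partial>M))"
    using p_pos[of a] letter_times_adapted(2)[OF X, of "t - 1" a] by (intro mult_left_mono) auto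
  also have "\<dots> = (\<integral>\<omega>. (X (t - 1) \<omega>)\<^sup>2 \<partial>M)" using p_pos[of a] by simp
  finally show ?thesis .
qed

text \<open>
  A contraction carries approximating combinations to approximating combinations.
\<close>

lemma process_span_md_single:
  assumes X: "X \<in> adapted" "X \<in> process_span M S" and S: "S \<subseteq> adapted"
  shows "md [a] X \<in> process_span M (md [a] ` S)"
  unfolding process_span_def
proof (intro CollectI conjI allI impI)
  fix t show "square_int M (md [a] X t)" using adapted_md_single[OF X(1)] by (rule adaptedD)
next
  fix e :: real assume "e > 0"
  then obtain Y where Y: "Y \<in> combinations S" "\<And>t. (\<integral>\<omega>. (X t \<omega> - Y t \<omega>)\<^sup>2 \<partial>M) < e"
    using X(2) unfolding process_span_def by blast
  have D: "(\<lambda>t \<omega>. X t \<omega> - Y t \<omega>) \<in> adapted"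
    using X(1) adapted_combinations[OF Y(1) S] by (rule adapted_diff)
  have eq: "md [a] X t \<omega> - md [a] Y t \<omega> = md [a] (\<lambda>t \<omega>. X t \<omega> - Y t \<omega>) t \<omega>" for t \<omega>
    by (simp add: modulate_single algebra_simps)
  have "(\<integral>\<omega>. (md [a] X t \<omega> - md [a] Y t \<omega>)\<^sup>2 \<partial>M) < e" for t
    unfolding eq using md_single_contraction[OF D, of a t] Y(2)[of "t - 1"] by simp
  then show "\<exists>Y\<in>combinations (md [a] ` S). \<forall>t. (\<integral>\<omega>. (md [a] X t \<omega> - Y t \<omega>)\<^sup>2 \<partial>M) < e"
    by (intro bexI[OF _ modulate_combinations[OF Y(1)]] allI)
qed

lemma process_span_md:
  assumes X: "X \<in> adapted" "X \<in> process_span M S" and S: "S \<subseteq> adapted"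
  shows "md w X \<in> process_span M (md w ` S)"
proof (induction w rule: rev_induct)
  case Nil
  have "md [] ` S = S" by (auto simp: image_iff)
  then show ?case using X by simp
next
  case (snoc a w)
  have "md w ` S \<subseteq> adapted" using S adapted_md by auto
  then have "md [a] (md w X) \<in> process_span M (md [a] ` md w ` S)"
    by (intro process_span_md_single adapted_md X(1) snoc.IH)
  then show ?case by (simp add: modulate_snoc image_image)
qed

lemma md_cross_letters:
  assumes X: "X \<in> adapted" and Y: "Y \<in> adapted" and "a \<noteq> b"
  shows "(\<integral>\<omega>. md [a] X t \<omega> * md [b] Y t \<omega> \<partial>M) = 0"
proof -
  let ?k = "t - 1"
  let ?f = "\<lambda>\<omega>. \<mu> ?k \<omega> $ a * \<mu> ?k \<omega> $ b"
  have i: "integrable M (\<lambda>\<omega>. (X ?k \<omega> * Y ?k \<omega>) * ?f \<omega>)"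
    using square_int_mult_integrable[OF letter_times_adapted(1)[OF X] letter_times_adapted(1)[OF Y], of ?k a ?k b]
    by (simp add: mult_ac)
  have "(\<integral>\<omega>. (X ?k \<omega> * Y ?k \<omega>) * ?f \<omega> \<partial>M) = (\<integral>\<omega>. (X ?k \<omega> * Y ?k \<omega>) * real_cond_exp M (past ?k) ?f \<omega> \<partial>M)"
    using adaptedD(2)[OF X] adaptedD(2)[OF Y] i
    by (intro integral_times_future borel_measurable_times measurable_mu_future) auto
  also have "\<dots> = (\<integral>\<omega>. 0 \<partial>M)"
  proof (rule integral_cong_AE)
    show "AE \<omega> in M. (X ?k \<omega> * Y ?k \<omega>) * real_cond_exp M (past ?k) ?f \<omega> = 0"
      using cond_exp_cross_letters[OF \<open>a \<noteq> b\<close>, of ?k] by eventually_elim simp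
  qed (use adaptedD(3)[OF X] adaptedD(3)[OF Y] in auto)
  finally have 0: "(\<integral>\<omega>. (X ?k \<omega> * Y ?k \<omega>) * ?f \<omega> \<partial>M) = 0" by simp
  have "(\<integral>\<omega>. md [a] X t \<omega> * md [b] Y t \<omega> \<partial>M)
      = (\<integral>\<omega>. (1 / sqrt (p a) * (1 / sqrt (p b))) * ((X ?k \<omega> * Y ?k \<omega>) * ?f \<omega>) \<partial>M)"
    unfolding modulate_single by (intro Bochner_Integration.integral_cong refl) (simp only: mult_ac)
  also have "\<dots> = (1 / sqrt (p a) * (1 / sqrt (p b))) * (\<integral>\<omega>. (X ?k \<omega> * Y ?k \<omega>) * ?f \<omega> \<partial>M)"
    by (rule integral_mult_right_zero)
  finally show ?thesis unfolding 0 by simp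
qed

text \<open>
  The second factor ends in the letter \<open>b\<close>, which supplies the factor \<open>\<mu>\<^sub>b\<close> that makes the
  conditional second moment of the next letter \<open>a\<close> constant (\<open>letter_cond_moment_step\<close>).
\<close>

lemma md_same_letter:
  assumes X: "X \<in> adapted" and Y: "Y \<in> adapted"
  shows "(\<integral>\<omega>. md [a] X t \<omega> * md [a] (md [b] Y) t \<omega> \<partial>M)
    = (if (b, a) \<in> E then \<integral>\<omega>. X (t - 1) \<omega> * md [b] Y (t - 1) \<omega> \<partial>M else 0)"
proof -
  let ?k = "t - 1" and ?Z = "md [b] Y"
  have Z: "?Z \<in> adapted" using Y by (rule adapted_md)
  let ?f = "\<lambda>\<omega>. (\<mu> ?k \<omega> $ a)\<^sup>2"
  have i: "integrable M (\<lambda>\<omega>. (X ?k \<omega> * ?Z ?k \<omega>) * ?f \<omega>)"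
    using square_int_mult_integrable[OF letter_times_adapted(1)[OF X] letter_times_adapted(1)[OF Z], of ?k a ?k a]
    by (simp add: mult_ac power2_eq_square)
  have "(\<integral>\<omega>. md [a] X t \<omega> * md [a] ?Z t \<omega> \<partial>M)
      = (\<integral>\<omega>. (1 / sqrt (p a) * (1 / sqrt (p a))) * ((X ?k \<omega> * ?Z ?k \<omega>) * ?f \<omega>) \<partial>M)"
    unfolding modulate_single[of _ _ a] power2_eq_square
    by (intro Bochner_Integration.integral_cong refl) (simp only: mult_ac)
  also have "\<dots> = (1 / sqrt (p a) * (1 / sqrt (p a))) * (\<integral>\<omega>. (X ?k \<omega> * ?Z ?k \<omega>) * ?f \<omega> \<partial>M)"
    by (rule integral_mult_right_zero)
  also have "1 / sqrt (p a) * (1 / sqrt (p a)) = 1 / p a"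
    using p_pos[of a] by (simp add: real_sqrt_mult_self flip: real_sqrt_mult)
  also have "(\<integral>\<omega>. (X ?k \<omega> * ?Z ?k \<omega>) * ?f \<omega> \<partial>M) = (\<integral>\<omega>. (X ?k \<omega> * ?Z ?k \<omega>) * letter_cond_moment a ?k \<omega> \<partial>M)"
    using adaptedD(2)[OF X] adaptedD(2)[OF Z] i
    by (intro integral_times_future borel_measurable_times borel_measurable_power measurable_mu_future) auto
  also have "\<dots> = (\<integral>\<omega>. (if (b, a) \<in> E then p a else 0) * (X ?k \<omega> * ?Z ?k \<omega>) \<partial>M)"
  proof (rule integral_cong_AE)
    show "AE \<omega> in M. (X ?k \<omega> * ?Z ?k \<omega>) * letter_cond_moment a ?k \<omega> = (if (b, a) \<in> E then p a else 0) * (X ?k \<omega> * ?Z ?k \<omega>)"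
      using letter_cond_moment_step[of ?k b a]
    proof eventually_elim
      case (elim \<omega>)
      have "(X ?k \<omega> * ?Z ?k \<omega>) * letter_cond_moment a ?k \<omega>
          = (X ?k \<omega> * (1 / sqrt (p b)) * Y (?k - 1) \<omega>) * (\<mu> (?k - 1) \<omega> $ b * letter_cond_moment a ?k \<omega>)"
        unfolding modulate_single by (simp only: mult_ac)
      also have "\<dots> = (X ?k \<omega> * (1 / sqrt (p b)) * Y (?k - 1) \<omega>) * (if (b, a) \<in> E then p a * \<mu> (?k - 1) \<omega> $ b else 0)"
        unfolding elim ..
      also have "\<dots> = (if (b, a) \<in> E then p a else 0) * (X ?k \<omega> * ?Z ?k \<omega>)"
        unfolding modulate_single by (simp add: mult_ac)
      finally show ?case .
    qed
  qed (use adaptedD(3)[OF X] adaptedD(3)[OF Z] in auto)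
  also have "\<dots> = (if (b, a) \<in> E then p a else 0) * (\<integral>\<omega>. X ?k \<omega> * ?Z ?k \<omega> \<partial>M)"
    by (rule integral_mult_right_zero)
  finally show ?thesis using p_pos[of a] by simp
qed

text \<open>
  Expand \<open>X Y = X Y (\<Sum> \<alpha>\<^sub>a \<mu>\<^sub>a)\<^sup>2\<close>. Mixed terms vanish by \<open>md_cross_letters\<close>, and the diagonal ones are
  multiples of the given moments.
\<close>

lemma orthogonal_if_md_orthogonal:
  assumes X: "X \<in> adapted" and Y: "Y \<in> adapted"
    and orth: "\<And>a. (\<integral>\<omega>. md [a] X (t + 1) \<omega> * md [a] Y (t + 1) \<omega> \<partial>M) = 0"
  shows "(\<integral>\<omega>. X t \<omega> * Y t \<omega> \<partial>M) = 0"
proof -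
  obtain \<alpha> where \<alpha>: "\<And>t. AE \<omega> in M. (\<Sum>a\<in>UNIV. \<alpha> a * \<mu> t \<omega> $ a) = 1" using letters_sum_one by blast
  note [measurable] = adaptedD(3)[OF X] adaptedD(3)[OF Y]
  let ?c = "\<lambda>a. \<alpha> a * sqrt (p a)"
  let ?X = "\<lambda>a. md [a] X (t + 1)" and ?Y = "\<lambda>a. md [a] Y (t + 1)"
  have X': "square_int M (?X a)" and Y': "square_int M (?Y a)" for a
    using adaptedD(1)[OF adapted_md] X Y by auto
  note [measurable] = square_intD(1)[OF X'] square_intD(1)[OF Y']
  have resolve: "AE \<omega> in M. V t \<omega> = (\<Sum>a\<in>UNIV. ?c a * md [a] V (t + 1) \<omega>)" for V
    using \<alpha>[of t]
  proof eventually_elim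
    case (elim \<omega>)
    have "(\<Sum>a\<in>UNIV. ?c a * md [a] V (t + 1) \<omega>) = (\<Sum>a\<in>UNIV. V t \<omega> * (\<alpha> a * \<mu> t \<omega> $ a))"
      by (intro sum.cong refl) (use p_pos in \<open>simp add: modulate_single less_imp_neq[symmetric]\<close>)
    also have "\<dots> = V t \<omega>" unfolding sum_distrib_left[symmetric] elim by simp
    finally show ?case by simp
  qed
  have "(\<integral>\<omega>. X t \<omega> * Y t \<omega> \<partial>M) = (\<integral>\<omega>. (\<Sum>a\<in>UNIV. \<Sum>b\<in>UNIV. (?c a * ?c b) * (?X a \<omega> * ?Y b \<omega>)) \<partial>M)"
  proof (rule integral_cong_AE)
    show "AE \<omega> in M. X t \<omega> * Y t \<omega> = (\<Sum>a\<in>UNIV. \<Sum>b\<in>UNIV. (?c a * ?c b) * (?X a \<omega> * ?Y b \<omega>))"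
      using resolve[of X] resolve[of Y]
    proof eventually_elim
      case (elim \<omega>)
      have "X t \<omega> * Y t \<omega> = (\<Sum>a\<in>UNIV. ?c a * ?X a \<omega>) * (\<Sum>b\<in>UNIV. ?c b * ?Y b \<omega>)"
        using elim by simp
      also have "\<dots> = (\<Sum>a\<in>UNIV. \<Sum>b\<in>UNIV. (?c a * ?X a \<omega>) * (?c b * ?Y b \<omega>))" by (rule sum_product)
      finally show ?case by (simp only: mult_ac)
    qed
  qed simp_all
  also have "\<dots> = (\<Sum>a\<in>UNIV. \<Sum>b\<in>UNIV. (?c a * ?c b) * (\<integral>\<omega>. ?X a \<omega> * ?Y b \<omega> \<partial>M))"
    by (simp add: square_int_mult_integrable X' Y')
  also have "\<dots> = 0"
  proof (intro sum.neutral ballI)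
    fix a b
    show "(?c a * ?c b) * (\<integral>\<omega>. ?X a \<omega> * ?Y b \<omega> \<partial>M) = 0"
      using orth[of a] md_cross_letters[OF X Y, of a b "t + 1"] by (cases "a = b") auto
  qed
  finally show ?thesis .
qed

text \<open>
  All that ZMWSSI asks of \<open>q\<close> is inherited from \<open>r\<close>: modulation keeps the components inside the span
  of the modulated components of \<open>r\<close>, where stationarity and zero means persist, and the history
  of \<open>q\<close> is contained in that of \<open>r\<close>.
\<close>

theorem zmwssi_from_components:
  fixes q :: "int \<Rightarrow> 'a \<Rightarrow> real ^ 'm::finite"
  assumes q: "\<And>i. component q i \<in> process_span M R" "\<And>i. component q i \<in> adapted"
  shows "zmwssi M \<mu> p q"
  unfolding zmwssi_iff
proof (intro conjI allI ballI)
  have Q: "modulated \<mu> p q \<subseteq> process_span M R"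
  proof
    fix X assume "X \<in> modulated \<mu> p q"
    then obtain w i where X: "X = md w (component q i)" by (auto simp: modulated_def)
    have "md w ` R \<subseteq> R" using modulated_modulate[of _ \<mu> p r] by auto
    then show "X \<in> process_span M R"
      unfolding X using process_span_md[OF q(2) q(1) R_adapted, of w] process_span_mono by blast
  qed
  note wss = process_span_jointly_wss[OF jointly_wss_R _ prob_space_axioms Q]
  show "jointly_wss M (modulated \<mu> p q)" by (rule wss(1)) (rule mean_R)
  show "(\<integral>\<omega>. X t \<omega> \<partial>M) = 0" if "X \<in> modulated \<mu> p q" for X t by (rule wss(2), erule mean_R, rule that)
  fix t
  have sp: "space (history t) = space M"
    using subalgebra_history(1) by (simp add: subalgebra_def)
  have "q k \<in> borel_measurable (history t)" if "k \<le> t" for k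
    unfolding borel_measurable_vec_components using history_mono[OF that adaptedD(2)[OF q(2)]] by blast
  then have "sets (sigma_gen M q {..t}) \<subseteq> sets (history t)"
    by (intro sets_sigma_gen_subset sp) simp
  then show "cond_independent M (sigma_gen M q {..t}) (future t) (past t)"
    using cond_independent_join[OF subalgebra_r subalgebra_future subalgebra_past cond_independent_r]
    by (rule cond_independent_mono[rotated])
qed

end

section \<open>Splitting the state of a stationary realization\<close>

lemma jointly_wss_subset: "jointly_wss M R \<Longrightarrow> S \<subseteq> R \<Longrightarrow> jointly_wss M S"
  unfolding jointly_wss_def by blast

lemma cross_moment_component: "cross_moment M X Y $ i $ j = (\<integral>\<omega>. X \<omega> $ i * Y \<omega> $ j \<partial>M)"
  by (simp add: cross_moment_def)

lemma cross_moment_eq_0_iff: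
  "cross_moment M X Y = 0 \<longleftrightarrow> (\<forall>i j. (\<integral>\<omega>. X \<omega> $ i * Y \<omega> $ j \<partial>M) = 0)"
  by (simp add: vec_eq_iff cross_moment_component)

lemma stack_nth [simp]:
  "stack r q t \<omega> $ Inl i = r t \<omega> $ i" "stack r q t \<omega> $ Inr j = q t \<omega> $ j"
  by (simp_all add: stack_def)

lemma sum_UNIV_sum:
  fixes f :: "'m::finite + 'n::finite \<Rightarrow> 'c::comm_monoid_add"
  shows "(\<Sum>k\<in>UNIV. f k) = (\<Sum>i\<in>UNIV. f (Inl i)) + (\<Sum>j\<in>UNIV. f (Inr j))"
proof -
  have "(\<Sum>k\<in>UNIV. f k) = (\<Sum>k\<in>UNIV <+> UNIV. f k)" by (simp only: UNIV_Plus_UNIV)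
  also have "\<dots> = (\<Sum>i\<in>UNIV. f (Inl i)) + (\<Sum>j\<in>UNIV. f (Inr j))"
    by (subst sum.Plus) (simp_all add: o_def)
  finally show ?thesis .
qed

lemma invertible_diagonal_block:
  fixes Q :: "real ^ ('m::finite + 'n::finite) ^ ('m + 'n)" and P :: "real ^ 'm ^ 'm"
  assumes Q: "invertible Q" and diag: "\<And>i j. Q $ Inl i $ Inl j = P $ i $ j"
    and off: "\<And>i j. Q $ Inr i $ Inl j = 0"
  shows "invertible P"
proof -
  have "z = 0" if z: "P *v z = 0" for z
  proof -
    define z' :: "real ^ ('m + 'n)" where "z' = (\<chi> k. case k of Inl i \<Rightarrow> z $ i | Inr _ \<Rightarrow> 0)"
    have "(Q *v z') $ k = 0" for k
    proof (cases k)
      case (Inl i)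
      have "(P *v z) $ i = 0" using z by simp
      then show ?thesis
        by (simp add: Inl matrix_vector_mult_def sum_UNIV_sum z'_def diag)
    next
      case (Inr i)
      then show ?thesis by (simp add: matrix_vector_mult_def sum_UNIV_sum z'_def off)
    qed
    then have "Q *v z' = 0" by (simp add: vec_eq_iff)
    moreover have "\<exists>N. N ** Q = mat 1" using Q unfolding invertible_def by blast
    then have "\<forall>z. Q *v z = 0 \<longrightarrow> z = 0" by (rule matrix_left_invertible_ker[THEN iffD1])
    ultimately have "z' = 0" by simp
    then have "z' $ Inl i = 0" for i by simp
    then show "z = 0" by (simp add: z'_def vec_eq_iff)
  qed
  then have "\<exists>N. N ** P = mat 1" by (intro matrix_left_invertible_ker[THEN iffD2]) simp
  then show ?thesis by (simp add: invertible_left_inverse)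
qed

text \<open>
  The noise covariance is invertible, so the edge condition of the realization carries over to
  each of the two input matrices separately.
\<close>

lemma hcat_mult_zero:
  assumes Q: "invertible Q" and zero: "A ** hcat K B ** Q = 0"
  shows "A ** K = 0" "A ** B = 0"
proof -
  obtain N where "Q ** N = mat 1" using Q unfolding invertible_def by blast
  then have "A ** hcat K B = (A ** hcat K B ** Q) ** N"
    by (simp add: matrix_mul_assoc[symmetric])
  then have 0: "A ** hcat K B = 0" by (simp add: zero)
  have "(A ** K) $ i $ j = (A ** hcat K B) $ i $ Inl j" for i j
    by (simp add: matrix_matrix_mult_def hcat_def)
  moreover have "(A ** B) $ i $ j = (A ** hcat K B) $ i $ Inr j" for i j
    by (simp add: matrix_matrix_mult_def hcat_def)
  ultimately show "A ** K = 0" "A ** B = 0" by (simp_all add: 0 vec_eq_iff)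
qed

lemma white_noise_words:
  assumes r: "white_noise M \<mu> E p r"
  shows white_noise_distinct_words: "w \<noteq> [] \<Longrightarrow> w' \<noteq> [] \<Longrightarrow> w \<noteq> w' \<Longrightarrow>
      cross_moment M (z_proc \<mu> p r w t) (z_proc \<mu> p r w' t) = 0"
    and white_noise_same_word: "a # s \<in> adm_words E \<Longrightarrow>
      cross_moment M (z_proc \<mu> p r (a # s) t) (z_proc \<mu> p r (a # s) t)
        = cross_moment M (z_proc \<mu> p r [a] t) (z_proc \<mu> p r [a] t)"
proof -
  have "\<forall>w s a t. w \<noteq> [] \<longrightarrow>
        (w \<noteq> a # s \<longrightarrow>
           cross_moment M (z_proc \<mu> p r w t) (z_proc \<mu> p r (a # s) t) = 0) \<and>
        (w = a # s \<and> w \<in> adm_words E \<longrightarrow>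
           cross_moment M (z_proc \<mu> p r w t) (z_proc \<mu> p r (a # s) t)
             = cross_moment M (z_proc \<mu> p r [a] t) (z_proc \<mu> p r [a] t))"
    using r unfolding white_noise_def by (elim conjE)
  note clauses = this[THEN spec, THEN spec, THEN spec, THEN spec]
  show "a # s \<in> adm_words E \<Longrightarrow>
      cross_moment M (z_proc \<mu> p r (a # s) t) (z_proc \<mu> p r (a # s) t)
        = cross_moment M (z_proc \<mu> p r [a] t) (z_proc \<mu> p r [a] t)"
    using clauses[of "a # s" a s t] by simp
  show "cross_moment M (z_proc \<mu> p r w t) (z_proc \<mu> p r w' t) = 0" if "w \<noteq> []" "w' \<noteq> []" "w \<noteq> w'"
    using clauses[of w "hd w'" "tl w'" t] that by simp
qed

lemma all_components_AE:
  fixes f g :: "'a \<Rightarrow> real ^ 'n::finite"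
  assumes "\<And>i. AE \<omega> in M. f \<omega> $ i = g \<omega> $ i"
  shows "AE \<omega> in M. f \<omega> = g \<omega>"
  using assms by (simp add: vec_eq_iff AE_all_countable)

text \<open>
  The underlying ZMWSSI process stacks state, noise and input, so that all processes below live
  in one jointly stationary family.
\<close>

locale stationary_realization = switched_process M \<mu> E p "stack x (stack v u)"
  for M :: "'a measure" and \<mu> :: "int \<Rightarrow> 'a \<Rightarrow> real ^ 's::finite" and E p
    and x :: "int \<Rightarrow> 'a \<Rightarrow> real ^ 'nx::finite" and v :: "int \<Rightarrow> 'a \<Rightarrow> real ^ 'nn::finite"
    and u :: "int \<Rightarrow> 'a \<Rightarrow> real ^ 'nu::finite" +
  fixes A :: "'s \<Rightarrow> real ^ 'nx ^ 'nx" and K :: "'s \<Rightarrow> real ^ 'nn ^ 'nx" and B :: "'s \<Rightarrow> real ^ 'nu ^ 'nx"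
  assumes state: "AE \<omega> in M. x (t + 1) \<omega>
      = (\<Sum>i\<in>UNIV. \<mu> t \<omega> $ i *\<^sub>R (A i *v x t \<omega> + B i *v u t \<omega> + K i *v v t \<omega>))"
    and noise: "white_noise M \<mu> E p (stack v u)"
    and noise_input: "cross_moment M (v t) (\<lambda>\<omega>. (\<mu> t \<omega> $ a)\<^sup>2 *\<^sub>R u t \<omega>) = 0"
    and state_noise_letter: "cross_moment M (z_proc \<mu> p x [a] t) (z_proc \<mu> p (stack v u) [a] t) = 0"
    and state_noise: "w \<noteq> [] \<Longrightarrow> cross_moment M (z_proc \<mu> p x w t) (stack v u t) = 0"
begin

abbreviation X where "X \<equiv> component x"
abbreviation V where "V \<equiv> component v"
abbreviation U where "U \<equiv> component u"
abbreviation W where "W \<equiv> component (stack v u)"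

lemma components_in_R: "X k \<in> R" "V i \<in> R" "U j \<in> R" "W l \<in> R"
proof -
  show X: "X k \<in> R" for k
    using modulated_component[of "stack x (stack v u)" "Inl k" \<mu> p] by simp
  show V: "V i \<in> R" for i
    using modulated_component[of "stack x (stack v u)" "Inr (Inl i)" \<mu> p] by simp
  show U: "U j \<in> R" for j
    using modulated_component[of "stack x (stack v u)" "Inr (Inr j)" \<mu> p] by simp
  show "W l \<in> R"
    using V U by (cases l) simp_all
qed

lemmas components_adapted = components_in_R[THEN subsetD[OF R_adapted]]

lemma R_span: "R \<subseteq> process_span M R"
  using process_span_base[OF square_int_R] by blast

lemma noise_words_orthogonal:
  assumes "w \<noteq> []" "w' \<noteq> []" "w \<noteq> w'"
  shows "(\<integral>\<omega>. md w (W k) t \<omega> * md w' (W l) t \<omega> \<partial>M) = 0"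
  using white_noise_distinct_words[OF noise assms, of t]
  unfolding cross_moment_eq_0_iff z_proc_component by simp

lemma noise_input_letter: "(\<integral>\<omega>. md [a] (V i) t \<omega> * md [a] (U j) t \<omega> \<partial>M) = 0"
proof -
  have "(\<integral>\<omega>. v (t - 1) \<omega> $ i * ((\<mu> (t - 1) \<omega> $ a)\<^sup>2 * u (t - 1) \<omega> $ j) \<partial>M) = 0"
    using noise_input[of "t - 1" a] unfolding cross_moment_eq_0_iff by simp
  then have "(\<integral>\<omega>. (1 / sqrt (p a) * (1 / sqrt (p a))) * (v (t - 1) \<omega> $ i * ((\<mu> (t - 1) \<omega> $ a)\<^sup>2 * u (t - 1) \<omega> $ j)) \<partial>M) = 0"
    unfolding integral_mult_right_zero by simp
  then show ?thesis
    unfolding modulate_single power2_eq_square by (simp only: mult_ac)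
qed

lemma state_noise_md_letter: "(\<integral>\<omega>. md [a] (X k) t \<omega> * md [a] (W l) t \<omega> \<partial>M) = 0"
  using state_noise_letter[of a t] unfolding cross_moment_eq_0_iff z_proc_component by simp

lemma state_noise_md: "w \<noteq> [] \<Longrightarrow> (\<integral>\<omega>. md w (X k) t \<omega> * W l t \<omega> \<partial>M) = 0"
  using state_noise[of w t] unfolding cross_moment_eq_0_iff z_proc_component by simp

text \<open>
  White noise relates words only to nonempty words. Appending a letter \<open>a\<close> to both sides brings the
  present noise into this form: \<open>wa\<close> and \<open>a\<close> are different words.
\<close>

lemma noise_past_noise_orthogonal:
  assumes "w \<noteq> []"
  shows "(\<integral>\<omega>. md w (W k) t \<omega> * W l t \<omega> \<partial>M) = 0"
proof (rule orthogonal_if_md_orthogonal)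
  show "md w (W k) \<in> adapted" "W l \<in> adapted" by (intro adapted_md components_adapted)+
  fix a
  have "w @ [a] \<noteq> [a]" using assms by simp
  then show "(\<integral>\<omega>. md [a] (md w (W k)) (t + 1) \<omega> * md [a] (W l) (t + 1) \<omega> \<partial>M) = 0"
    unfolding modulate_snoc[symmetric] by (intro noise_words_orthogonal) simp_all
qed

lemma noise_input_orthogonal: "(\<integral>\<omega>. V i t \<omega> * U j t \<omega> \<partial>M) = 0"
  by (rule orthogonal_if_md_orthogonal) (rule components_adapted noise_input_letter)+

lemma state_noise_orthogonal: "(\<integral>\<omega>. X k t \<omega> * W l t \<omega> \<partial>M) = 0"
  by (rule orthogonal_if_md_orthogonal) (rule components_adapted state_noise_md_letter)+

text \<open>
  The present input \<open>u(t)\<close> is left out, although it takes part in the definition of \<open>y\<^sup>d\<close>: it is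
  orthogonal to \<open>x(t)\<close>, and without it the projected state is visibly a limit of past words,
  which makes its modulations orthogonal to those of the present noise.
\<close>

definition past_input :: "(int \<Rightarrow> 'a \<Rightarrow> real) set" where
  "past_input = {md w (U j) | w j. w \<noteq> []}"

lemma md_past_input: "g \<in> past_input \<Longrightarrow> md w g \<in> past_input"
proof -
  assume "g \<in> past_input"
  then obtain w' j where g: "g = md w' (U j)" "w' \<noteq> []" by (auto simp: past_input_def)
  then have "md w g = md (w' @ w) (U j)" by (simp add: modulate_append)
  moreover have "w' @ w \<noteq> []" using g(2) by simp
  ultimately show "md w g \<in> past_input" unfolding past_input_def by blast
qed

lemma past_input_R: "past_input \<subseteq> R"
proof
  fix g assume "g \<in> past_input"
  then obtain w j where "g = md w (U j)" by (auto simp: past_input_def)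
  then show "g \<in> R" using modulated_modulate[OF components_in_R(3)] by simp
qed

lemma past_input_adapted: "past_input \<subseteq> adapted"
  using past_input_R R_adapted by blast

lemmas square_int_past_input = adapted_square_int[OF past_input_adapted]

lemma past_input_noise_orthogonal: "g \<in> past_input \<Longrightarrow> (\<integral>\<omega>. g t \<omega> * W l t \<omega> \<partial>M) = 0"
proof -
  assume "g \<in> past_input"
  then obtain w j where g: "g = md w (W (Inr j))" "w \<noteq> []" by (auto simp: past_input_def)
  show ?thesis unfolding g(1) by (rule noise_past_noise_orthogonal[OF g(2)])
qed

lemma state_projection_exists:
  "\<exists>P. P \<in> process_span M past_input \<and> P \<in> adapted \<and>
     (\<forall>g\<in>past_input. \<forall>t. (\<integral>\<omega>. (X k t \<omega> - P t \<omega>) * g t \<omega> \<partial>M) = 0)"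
proof -
  have "insert (X k) past_input \<subseteq> R" using past_input_R components_in_R by blast
  then have "jointly_wss M (insert (X k) past_input)" by (rule jointly_wss_subset[OF jointly_wss_R])
  then show ?thesis
  proof (rule stationary_projection)
    fix P
    assume P: "P \<in> process_span M past_input"
      "\<And>g t. g \<in> past_input \<Longrightarrow> (\<integral>\<omega>. (X k t \<omega> - P t \<omega>) * g t \<omega> \<partial>M) = 0"
      "\<And>N t. (\<And>g. g \<in> past_input \<Longrightarrow> g t \<in> borel_measurable N) \<Longrightarrow> P t \<in> borel_measurable N"
    have "P t \<in> borel_measurable (history t)" for t
      using past_input_adapted adaptedD(2) by (intro P(3)) blast
    then have "P \<in> adapted" using process_spanD[OF P(1)] by (simp add: adapted_def)
    with P(1,2) show ?thesis by blast
  qed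
qed

text \<open>
  The projection of the state onto the past input, with one version fixed for all components.
\<close>

definition Xd :: "'nx \<Rightarrow> int \<Rightarrow> 'a \<Rightarrow> real" where
  "Xd = (SOME P. \<forall>k. P k \<in> process_span M past_input \<and> P k \<in> adapted \<and>
     (\<forall>g\<in>past_input. \<forall>t. (\<integral>\<omega>. (X k t \<omega> - P k t \<omega>) * g t \<omega> \<partial>M) = 0))"

definition xd :: "int \<Rightarrow> 'a \<Rightarrow> real ^ 'nx" where "xd t \<omega> = (\<chi> k. Xd k t \<omega>)"
definition xs :: "int \<Rightarrow> 'a \<Rightarrow> real ^ 'nx" where "xs t \<omega> = x t \<omega> - xd t \<omega>"

abbreviation Xs where "Xs \<equiv> component xs"

lemma Xd_component: "component xd k = Xd k"
  by (simp add: xd_def)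

lemma Xs_eq: "xs t \<omega> $ k = x t \<omega> $ k - Xd k t \<omega>"
  by (simp add: xs_def xd_def)

lemma Xd:
  shows Xd_span: "Xd k \<in> process_span M past_input" and Xd_adapted: "Xd k \<in> adapted"
    and Xs_past_input: "g \<in> past_input \<Longrightarrow> (\<integral>\<omega>. Xs k t \<omega> * g t \<omega> \<partial>M) = 0"
proof -
  have "\<forall>k. \<exists>P. P \<in> process_span M past_input \<and> P \<in> adapted \<and>
     (\<forall>g\<in>past_input. \<forall>t. (\<integral>\<omega>. (X k t \<omega> - P t \<omega>) * g t \<omega> \<partial>M) = 0)"
    using state_projection_exists by blast
  from someI_ex[OF choice[OF this]]
  have "\<forall>k. Xd k \<in> process_span M past_input \<and> Xd k \<in> adapted \<and>
     (\<forall>g\<in>past_input. \<forall>t. (\<integral>\<omega>. (X k t \<omega> - Xd k t \<omega>) * g t \<omega> \<partial>M) = 0)"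
    unfolding Xd_def .
  then show "Xd k \<in> process_span M past_input" "Xd k \<in> adapted"
    "g \<in> past_input \<Longrightarrow> (\<integral>\<omega>. Xs k t \<omega> * g t \<omega> \<partial>M) = 0"
    unfolding Xs_eq by blast+
qed

lemma Xs_adapted: "Xs k \<in> adapted"
  unfolding Xs_eq by (intro adapted_diff components_adapted Xd_adapted)

lemma Xd_span_R: "Xd k \<in> process_span M R"
  using Xd_span process_span_mono[OF past_input_R] by blast

lemma Xs_span_R: "Xs k \<in> process_span M R"
  unfolding Xs_eq using components_in_R(1) R_span
  by (intro process_span_diff[OF square_int_R] Xd_span_R) blast

lemma Xd_noise_orthogonal: "(\<integral>\<omega>. md w (Xd k) t \<omega> * W l t \<omega> \<partial>M) = 0"
proof (rule process_span_orthogonal)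
  have "md w ` past_input \<subseteq> past_input" using md_past_input by blast
  then show "md w (Xd k) \<in> process_span M past_input"
    using process_span_md[OF Xd_adapted Xd_span past_input_adapted, of w k] process_span_mono by blast
  show "square_int M (W l t)" using components_adapted(4) by (rule adaptedD)
qed (use square_int_past_input past_input_noise_orthogonal in auto)

text \<open>
  Modulation makes the past input words longer than one letter, so they differ from the
  one-letter words of the noise.
\<close>

lemma Xd_noise_letter: "(\<integral>\<omega>. md [a] (Xd k) t \<omega> * md [a] (W l) t \<omega> \<partial>M) = 0"
proof (rule process_span_orthogonal)
  show "md [a] (Xd k) \<in> process_span M (md [a] ` past_input)"
    by (rule process_span_md[OF Xd_adapted Xd_span past_input_adapted])
  show "md [a] ` past_input \<subseteq> square_int_processes M"
    using past_input_adapted adapted_md by (intro adapted_square_int) blast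
  show "square_int M (md [a] (W l) t)" using adapted_md[OF components_adapted(4)] by (rule adaptedD)
  fix g assume "g \<in> md [a] ` past_input"
  then obtain w j where w: "w \<noteq> []" and g: "g = md [a] (md w (W (Inr j)))" by (auto simp: past_input_def)
  show "(\<integral>\<omega>. g t \<omega> * md [a] (W l) t \<omega> \<partial>M) = 0"
    unfolding g modulate_snoc[symmetric] using w by (intro noise_words_orthogonal) simp_all
qed

lemma integral_diff_eq_0:
  assumes "square_int M f" "square_int M g" "square_int M h"
    and "(\<integral>\<omega>. f \<omega> * h \<omega> \<partial>M) = 0" "(\<integral>\<omega>. g \<omega> * h \<omega> \<partial>M) = 0"
  shows "(\<integral>\<omega>. (f \<omega> - g \<omega>) * h \<omega> \<partial>M) = 0"
  using assms by (simp add: left_diff_distrib square_int_mult_integrable)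

lemma md_Xs: "md w (Xs k) t \<omega> = md w (X k) t \<omega> - md w (Xd k) t \<omega>"
  by (simp add: modulate_def Xs_eq right_diff_distrib)

lemma Xs_noise_letter: "(\<integral>\<omega>. md [a] (Xs k) t \<omega> * md [a] (W l) t \<omega> \<partial>M) = 0"
  unfolding md_Xs
  by (intro integral_diff_eq_0 state_noise_md_letter Xd_noise_letter adaptedD(1) adapted_md components_adapted Xd_adapted)

lemma Xs_noise_orthogonal: "(\<integral>\<omega>. md w (Xs k) t \<omega> * W l t \<omega> \<partial>M) = 0"
proof -
  have "(\<integral>\<omega>. md w (X k) t \<omega> * W l t \<omega> \<partial>M) = 0"
    using state_noise_md state_noise_orthogonal by (cases "w = []") simp_all
  then show ?thesis
    unfolding md_Xs
    by (intro integral_diff_eq_0 Xd_noise_orthogonal adaptedD(1) adapted_md components_adapted Xd_adapted)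
qed

text \<open>
  Compare the last letter \<open>b\<close> of the word with \<open>a\<close>. If they differ, the moment vanishes. If they agree
  and the word is the single letter \<open>a\<close>, it is the assumption on the state together with
  \<open>Xd_noise_letter\<close>. Otherwise \<open>md_same_letter\<close> removes the common letter and leaves the
  orthogonality of the residual to a shorter past input word.
\<close>

lemma Xs_letter_past_input:
  assumes "g \<in> past_input"
  shows "(\<integral>\<omega>. md [a] (Xs k) t \<omega> * g t \<omega> \<partial>M) = 0"
proof -
  obtain w j where w: "w \<noteq> []" and g: "g = md w (U j)" using assms by (auto simp: past_input_def)
  obtain w' b where w': "w = w' @ [b]" using w by (cases w rule: rev_cases) auto
  have g': "g = md [b] (md w' (U j))" unfolding g w' by (rule modulate_snoc)
  show ?thesis
  proof (cases "a = b")
    case False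
    then show ?thesis
      unfolding g' by (intro md_cross_letters Xs_adapted adapted_md components_adapted)
  next
    case True
    show ?thesis
    proof (cases w' rule: rev_cases)
      case Nil
      then show ?thesis using Xs_noise_letter[of a k t "Inr j"] by (simp add: g' True)
    next
      case (snoc w'' c)
      have "md [c] (md w'' (U j)) \<in> past_input"
        unfolding past_input_def modulate_snoc[symmetric] by blast
      then have "(\<integral>\<omega>. Xs k (t - 1) \<omega> * md [c] (md w'' (U j)) (t - 1) \<omega> \<partial>M) = 0"
        by (rule Xs_past_input)
      then show ?thesis
        using md_same_letter[OF Xs_adapted adapted_md[OF components_adapted(3)], where a=b and b=c and t=t]
        unfolding g' True snoc modulate_snoc by simp
    qed
  qed
qed

lemma V_letter_past_input:
  assumes "g \<in> past_input"
  shows "(\<integral>\<omega>. md [a] (V i) t \<omega> * g t \<omega> \<partial>M) = 0"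
proof -
  obtain w j where w: "w \<noteq> []" and g: "g = md w (U j)" using assms by (auto simp: past_input_def)
  show ?thesis
  proof (cases "w = [a]")
    case True then show ?thesis unfolding g by (simp only: noise_input_letter)
  next
    case False
    then show ?thesis
      using noise_words_orthogonal[of "[a]" w "Inl i" t "Inr j"] w by (simp add: g)
  qed
qed

text \<open>
  Component \<open>k\<close> of \<open>\<Sum> \<mu>\<^sub>a(t - 1) N\<^sub>a Y(t - 1)\<close>; the factor \<open>\<surd>p\<^sub>a\<close> undoes the normalisation in the modulation.
\<close>

definition update :: "('n \<Rightarrow> int \<Rightarrow> 'a \<Rightarrow> real) \<Rightarrow> ('s \<Rightarrow> real ^ 'n ^ 'nx) \<Rightarrow> 'nx \<Rightarrow> int \<Rightarrow> 'a \<Rightarrow> real" where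
  "update Y N k t \<omega> = (\<Sum>a\<in>UNIV. \<Sum>l\<in>UNIV. (sqrt (p a) * N a $ k $ l) * md [a] (Y l) t \<omega>)"

lemma update_eq:
  "update (component y) N k (t + 1) \<omega> = (\<Sum>a\<in>UNIV. \<mu> t \<omega> $ a *\<^sub>R (N a *v y t \<omega>)) $ k"
proof -
  have "(sqrt (p a) * N a $ k $ l) * md [a] (component y l) (t + 1) \<omega> = \<mu> t \<omega> $ a * (N a $ k $ l * y t \<omega> $ l)" for a l
    using p_pos[of a] by (simp add: modulate_single)
  then have "update (component y) N k (t + 1) \<omega> = (\<Sum>a\<in>UNIV. \<Sum>l\<in>UNIV. \<mu> t \<omega> $ a * (N a $ k $ l * y t \<omega> $ l))"
    by (simp only: update_def)
  then show ?thesis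
    by (simp add: matrix_vector_mult_def sum_distrib_left)
qed

lemma update_span:
  assumes S: "S \<subseteq> square_int_processes M" and Y: "\<And>a l. md [a] (Y l) \<in> process_span M S"
  shows "update Y N k \<in> process_span M S"
  unfolding update_def[abs_def]
  by (intro process_span_sum process_span_cmult S Y)

lemma update_orthogonal:
  assumes Y: "\<And>l. Y l \<in> adapted" and Z: "square_int M Z"
    and orth: "\<And>a l. (\<integral>\<omega>. md [a] (Y l) t \<omega> * Z \<omega> \<partial>M) = 0"
  shows "(\<integral>\<omega>. update Y N k t \<omega> * Z \<omega> \<partial>M) = 0" "square_int M (update Y N k t)"
proof -
  have md: "square_int M (md [a] (Y l) t)" for a l using adapted_md[OF Y] by (rule adaptedD)
  show "(\<integral>\<omega>. update Y N k t \<omega> * Z \<omega> \<partial>M) = 0"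
    unfolding update_def sum_distrib_right mult.assoc
    by (simp add: square_int_mult_integrable md Z orth)
  show "square_int M (update Y N k t)"
    unfolding update_def[abs_def] by (intro square_int_sum square_int_cmult md)
qed

text \<open>
  Split the state equation into the contribution of \<open>x\<^sup>d\<close> and \<open>u\<close>, which is in the span of the past
  input, and that of \<open>x\<^sup>s\<close> and \<open>v\<close>, which is orthogonal to it. Both sides of the claim then
  lie in the span and have the same inner products with the past input as the state.
\<close>

lemma Xd_update: "AE \<omega> in M. Xd k t \<omega> = update Xd A k t \<omega> + update U B k t \<omega>"
proof -
  let ?Q = "\<lambda>t \<omega>. update Xd A k t \<omega> + update U B k t \<omega>"
  let ?e = "\<lambda>\<omega>. update Xs A k t \<omega> + update V K k t \<omega>"
  have mdU: "md [a] (U j) \<in> process_span M past_input" for a j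
    by (rule process_span_base[OF square_int_past_input]) (auto simp: past_input_def)
  have mdXd: "md [a] (Xd l) \<in> process_span M past_input" for a l
  proof -
    have "md [a] ` past_input \<subseteq> past_input" using md_past_input by blast
    then show ?thesis
      using process_span_md[OF Xd_adapted Xd_span past_input_adapted, of "[a]" l] process_span_mono by blast
  qed
  have Q: "?Q \<in> process_span M past_input"
    by (intro process_span_add square_int_past_input update_span mdU mdXd)
  have X_eq: "AE \<omega> in M. X k t \<omega> = ?Q t \<omega> + ?e \<omega>"
    using state[of "t - 1"]
  proof eventually_elim
    case (elim \<omega>)
    have lin: "update X A k t \<omega> = update Xd A k t \<omega> + update Xs A k t \<omega>"
      unfolding update_def sum.distrib[symmetric] distrib_left[symmetric] md_Xs by simp
    have "x t \<omega> $ k = update X A k t \<omega> + update U B k t \<omega> + update V K k t \<omega>"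
      using elim update_eq[of x A k "t - 1" \<omega>] update_eq[of u B k "t - 1" \<omega>] update_eq[of v K k "t - 1" \<omega>]
      by (simp add: scaleR_add_right sum.distrib)
    with lin show ?case by simp
  qed
  have e: "(\<integral>\<omega>. ?e \<omega> * g t \<omega> \<partial>M) = 0" "square_int M ?e" if g: "g \<in> past_input" for g
  proof -
    have gs: "square_int M (g t)" using g square_int_past_input by (auto simp: square_int_processes_def)
    note s = update_orthogonal[OF Xs_adapted gs Xs_letter_past_input[OF g], where N = A and k = k]
    note n = update_orthogonal[OF components_adapted(2) gs V_letter_past_input[OF g], where N = K and k = k]
    show "square_int M ?e" using s(2) n(2) by (rule square_int_add)
    show "(\<integral>\<omega>. ?e \<omega> * g t \<omega> \<partial>M) = 0"
      using s n gs by (simp add: distrib_right square_int_mult_integrable)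
  qed
  show ?thesis
  proof (rule process_span_AE_unique[OF square_int_past_input Xd_span Q])
    fix g assume g: "g \<in> past_input"
    have gs: "square_int M (g t)" using g square_int_past_input by (auto simp: square_int_processes_def)
    have Xk: "square_int M (X k t)" using components_adapted(1) by (rule adaptedD)
    have Xdk: "square_int M (Xd k t)" using Xd_adapted by (rule adaptedD)
    note Qs = process_spanD[OF Q, of t]
    have "(\<integral>\<omega>. X k t \<omega> * g t \<omega> \<partial>M) - (\<integral>\<omega>. Xd k t \<omega> * g t \<omega> \<partial>M) = (\<integral>\<omega>. (X k t \<omega> - Xd k t \<omega>) * g t \<omega> \<partial>M)"
      by (simp add: left_diff_distrib square_int_mult_integrable gs Xk Xdk)
    also have "\<dots> = 0" using Xs_past_input[OF g, where k = k and t = t] by (simp only: Xs_eq)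
    finally have 1: "(\<integral>\<omega>. X k t \<omega> * g t \<omega> \<partial>M) = (\<integral>\<omega>. Xd k t \<omega> * g t \<omega> \<partial>M)" by simp
    have "(\<integral>\<omega>. X k t \<omega> * g t \<omega> \<partial>M) = (\<integral>\<omega>. ?Q t \<omega> * g t \<omega> + ?e \<omega> * g t \<omega> \<partial>M)"
    proof (rule integral_cong_AE)
      show "AE \<omega> in M. X k t \<omega> * g t \<omega> = ?Q t \<omega> * g t \<omega> + ?e \<omega> * g t \<omega>"
        using X_eq by eventually_elim (simp add: distrib_right)
    qed (use square_intD(1)[OF gs] square_intD(1)[OF Xk] square_intD(1)[OF Qs] square_intD(1)[OF e(2)[OF g]] in auto)
    also have "\<dots> = (\<integral>\<omega>. ?Q t \<omega> * g t \<omega> \<partial>M) + (\<integral>\<omega>. ?e \<omega> * g t \<omega> \<partial>M)"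
      by (intro Bochner_Integration.integral_add square_int_mult_integrable Qs e(2)[OF g] gs)
    finally show "(\<integral>\<omega>. Xd k t \<omega> * g t \<omega> \<partial>M) = (\<integral>\<omega>. ?Q t \<omega> * g t \<omega> \<partial>M)"
      using 1 e(1)[OF g] by simp
  qed
qed



lemma xd_state:
  "AE \<omega> in M. xd (t + 1) \<omega> = (\<Sum>i\<in>UNIV. \<mu> t \<omega> $ i *\<^sub>R (A i *v xd t \<omega> + B i *v u t \<omega>))"
proof (rule all_components_AE)
  fix k
  show "AE \<omega> in M. xd (t + 1) \<omega> $ k = (\<Sum>i\<in>UNIV. \<mu> t \<omega> $ i *\<^sub>R (A i *v xd t \<omega> + B i *v u t \<omega>)) $ k"
    using Xd_update[of k "t + 1"]
  proof eventually_elim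
    case (elim \<omega>)
    then have "xd (t + 1) \<omega> $ k = (\<Sum>i\<in>UNIV. \<mu> t \<omega> $ i *\<^sub>R (A i *v xd t \<omega>)) $ k
        + (\<Sum>i\<in>UNIV. \<mu> t \<omega> $ i *\<^sub>R (B i *v u t \<omega>)) $ k"
      using update_eq[of xd A k t \<omega>] update_eq[of u B k t \<omega>] unfolding Xd_component[symmetric] by simp
    then show ?case by (simp add: scaleR_add_right sum.distrib)
  qed
qed

lemma xs_state:
  "AE \<omega> in M. xs (t + 1) \<omega> = (\<Sum>i\<in>UNIV. \<mu> t \<omega> $ i *\<^sub>R (A i *v xs t \<omega> + K i *v v t \<omega>))"
  using state[of t] xd_state[of t]
proof eventually_elim
  case (elim \<omega>)
  have "xs (t + 1) \<omega>
      = (\<Sum>i\<in>UNIV. \<mu> t \<omega> $ i *\<^sub>R (A i *v x t \<omega> + B i *v u t \<omega> + K i *v v t \<omega>)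
          - \<mu> t \<omega> $ i *\<^sub>R (A i *v xd t \<omega> + B i *v u t \<omega>))"
    unfolding xs_def elim sum_subtractf ..
  also have "\<dots> = (\<Sum>i\<in>UNIV. \<mu> t \<omega> $ i *\<^sub>R (A i *v xs t \<omega> + K i *v v t \<omega>))"
    unfolding scaleR_diff_right[symmetric] xs_def
    by (intro sum.cong refl arg_cong2[where f = scaleR]) (simp add: matrix_vector_mult_diff_distrib)
  finally show ?case .
qed

text \<open>
  The right-hand side lies in the span of \<open>u(t)\<close> and the past input, and what is missing from
  \<open>y(t)\<close> is \<open>C x\<^sup>s(t) + F v(t)\<close>, which is orthogonal to both.
\<close>

lemma y_det_eq:
  fixes C :: "real ^ 'nx ^ 'ny::finite"
  assumes y: "AE \<omega> in M. y t \<omega> = C *v x t \<omega> + D *v u t \<omega> + F *v v t \<omega>"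
    and ysq: "\<And>i. square_int M (\<lambda>\<omega>. y t \<omega> $ i)"
  shows "AE \<omega> in M. y_det M \<mu> p y u t \<omega> = C *v xd t \<omega> + D *v u t \<omega>"
proof (rule all_components_AE)
  fix i
  let ?S = "past_input \<union> range U"
  let ?V = "closed_span M {g t | g. g \<in> ?S}"
  let ?P = "\<lambda>t \<omega>. (\<Sum>l\<in>UNIV. C $ i $ l * Xd l t \<omega>) + (\<Sum>j\<in>UNIV. D $ i $ j * U j t \<omega>)"
  let ?e = "\<lambda>\<omega>. (\<Sum>l\<in>UNIV. C $ i $ l * Xs l t \<omega>) + (\<Sum>j\<in>UNIV. F $ i $ j * V j t \<omega>)"
  have S: "?S \<subseteq> adapted" using past_input_adapted components_adapted by blast
  have Ssq: "square_int M (g t)" if "g \<in> ?S" for g t using S that adaptedD(1) by blast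
  have gens: "{\<lambda>\<omega>. Y \<omega> $ j | Y j. Y \<in> {z_proc \<mu> p u w t | w. w \<noteq> []} \<union> {u t}} = {g t | g. g \<in> ?S}"
  proof -
    have z: "(\<lambda>\<omega>. z_proc \<mu> p u w t \<omega> $ j) = md w (U j) t" for w j
      by (simp add: fun_eq_iff z_proc_component)
    show ?thesis
    proof (rule set_eqI, rule iffI)
      fix f assume "f \<in> {\<lambda>\<omega>. Y \<omega> $ j | Y j. Y \<in> {z_proc \<mu> p u w t | w. w \<noteq> []} \<union> {u t}}"
      then obtain Y j where f: "f = (\<lambda>\<omega>. Y \<omega> $ j)" and Y: "(\<exists>w. Y = z_proc \<mu> p u w t \<and> w \<noteq> []) \<or> Y = u t"
        by auto
      from Y show "f \<in> {g t | g. g \<in> ?S}"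
      proof
        assume "\<exists>w. Y = z_proc \<mu> p u w t \<and> w \<noteq> []"
        then obtain w where w: "Y = z_proc \<mu> p u w t" "w \<noteq> []" by auto
        have "f = md w (U j) t" unfolding f w z ..
        moreover have "md w (U j) \<in> ?S" using w(2) by (auto simp: past_input_def)
        ultimately show ?thesis by (intro CollectI exI conjI)
      next
        assume "Y = u t"
        then have "f = U j t" using f by simp
        moreover have "U j \<in> ?S" by simp
        ultimately show ?thesis by (intro CollectI exI[of _ "U j"] conjI)
      qed
    next
      fix f assume "f \<in> {g t | g. g \<in> ?S}"
      then obtain g where f: "f = g t" and g: "g \<in> past_input \<or> g \<in> range U" by auto
      from g show "f \<in> {\<lambda>\<omega>. Y \<omega> $ j | Y j. Y \<in> {z_proc \<mu> p u w t | w. w \<noteq> []} \<union> {u t}}"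
      proof
        assume "g \<in> past_input"
        then obtain w j where w: "g = md w (U j)" "w \<noteq> []" by (auto simp: past_input_def)
        have "f = (\<lambda>\<omega>. z_proc \<mu> p u w t \<omega> $ j)" unfolding f w z ..
        then show ?thesis using w(2) by (intro CollectI exI[of _ "z_proc \<mu> p u w t"] exI[of _ j]) auto
      next
        assume "g \<in> range U"
        then obtain j where "f = (\<lambda>\<omega>. u t \<omega> $ j)" unfolding f by auto
        then show ?thesis by (intro CollectI exI[of _ "u t"] exI[of _ j]) auto
      qed
    qed
  qed
  have Xdl: "Xd l \<in> process_span M ?S" for l using Xd_span process_span_mono[of past_input ?S M] by blast
  have Uj: "U j \<in> process_span M ?S" for j by (rule process_span_base[OF adapted_square_int[OF S]]) blast
  have P: "?P \<in> process_span M ?S"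
    by (intro process_span_add process_span_sum process_span_cmult adapted_square_int[OF S] Xdl Uj)
  have Xs_sq: "square_int M (Xs l t)" for l using Xs_adapted by (rule adaptedD)
  have V_sq: "square_int M (V j t)" for j using components_adapted(2) by (rule adaptedD)
  have e: "square_int M ?e" by (intro square_int_add square_int_sum square_int_cmult Xs_sq V_sq)
  have e_orth: "(\<integral>\<omega>. ?e \<omega> * g t \<omega> \<partial>M) = 0" if g: "g \<in> ?S" for g
  proof -
    have "(\<integral>\<omega>. Xs l t \<omega> * g t \<omega> \<partial>M) = 0" for l
    proof (cases "g \<in> past_input")
      case True then show ?thesis by (rule Xs_past_input)
    next
      case False
      then obtain j where "g = U j" using g by blast
      then show ?thesis using Xs_noise_orthogonal[of "[]" l t "Inr j"] by simp
    qed
    moreover have "(\<integral>\<omega>. V j t \<omega> * g t \<omega> \<partial>M) = 0" for j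
    proof (cases "g \<in> past_input")
      case True
      then show ?thesis using past_input_noise_orthogonal[of g t "Inl j"] by (simp add: mult.commute)
    next
      case False
      then obtain j where "g = U j" using g by blast
      then show ?thesis using noise_input_orthogonal by simp
    qed
    ultimately show ?thesis
      by (simp add: distrib_right sum_distrib_right mult.assoc square_int_mult_integrable Xs_sq V_sq Ssq[OF g])
  qed
  have res: "AE \<omega> in M. y t \<omega> $ i - ?P t \<omega> = ?e \<omega>"
    using y by eventually_elim
      (simp add: matrix_vector_mult_def Xs_eq right_diff_distrib sum_subtractf)
  have Pt: "square_int M (?P t)" using P by (rule process_spanD)
  have "AE \<omega> in M. orth_proj M ?V (\<lambda>\<omega>. y t \<omega> $ i) \<omega> = ?P t \<omega>"
  proof (rule orth_proj_AE_eq[OF ysq])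
    show "square_int M Z" if "Z \<in> ?V" for Z using that by (simp add: closed_span_def)
    show "?P t \<in> ?V" using P by (rule process_span_slice)
    fix Z assume Z: "Z \<in> ?V"
    have Zsq: "square_int M Z" using Z by (simp add: closed_span_def)
    have "(\<integral>\<omega>. (y t \<omega> $ i - ?P t \<omega>) * Z \<omega> \<partial>M) = (\<integral>\<omega>. ?e \<omega> * Z \<omega> \<partial>M)"
    proof (rule integral_cong_AE)
      show "AE \<omega> in M. (y t \<omega> $ i - ?P t \<omega>) * Z \<omega> = ?e \<omega> * Z \<omega>"
        using res by eventually_elim simp
      show "(\<lambda>\<omega>. (y t \<omega> $ i - ?P t \<omega>) * Z \<omega>) \<in> borel_measurable M"
        by (intro borel_measurable_times square_intD(1)[OF Zsq] square_intD(1)[OF square_int_diff[OF ysq Pt]])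
      show "(\<lambda>\<omega>. ?e \<omega> * Z \<omega>) \<in> borel_measurable M"
        by (intro borel_measurable_times square_intD(1)[OF Zsq] square_intD(1)[OF e])
    qed
    also have "\<dots> = 0"
    proof (rule closed_span_orthogonal[OF _ Z e])
      show "square_int M g" if "g \<in> {g t | g. g \<in> ?S}" for g using that Ssq by blast
      show "(\<integral>\<omega>. ?e \<omega> * g \<omega> \<partial>M) = 0" if "g \<in> {g t | g. g \<in> ?S}" for g using that e_orth by blast
    qed
    finally show "(\<integral>\<omega>. (y t \<omega> $ i - ?P t \<omega>) * Z \<omega> \<partial>M) = 0" .
  qed
  then show "AE \<omega> in M. y_det M \<mu> p y u t \<omega> $ i = (C *v xd t \<omega> + D *v u t \<omega>) $ i"
  proof eventually_elim
    case (elim \<omega>)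
    then show ?case
      unfolding y_det_def lin_proj_def gens by (simp add: matrix_vector_mult_def xd_def)
  qed
qed

lemma zmwssi_xd_u: "zmwssi M \<mu> p (stack xd u)"
proof (rule zmwssi_from_components)
  fix l :: "'nx + 'nu"
  show "component (stack xd u) l \<in> process_span M R"
    using R_span components_in_R(3) by (cases l) (auto simp: xd_def Xd_span_R)
  show "component (stack xd u) l \<in> adapted"
    using components_adapted(3) by (cases l) (simp_all add: xd_def Xd_adapted)
qed

lemma zmwssi_xs_v: "zmwssi M \<mu> p (stack xs v)"
proof (rule zmwssi_from_components)
  fix l :: "'nx + 'nn"
  show "component (stack xs v) l \<in> process_span M R"
    using R_span components_in_R(2) Xs_span_R by (cases l) auto
  show "component (stack xs v) l \<in> adapted"
    using components_adapted(2) Xs_adapted by (cases l) simp_all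
qed

text \<open>
  Since \<open>v\<close> and \<open>u\<close> stay uncorrelated after modulation by a letter, the noise covariance is block
  diagonal, and its invertibility passes to the block of \<open>v\<close>.
\<close>

lemma letter_moment_blocks:
  shows "cross_moment M (z_proc \<mu> p (stack v u) w t) (z_proc \<mu> p (stack v u) w' t) $ Inl i $ Inl j
      = cross_moment M (z_proc \<mu> p v w t) (z_proc \<mu> p v w' t) $ i $ j"
    and "cross_moment M (z_proc \<mu> p (stack v u) [a] t) (z_proc \<mu> p (stack v u) [a] t) $ Inr k $ Inl j = 0"
proof -
  show "cross_moment M (z_proc \<mu> p (stack v u) w t) (z_proc \<mu> p (stack v u) w' t) $ Inl i $ Inl j
      = cross_moment M (z_proc \<mu> p v w t) (z_proc \<mu> p v w' t) $ i $ j"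
    unfolding cross_moment_component z_proc_component by simp
  show "cross_moment M (z_proc \<mu> p (stack v u) [a] t) (z_proc \<mu> p (stack v u) [a] t) $ Inr k $ Inl j = 0"
    unfolding cross_moment_component z_proc_component
    using noise_input_letter[of a j t k] by (simp add: mult.commute)
qed

lemma noise_moment_invertible:
  "invertible (cross_moment M (z_proc \<mu> p (stack v u) [a] t) (z_proc \<mu> p (stack v u) [a] t))"
  using noise by (simp add: white_noise_def)

lemma white_noise_v: "white_noise M \<mu> E p v"
  unfolding white_noise_def
proof (intro conjI allI impI)
  show "zmwssi M \<mu> p v"
    using R_span components_in_R(2) components_adapted(2) by (intro zmwssi_from_components) blast+
next
  fix w s :: "'s list" and a t assume w: "w \<noteq> []" "w \<noteq> a # s"
  show "cross_moment M (z_proc \<mu> p v w t) (z_proc \<mu> p v (a # s) t) = 0"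
    unfolding cross_moment_eq_0_iff z_proc_component
    using noise_words_orthogonal[OF w(1) _ w(2), of "Inl _" t "Inl _"] by simp
next
  fix w s :: "'s list" and a t assume "w = a # s \<and> w \<in> adm_words E"
  then have "cross_moment M (z_proc \<mu> p (stack v u) w t) (z_proc \<mu> p (stack v u) (a # s) t)
      = cross_moment M (z_proc \<mu> p (stack v u) [a] t) (z_proc \<mu> p (stack v u) [a] t)"
    using white_noise_same_word[OF noise, of a s t] by auto
  then show "cross_moment M (z_proc \<mu> p v w t) (z_proc \<mu> p v (a # s) t)
      = cross_moment M (z_proc \<mu> p v [a] t) (z_proc \<mu> p v [a] t)"
    unfolding vec_eq_iff[of "cross_moment M (z_proc \<mu> p v w t) _"] vec_eq_iff[of "cross_moment M (z_proc \<mu> p v w t) _ $ _"]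
      letter_moment_blocks(1)[symmetric] by simp
next
  fix a t
  show "invertible (cross_moment M (z_proc \<mu> p v [a] t) (z_proc \<mu> p v [a] t))"
    by (rule invertible_diagonal_block[OF noise_moment_invertible letter_moment_blocks])
qed

lemma xd_noise_moments:
  "cross_moment M (z_proc \<mu> p xd [a] t) (z_proc \<mu> p u [a] t) = 0"
  "cross_moment M (z_proc \<mu> p xd w t) (u t) = 0"
  unfolding cross_moment_eq_0_iff z_proc_component Xd_component
  using Xd_noise_letter[of a _ t "Inr _"] Xd_noise_orthogonal[of w _ t "Inr _"] by simp_all

lemma xs_noise_moments:
  "cross_moment M (z_proc \<mu> p xs [a] t) (z_proc \<mu> p v [a] t) = 0"
  "cross_moment M (z_proc \<mu> p xs w t) (v t) = 0"
  unfolding cross_moment_eq_0_iff z_proc_component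
  using Xs_noise_letter[of a _ t "Inl _"] Xs_noise_orthogonal[of w _ t "Inl _"] by simp_all

end

theorem theorem1:
  fixes M :: "'a measure"
    and \<mu> :: "int \<Rightarrow> 'a \<Rightarrow> real ^ 's::finite"
    and E :: "('s \<times> 's) set" and p :: "'s \<Rightarrow> real"
    and y :: "int \<Rightarrow> 'a \<Rightarrow> real ^ 'ny::finite"
    and u :: "int \<Rightarrow> 'a \<Rightarrow> real ^ 'nu::finite"
    and v :: "int \<Rightarrow> 'a \<Rightarrow> real ^ 'nn::finite"
    and A :: "'s \<Rightarrow> real ^ 'nx::finite ^ 'nx"
    and K :: "'s \<Rightarrow> real ^ 'nn ^ 'nx"
    and B :: "'s \<Rightarrow> real ^ 'nu ^ 'nx"
    and C :: "real ^ 'nx ^ 'ny" and D :: "real ^ 'nu ^ 'ny" and F :: "real ^ 'nn ^ 'ny"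
  assumes "prob_space M"
    and "admissible M \<mu> E p"
    and "white_noise M \<mu> E p u"
    and "zmwssi M \<mu> p (stack y u)"
    and "sGLSS M \<mu> E p y u A K B C D F v"
  shows "asGLSS M \<mu> E p (y_det M \<mu> p y u) A B C D u \<and>
         asGLSS M \<mu> E p (y_sto M \<mu> p y u) A K C F v"
proof -
  obtain x :: "int \<Rightarrow> 'a \<Rightarrow> real ^ 'nx" where
    state: "\<forall>t. AE \<omega> in M. x (t + 1) \<omega>
        = (\<Sum>i\<in>UNIV. \<mu> t \<omega> $ i *\<^sub>R (A i *v x t \<omega> + B i *v u t \<omega> + K i *v v t \<omega>))"
    and out: "\<forall>t. AE \<omega> in M. y t \<omega> = C *v x t \<omega> + D *v u t \<omega> + F *v v t \<omega>"
    and noise: "white_noise M \<mu> E p (stack v u)"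
    and vu: "\<forall>a t. cross_moment M (v t) (\<lambda>\<omega>. (\<mu> t \<omega> $ a)\<^sup>2 *\<^sub>R u t \<omega>) = 0"
    and wss: "zmwssi M \<mu> p (stack x (stack v u))"
    and letter: "\<forall>a t. cross_moment M (z_proc \<mu> p x [a] t) (z_proc \<mu> p (stack v u) [a] t) = 0"
    and word: "\<forall>w t. w \<noteq> [] \<longrightarrow> cross_moment M (z_proc \<mu> p x w t) (stack v u t) = 0"
    and stable: "\<forall>l \<in> complex_eigenvalues (\<Sum>a\<in>UNIV. p a *\<^sub>R kronecker (A a) (A a)). cmod l < 1"
    and edges: "\<forall>a b. (a, b) \<notin> E \<longrightarrow> A b ** A a = 0 \<and>
           (\<forall>t. A b ** hcat (K a) (B a) **
              cross_moment M (z_proc \<mu> p (stack v u) [a] t) (z_proc \<mu> p (stack v u) [a] t) = 0)"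
    using assms(5) unfolding sGLSS_def by (elim exE conjE)
  interpret prob_space M by fact
  interpret stationary_realization M \<mu> E p x v u A K B
  proof unfold_locales
    show "admissible M \<mu> E p" by fact
    show "zmwssi M \<mu> p (stack x (stack v u))" by fact
    show "white_noise M \<mu> E p (stack v u)" by fact
  qed (use state vu letter word in simp_all)
  have ysq: "square_int M (\<lambda>\<omega>. y t \<omega> $ i)" for t i
  proof -
    have "\<forall>a\<in>modulated \<mu> p (stack y u). \<forall>t. square_int M (a t)"
      using assms(4) by (simp add: zmwssi_iff jointly_wss_def)
    from bspec[OF this modulated_component[of "stack y u" "Inl i"]] show ?thesis by simp
  qed
  have det: "AE \<omega> in M. y_det M \<mu> p y u t \<omega> = C *v xd t \<omega> + D *v u t \<omega>" for t
    by (rule y_det_eq[OF out[rule_format] ysq])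
  have sto: "AE \<omega> in M. y_sto M \<mu> p y u t \<omega> = C *v xs t \<omega> + F *v v t \<omega>" for t
    using det[of t] out[rule_format, of t]
    by eventually_elim (simp add: y_sto_def xs_def matrix_vector_mult_diff_distrib)
  have edge: "A b ** A a = 0" "A b ** K a = 0" "A b ** B a = 0" if "(a, b) \<notin> E" for a b
    using edges that hcat_mult_zero[OF noise_moment_invertible, of "A b" "K a" "B a" a 0] by simp_all
  have "asGLSS M \<mu> E p (y_det M \<mu> p y u) A B C D u"
    unfolding asGLSS_def
  proof (rule exI[of _ xd], intro conjI allI impI)
    show "A b ** B a ** cross_moment M (z_proc \<mu> p u [a] t) (z_proc \<mu> p u [a] t) = 0" if "(a, b) \<notin> E" for a b t
      by (simp add: edge[OF that])
  qed (rule xd_state det assms(3) zmwssi_xd_u xd_noise_moments stable edge, assumption?)+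
  moreover have "asGLSS M \<mu> E p (y_sto M \<mu> p y u) A K C F v"
    unfolding asGLSS_def
  proof (rule exI[of _ xs], intro conjI allI impI)
    show "A b ** K a ** cross_moment M (z_proc \<mu> p v [a] t) (z_proc \<mu> p v [a] t) = 0" if "(a, b) \<notin> E" for a b t
      by (simp add: edge[OF that])
  qed (rule xs_state sto white_noise_v zmwssi_xs_v xs_noise_moments stable edge, assumption?)+
  ultimately show ?thesis by blast
qed

end
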